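(* Let $p$ be a prime, $G$ a finite Abelian $p$-group and $n\geq 3$ a natural number. (1) Unless $G$ is cyclic, the group $\widetilde{\mathcal K}(G,n)$ is nilpotent of class $2$. (2) The commutator subgroup of $\widetilde{\mathcal K}(G,n)$ is equal to $H_2(G,\mathbb Z)$, embedded via the central short exact sequence $0\to H_2(G,\mathbb Z)\to\widetilde{\mathcal K}(G,n)\to G^{n-1}\to 1$. (3) The Frattini subgroup $\Phi(\widetilde{\mathcal K}(G,n))$ is an extension of $H_2(G,\mathbb Z)$ by $\Phi(G)^{n-1}$, i.e. there is a short exact sequence $0\to H_2(G,\mathbb Z)\to\Phi(\widetilde{\mathcal K}(G,n))\to\Phi(G)^{n-1}\to 1$.
   Context: For a group $G$ and $n\geq 2$, let $G^{\rm ab}=G/[G,G]$ and let $\mathcal K(G,n)$ be the kernel of the homomorphism $G^n\to G^{\rm ab}$, $(g_1,\dots,g_n)\mapsto\overline{g_1\cdots g_n}$. Choose a presentation $G\cong F/N$ with $F$ a free group and $N$ a normal subgroup of $F$. Let $\langle\langle\mathcal K(N,n)\rangle\rangle$ be the normal closure of $\mathcal K(N,n)$ in $F^n$ (it is contained in $\mathcal K(F,n)$), and define $\widetilde{\mathcal K}(G,n):=\mathcal K(F,n)/\langle\langle\mathcal K(N,n)\rangle\rangle$. Up to isomorphism this does not depend on the choice of presentation. There is a central short exact sequence $0\to H_2(G,\mathbb Z)\to\widetilde{\mathcal K}(G,n)\to\mathcal K(G,n)\to 1$: identifying $H_2(G,\mathbb Z)$ with $(N\cap[F,F])/[F,N]$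 by Hopf's formula, the first map is $x\mapsto(x,1,\dots,1)$, and the second is induced by $F^n\to G^n$. For $G$ Abelian, $\mathcal K(G,n)\cong G^{n-1}$ via $(g_1,\dots,g_{n-1})\mapsto(g_1,\dots,g_{n-1},(g_1\cdots g_{n-1})^{-1})$, which gives the sequence $0\to H_2(G,\mathbb Z)\to\widetilde{\mathcal K}(G,n)\to G^{n-1}\to 1$. The Frattini subgroup $\Phi(H)$ of a group $H$ is the intersection of all its maximal subgroups. *)

theory Defs
  imports "HOL-Algebra.Algebra" "HOL-Computational_Algebra.Primes"
begin

section \<open>Free groups\<close>

text \<open>A letter \<open>(x, True)\<close> stands for \<open>x\<close> and \<open>(x, False)\<close> for its inverse.\<close>

definition word_eval :: "('a, 'b) monoid_scheme \<Rightarrow> ('a \<times> bool) list \<Rightarrow> 'a" where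
  "word_eval F w =
     foldr (\<lambda>(x, b) y. (if b then x else inv\<^bsub>F\<^esub> x) \<otimes>\<^bsub>F\<^esub> y) w \<one>\<^bsub>F\<^esub>"

definition reduced_words :: "'a set \<Rightarrow> ('a \<times> bool) list set" where
  "reduced_words S =
     {w. fst ` set w \<subseteq> S \<and> successively (\<lambda>u v. \<not> (fst u = fst v \<and> snd u \<noteq> snd v)) w}"

text \<open>Freeness on \<open>S\<close>: every element is the value of exactly one reduced word in \<open>S\<close>. (A universal
  property quantifying over all groups is not available inside a definition, because its target groups
  would have to live on one fixed type.)\<close>

definition free_group_on :: "('a, 'b) monoid_scheme \<Rightarrow> 'a set \<Rightarrow> bool" where
  "free_group_on F S \<longleftrightarrow>
     group F \<and> S \<subseteq> carrier F \<and> bij_betw (word_eval F) (reduced_words S) (carrier F)"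

definition free_group :: "('a, 'b) monoid_scheme \<Rightarrow> bool" where
  "free_group F \<longleftrightarrow> (\<exists>S. free_group_on F S)"


section \<open>General group theory\<close>

abbreviation direct_power :: "('a, 'b) monoid_scheme \<Rightarrow> nat \<Rightarrow> (nat \<Rightarrow> 'a) monoid" where
  "direct_power G n \<equiv> product_group {..<n} (\<lambda>_. G)"

definition normal_closure :: "('a, 'b) monoid_scheme \<Rightarrow> 'a set \<Rightarrow> 'a set" where
  "normal_closure G S = \<Inter>{M. M \<lhd> G \<and> S \<subseteq> M}"

definition commutator_subgroup :: "('a, 'b) monoid_scheme \<Rightarrow> 'a set \<Rightarrow> 'a set \<Rightarrow> 'a set" where
  "commutator_subgroup G A B =
     generate G (\<Union>a\<in>A. \<Union>b\<in>B. {a \<otimes>\<^bsub>G\<^esub> b \<otimes>\<^bsub>G\<^esub> inv\<^bsub>G\<^esub> a \<otimes>\<^bsub>G\<^esub> inv\<^bsub>G\<^esub> b})"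

text \<open>The index is shifted by one from the usual numbering \<open>\<gamma>\<^sub>1 = G\<close>, \<open>\<gamma>\<^sub>2 = [G,G]\<close>, \<dots>, so that the
  nilpotency class is the least \<open>c\<close> for which term number \<open>c\<close> is trivial.\<close>

primrec lower_central :: "('a, 'b) monoid_scheme \<Rightarrow> nat \<Rightarrow> 'a set" where
  "lower_central G 0 = carrier G"
| "lower_central G (Suc k) = commutator_subgroup G (lower_central G k) (carrier G)"

definition nilpotent_of_class :: "('a, 'b) monoid_scheme \<Rightarrow> nat \<Rightarrow> bool" where
  "nilpotent_of_class G c \<longleftrightarrow>
     group G \<and> lower_central G c = {\<one>\<^bsub>G\<^esub>} \<and> (\<forall>k<c. lower_central G k \<noteq> {\<one>\<^bsub>G\<^esub>})"

definition maximal_subgroup :: "'a set \<Rightarrow> ('a, 'b) monoid_scheme \<Rightarrow> bool" where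
  "maximal_subgroup M G \<longleftrightarrow>
     subgroup M G \<and> M \<noteq> carrier G \<and>
     (\<forall>L. subgroup L G \<longrightarrow> M \<subseteq> L \<longrightarrow> L = M \<or> L = carrier G)"

text \<open>If there are no maximal subgroups, this is the whole group.\<close>

definition frattini :: "('a, 'b) monoid_scheme \<Rightarrow> 'a set" where
  "frattini G = carrier G \<inter> \<Inter>{M. maximal_subgroup M G}"

text \<open>The library's exact sequences require all groups to live on the same type.\<close>

definition short_exact ::
  "('a, 'd) monoid_scheme \<Rightarrow> ('b, 'e) monoid_scheme \<Rightarrow> ('c, 'g) monoid_scheme
    \<Rightarrow> ('a \<Rightarrow> 'b) \<Rightarrow> ('b \<Rightarrow> 'c) \<Rightarrow> bool" where
  "short_exact A B C f g \<longleftrightarrow>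
     group_hom A B f \<and> group_hom B C g \<and> inj_on f (carrier A) \<and>
     f ` carrier A = kernel B C g \<and> g ` carrier B = carrier C"

definition central_short_exact ::
  "('a, 'd) monoid_scheme \<Rightarrow> ('b, 'e) monoid_scheme \<Rightarrow> ('c, 'g) monoid_scheme
    \<Rightarrow> ('a \<Rightarrow> 'b) \<Rightarrow> ('b \<Rightarrow> 'c) \<Rightarrow> bool" where
  "central_short_exact A B C f g \<longleftrightarrow>
     short_exact A B C f g \<and>
     (\<forall>a\<in>carrier A. \<forall>b\<in>carrier B. f a \<otimes>\<^bsub>B\<^esub> b = b \<otimes>\<^bsub>B\<^esub> f a)"


section \<open>The second integral homology group\<close>

text \<open>The inhomogeneous bar complex with trivial integer coefficients in degrees 1 to 3: the group of
  \<open>k\<close>-chains is free Abelian on the \<open>k\<close>-tuples of elements of \<open>G\<close>.\<close>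

definition bar_d2 :: "('a, 'b) monoid_scheme \<Rightarrow> ('a \<times> 'a \<Rightarrow>\<^sub>0 int) \<Rightarrow> ('a \<Rightarrow>\<^sub>0 int)" where
  "bar_d2 G = frag_extend (\<lambda>(g, h). frag_of h - frag_of (g \<otimes>\<^bsub>G\<^esub> h) + frag_of g)"

definition bar_d3 :: "('a, 'b) monoid_scheme \<Rightarrow> ('a \<times> 'a \<times> 'a \<Rightarrow>\<^sub>0 int) \<Rightarrow> ('a \<times> 'a \<Rightarrow>\<^sub>0 int)" where
  "bar_d3 G = frag_extend (\<lambda>(g, h, k).
     frag_of (h, k) - frag_of (g \<otimes>\<^bsub>G\<^esub> h, k) + frag_of (g, h \<otimes>\<^bsub>G\<^esub> k) - frag_of (g, h))"

definition H2 :: "('a, 'b) monoid_scheme \<Rightarrow> ('a \<times> 'a \<Rightarrow>\<^sub>0 int) set monoid" where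
  "H2 G =
     (let C1 = free_Abelian_group (carrier G);
          C2 = free_Abelian_group (carrier G \<times> carrier G);
          C3 = free_Abelian_group (carrier G \<times> carrier G \<times> carrier G)
      in C2\<lparr>carrier := kernel C2 C1 (bar_d2 G)\<rparr> Mod (bar_d3 G ` carrier C3))"

text \<open>The group \<open>(N \<inter> [F,F]) / [F,N]\<close> of Hopf's formula.\<close>

definition hopf_group :: "('f, 'b) monoid_scheme \<Rightarrow> 'f set \<Rightarrow> 'f set monoid" where
  "hopf_group F N =
     F\<lparr>carrier := N \<inter> derived F (carrier F)\<rparr> Mod commutator_subgroup F (carrier F) N"


section \<open>The groups \<open>\<K>(G,n)\<close> and \<open>\<K>~(G,n)\<close>\<close>

definition ordered_prod :: "('a, 'b) monoid_scheme \<Rightarrow> nat \<Rightarrow> (nat \<Rightarrow> 'a) \<Rightarrow> 'a" where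
  "ordered_prod G n g = foldr (\<lambda>i y. g i \<otimes>\<^bsub>G\<^esub> y) [0..<n] \<one>\<^bsub>G\<^esub>"

definition K_set :: "('a, 'b) monoid_scheme \<Rightarrow> nat \<Rightarrow> (nat \<Rightarrow> 'a) set" where
  "K_set G n =
     kernel (direct_power G n) (G Mod derived G (carrier G))
       (\<lambda>g. derived G (carrier G) #>\<^bsub>G\<^esub> ordered_prod G n g)"

text \<open>The normal closure in \<open>F\<^sup>n\<close> of \<open>\<K>(N,n)\<close>, where \<open>N\<close> is a normal subgroup of \<open>F\<close>.\<close>

definition K_rel :: "('f, 'b) monoid_scheme \<Rightarrow> 'f set \<Rightarrow> nat \<Rightarrow> (nat \<Rightarrow> 'f) set" where
  "K_rel F N n = normal_closure (direct_power F n) (K_set (F\<lparr>carrier := N\<rparr>) n)"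

text \<open>\<open>\<K>~(G,n)\<close> as computed from the presentation \<open>G \<cong> F/N\<close>.\<close>

definition K_tilde :: "('f, 'b) monoid_scheme \<Rightarrow> 'f set \<Rightarrow> nat \<Rightarrow> (nat \<Rightarrow> 'f) set monoid" where
  "K_tilde F N n = (direct_power F n)\<lparr>carrier := K_set F n\<rparr> Mod K_rel F N n"

text \<open>Both of the following maps are given by formulas on representatives of a coset \<open>A\<close>. The first is
  \<open>x \<mapsto> (x,1,\<dots>,1)\<close>. The second is induced by \<open>F\<^sup>n \<rightarrow> G\<^sup>n\<close>, where \<open>\<phi>\<close> is the isomorphism
  \<open>F/N \<cong> G\<close>, followed by projection to the first \<open>n - 1\<close> coordinates; for Abelian \<open>G\<close> this projection
  is inverse to \<open>(g\<^sub>1,\<dots>,g\<^bsub>n-1\<^esub>) \<mapsto> (g\<^sub>1,\<dots>,g\<^bsub>n-1\<^esub>,(g\<^sub>1\<cdots>g\<^bsub>n-1\<^esub>)\<^sup>-\<^sup>1)\<close>.\<close>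

definition hopf_to_K_tilde ::
  "('f, 'b) monoid_scheme \<Rightarrow> 'f set \<Rightarrow> nat \<Rightarrow> 'f set \<Rightarrow> (nat \<Rightarrow> 'f) set" where
  "hopf_to_K_tilde F N n A =
     the_elem ((\<lambda>x. K_rel F N n #>\<^bsub>direct_power F n\<^esub>
                      (\<lambda>i\<in>{..<n}. if i = 0 then x else \<one>\<^bsub>F\<^esub>)) ` A)"

definition K_tilde_to_power ::
  "('f, 'b) monoid_scheme \<Rightarrow> 'f set \<Rightarrow> ('f set \<Rightarrow> 'a) \<Rightarrow> nat \<Rightarrow> (nat \<Rightarrow> 'f) set \<Rightarrow> (nat \<Rightarrow> 'a)" where
  "K_tilde_to_power F N \<phi> n A =
     the_elem ((\<lambda>f. \<lambda>i\<in>{..<n - 1}. \<phi> (N #>\<^bsub>F\<^esub> f i)) ` A)"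

end

theory Submission
  imports Defs
begin

text \<open>Write \<open>G = F/N\<close>. Since \<open>G\<close> is Abelian, \<open>[F,F] \<le> N\<close>, and Hopf's formula reads
\<open>H\<^sub>2(G) \<cong> [F,F]/[F,N]\<close>.

The relation group is explicit: for \<open>n \<ge> 2\<close> the normal closure of \<open>\<K>(N,n)\<close> in \<open>F\<^sup>n\<close> consists of the
tuples over \<open>N\<close> whose product lies in \<open>[F,N]\<close> (\<open>K_rel_eq\<close>). That set is a normal subgroup because the
product map \<open>N\<^sup>n \<rightarrow> N/[F,N]\<close> is a homomorphism that does not see conjugation by \<open>F\<^sup>n\<close>; conversely
\<open>([a,m],1,\<dots>,1)\<close> is the commutator of \<open>(a,1,\<dots>,1)\<close> with \<open>(m,m\<^sup>-\<^sup>1,1,\<dots>) \<in> \<K>(N,n)\<close>. Consequently a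
class of a tuple over \<open>N\<close> in \<open>\<K>~(G,n)\<close> depends only on the product modulo \<open>[F,N]\<close>, which makes
\<open>x \<mapsto> (x,1,\<dots>,1)\<close> an isomorphism of \<open>[F,F]/[F,N]\<close> onto the kernel of \<open>\<K>~(G,n) \<rightarrow> G\<^sup>n\<^sup>-\<^sup>1\<close>. This kernel is
central, as \<open>(x,1,\<dots>,1)\<close> with \<open>x \<in> N\<close> commutes with every tuple up to an element \<open>([a,x],1,\<dots>,1)\<close>. It
contains all commutators because the quotient \<open>G\<^sup>n\<^sup>-\<^sup>1\<close> is Abelian, and for \<open>n \<ge> 3\<close> it consists of
products of commutators: \<open>([a,b],1,1) = [(a,a\<^sup>-\<^sup>1,1), (b,1,b\<^sup>-\<^sup>1)]\<close> (\<open>derived_KT\<close>).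

Hopf's formula (\<open>hopf_formula\<close>) is obtained by comparing two central extensions of \<open>G\<close>. One is
\<open>F/[F,N]\<close>. The other, \<open>U\<close>, is defined by the universal cocycle \<open>(g,h) \<mapsto> [g|h]\<close> with values in bar
2-chains modulo boundaries. Each maps to the other over \<open>G\<close>: \<open>F\<close> is free, and the cocycle of \<open>U\<close> is
universal. A homomorphism between central extensions that covers the identity of \<open>G\<close> is determined on
commutators, so the two maps are mutually inverse on the intersections of the kernels with the
commutator subgroups (\<open>multiplier_iso\<close>). For \<open>F/[F,N]\<close> this intersection is \<open>(N \<inter> [F,F])/[F,N]\<close>, and
for \<open>U\<close> it is cycles modulo boundaries, because the Abelianisation of \<open>U\<close> is the group of 1-chains.

The commutator subgroup \<open>A\<close> of \<open>\<K>~(G,n)\<close> is central, hence contained in every maximal subgroup \<open>M\<close>: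
otherwise \<open>\<K>~(G,n) = AM\<close>, and then \<open>A = [AM,AM] = [M,M] \<le> M\<close>. So maximal subgroups correspond to those
of the quotient \<open>G\<^sup>n\<^sup>-\<^sup>1\<close>, whose Frattini subgroup is \<open>\<Phi>(G)\<^sup>n\<^sup>-\<^sup>1\<close> (\<open>frattini_direct_power\<close>). This
describes \<open>\<Phi>(\<K>~(G,n))\<close>.

The nilpotency class is exactly 2 as soon as \<open>H\<^sub>2(G)\<close> is nontrivial. A finite non-cyclic Abelian \<open>p\<close>-group has
two different maximal subgroups, which are kernels of two independent homomorphisms \<open>\<alpha>\<close>, \<open>\<beta>\<close> to the
integers modulo \<open>p\<close>; the bilinear cocycle \<open>\<alpha>(g)\<beta>(h)\<close> is nonzero on a cycle \<open>[x|y] - [y|x]\<close>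
(\<open>H2_nontrivial\<close>).\<close>

section \<open>Commutators and homomorphisms\<close>

lemma group_homI: "group G \<Longrightarrow> group H \<Longrightarrow> h \<in> hom G H \<Longrightarrow> group_hom G H h"
  by (simp add: group_hom_def group_hom_axioms_def)

lemma group_hom_trivial:
  assumes "group G" "group H"
  shows "group_hom G H (\<lambda>_. \<one>\<^bsub>H\<^esub>)"
proof -
  interpret H: group H by fact
  show ?thesis by (rule group_homI) (use assms in \<open>auto simp: hom_def\<close>)
qed

lemma group_hom_comp: "group_hom G H f \<Longrightarrow> group_hom H K g \<Longrightarrow> group_hom G K (g \<circ> f)"
  by (auto simp: group_hom_def group_hom_axioms_def hom_def Pi_iff)

lemma (in group) inv_mult_cancel:
  "x \<in> carrier G \<Longrightarrow> y \<in> carrier G \<Longrightarrow> inv x \<otimes> (x \<otimes> y) = y"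
  "x \<in> carrier G \<Longrightarrow> y \<in> carrier G \<Longrightarrow> x \<otimes> (inv x \<otimes> y) = y"
  by (simp_all flip: m_assoc)

lemma (in group) commutator_mult_central:
  assumes ab: "a \<in> carrier G" "b \<in> carrier G" and yz: "y \<in> carrier G" "z \<in> carrier G"
    and central: "\<And>x. x \<in> carrier G \<Longrightarrow> y \<otimes> x = x \<otimes> y" "\<And>x. x \<in> carrier G \<Longrightarrow> z \<otimes> x = x \<otimes> z"
  shows "(y \<otimes> a) \<otimes> (z \<otimes> b) \<otimes> inv (y \<otimes> a) \<otimes> inv (z \<otimes> b) = a \<otimes> b \<otimes> inv a \<otimes> inv b"
proof -
  have yzc: "(y \<otimes> z) \<otimes> x = x \<otimes> (y \<otimes> z)" if "x \<in> carrier G" for x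
    using that yz central by (metis m_assoc)
  have e1: "(y \<otimes> a) \<otimes> (z \<otimes> b) = (y \<otimes> z) \<otimes> (a \<otimes> b)"
    using ab yz central(2)[of a] by (metis m_assoc m_closed)
  have e2: "(z \<otimes> b) \<otimes> (y \<otimes> a) = (y \<otimes> z) \<otimes> (b \<otimes> a)"
    using ab yz central(1)[of b] central(1)[of z] by (metis m_assoc m_closed)
  have "(y \<otimes> a) \<otimes> (z \<otimes> b) \<otimes> inv (y \<otimes> a) \<otimes> inv (z \<otimes> b)
      = ((y \<otimes> a) \<otimes> (z \<otimes> b)) \<otimes> inv ((z \<otimes> b) \<otimes> (y \<otimes> a))"
    using ab yz by (simp add: m_assoc inv_mult_group)
  also have "\<dots> = ((y \<otimes> z) \<otimes> (a \<otimes> b)) \<otimes> inv ((y \<otimes> z) \<otimes> (b \<otimes> a))"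
    by (simp only: e1 e2)
  also have "\<dots> = (y \<otimes> z) \<otimes> ((a \<otimes> b) \<otimes> inv (b \<otimes> a)) \<otimes> inv (y \<otimes> z)"
    using ab yz by (simp add: m_assoc inv_mult_group)
  also have "\<dots> = ((a \<otimes> b) \<otimes> inv (b \<otimes> a)) \<otimes> (y \<otimes> z) \<otimes> inv (y \<otimes> z)"
    using ab yz yzc by (metis m_closed inv_closed)
  also have "\<dots> = (a \<otimes> b) \<otimes> inv (b \<otimes> a)"
    using ab yz by (metis inv_solve_right inv_closed m_closed)
  also have "\<dots> = a \<otimes> b \<otimes> inv a \<otimes> inv b"
    using ab by (simp add: m_assoc inv_mult_group)
  finally show ?thesis .
qed

lemma (in group) conj_commutator:
  assumes "g \<in> carrier G" "a \<in> carrier G" "b \<in> carrier G"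
  shows "g \<otimes> (a \<otimes> b \<otimes> inv a \<otimes> inv b) \<otimes> inv g =
    (g \<otimes> a \<otimes> inv g) \<otimes> (g \<otimes> b \<otimes> inv g) \<otimes> inv (g \<otimes> a \<otimes> inv g) \<otimes> inv (g \<otimes> b \<otimes> inv g)"
  using assms by (simp add: m_assoc inv_mult_group inv_mult_cancel)

lemma (in group_hom) hom_commutator:
  assumes "a \<in> carrier G" "b \<in> carrier G"
  shows "h (a \<otimes>\<^bsub>G\<^esub> b \<otimes>\<^bsub>G\<^esub> inv\<^bsub>G\<^esub> a \<otimes>\<^bsub>G\<^esub> inv\<^bsub>G\<^esub> b) = h a \<otimes>\<^bsub>H\<^esub> h b \<otimes>\<^bsub>H\<^esub> inv\<^bsub>H\<^esub> h a \<otimes>\<^bsub>H\<^esub> inv\<^bsub>H\<^esub> h b"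
  using assms by simp

lemma (in group_hom) subgroup_preimage:
  assumes "subgroup M H"
  shows "subgroup {x \<in> carrier G. h x \<in> M} G"
proof (rule G.subgroupI)
  have "h \<one>\<^bsub>G\<^esub> \<in> M" using subgroup.one_closed[OF assms] by simp
  then show "{x \<in> carrier G. h x \<in> M} \<noteq> {}" by blast
qed (use subgroup.m_closed[OF assms] subgroup.m_inv_closed[OF assms] in auto)

lemma (in group) commutator_mem:
  assumes "a \<in> A" "b \<in> B"
  shows "a \<otimes> b \<otimes> inv a \<otimes> inv b \<in> commutator_subgroup G A B"
  unfolding commutator_subgroup_def using assms by (intro generate.incl) blast

lemma (in group) commutator_subgroup_le:
  assumes "subgroup H G" "\<And>a b. a \<in> A \<Longrightarrow> b \<in> B \<Longrightarrow> a \<otimes> b \<otimes> inv a \<otimes> inv b \<in> H"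
  shows "commutator_subgroup G A B \<subseteq> H"
  unfolding commutator_subgroup_def using assms by (intro generate_subgroup_incl) auto

lemma derived_eq_commutator_subgroup: "derived G A = commutator_subgroup G A A"
  by (simp add: derived_def commutator_subgroup_def)

lemma (in group) commutator_subgroup_normal:
  assumes "N \<lhd> G"
  shows "commutator_subgroup G (carrier G) N \<lhd> G" "commutator_subgroup G (carrier G) N \<subseteq> N"
    "commutator_subgroup G (carrier G) N \<subseteq> derived G (carrier G)"
proof -
  interpret N: normal N G by fact
  show "commutator_subgroup G (carrier G) N \<lhd> G"
    unfolding commutator_subgroup_def
  proof (rule normal_generateI)
    fix h g assume "h \<in> (\<Union>a\<in>carrier G. \<Union>b\<in>N. {a \<otimes> b \<otimes> inv a \<otimes> inv b})" and g: "g \<in> carrier G"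
    then obtain a b where ab: "a \<in> carrier G" "b \<in> N" "h = a \<otimes> b \<otimes> inv a \<otimes> inv b" by blast
    have "g \<otimes> h \<otimes> inv g = (g \<otimes> a \<otimes> inv g) \<otimes> (g \<otimes> b \<otimes> inv g) \<otimes> inv (g \<otimes> a \<otimes> inv g) \<otimes> inv (g \<otimes> b \<otimes> inv g)"
      using conj_commutator g ab N.mem_carrier by simp
    moreover have "g \<otimes> b \<otimes> inv g \<in> N" using N.inv_op_closed2 g ab by blast
    ultimately show "g \<otimes> h \<otimes> inv g \<in> (\<Union>a\<in>carrier G. \<Union>b\<in>N. {a \<otimes> b \<otimes> inv a \<otimes> inv b})"
      using g ab(1)
      by (intro UN_I[of "g \<otimes> a \<otimes> inv g"] UN_I[of "g \<otimes> b \<otimes> inv g"]) (simp_all only: singleton_iff m_closed inv_closed)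
  qed auto
  show "commutator_subgroup G (carrier G) N \<subseteq> N"
  proof (rule commutator_subgroup_le[OF N.subgroup_axioms])
    fix a b assume ab: "a \<in> carrier G" "b \<in> N"
    then have "a \<otimes> b \<otimes> inv a \<in> N" by (rule N.inv_op_closed2)
    then show "a \<otimes> b \<otimes> inv a \<otimes> inv b \<in> N" using ab by blast
  qed
  show "commutator_subgroup G (carrier G) N \<subseteq> derived G (carrier G)"
    using commutator_subgroup_le[OF derived_is_subgroup] commutator_mem N.subset
    unfolding derived_eq_commutator_subgroup by blast
qed

lemma hom_image_derived_le:
  assumes "group_hom G H h" "x \<in> derived G (carrier G)"
  shows "h x \<in> derived H (carrier H)"
proof -
  interpret group_hom G H h by fact
  have "h ` derived G (carrier G) = derived H (h ` carrier G)"
    using derived_img[of "carrier G"] by simp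
  then have "h ` derived G (carrier G) \<subseteq> derived H (carrier H)"
    using H.mono_derived[of "h ` carrier G" "carrier H"] hom_closed by (metis image_subsetI)
  then show ?thesis using assms(2) by (rule subsetD[OF _ imageI])
qed

section \<open>Maps induced on quotients\<close>

lemma the_elem_image_coset:
  assumes "group_hom G H h" "subgroup R G" "R \<subseteq> kernel G H h" "x \<in> carrier G"
  shows "the_elem (h ` (R #>\<^bsub>G\<^esub> x)) = h x"
proof -
  interpret group_hom G H h by fact
  have "h ` (R #>\<^bsub>G\<^esub> x) = {h x}"
    using assms(3,4) subgroup.one_closed[OF assms(2)] subgroup.mem_carrier[OF assms(2)]
    by (force simp: r_coset_def kernel_def image_iff subset_iff)
  then show ?thesis by simp
qed

text \<open>The value at a coset is written with \<open>the_elem\<close> because this is the form in which the maps of the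
statement are given on representatives.\<close>

lemma hom_FactGroup_induced:
  assumes "group_hom G H h" "R \<lhd> G" "R \<subseteq> kernel G H h"
  shows "group_hom (G Mod R) H (\<lambda>A. the_elem (h ` A))"
    and "kernel (G Mod R) H (\<lambda>A. the_elem (h ` A)) = (\<lambda>x. R #>\<^bsub>G\<^esub> x) ` kernel G H h"
    and "(\<lambda>A. the_elem (h ` A)) ` carrier (G Mod R) = h ` carrier G"
proof -
  interpret group_hom G H h by fact
  interpret R: normal R G by fact
  note el = the_elem_image_coset[OF assms(1) R.subgroup_axioms assms(3)]
  have "(\<lambda>A. the_elem (h ` A)) \<in> hom (G Mod R) H"
    by (rule homI) (auto simp: carrier_FactGroup el R.rcos_sum)
  then show "group_hom (G Mod R) H (\<lambda>A. the_elem (h ` A))"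
    using R.factorgroup_is_group by (simp add: group_hom_def group_hom_axioms_def)
  show "kernel (G Mod R) H (\<lambda>A. the_elem (h ` A)) = (\<lambda>x. R #>\<^bsub>G\<^esub> x) ` kernel G H h"
    by (auto simp: kernel_def carrier_FactGroup el)
  show "(\<lambda>A. the_elem (h ` A)) ` carrier (G Mod R) = h ` carrier G"
    by (auto simp: carrier_FactGroup el image_iff)
qed

lemma group_hom_coset: "R \<lhd> G \<Longrightarrow> group_hom G (G Mod R) (\<lambda>x. R #>\<^bsub>G\<^esub> x)"
  by (simp add: group_hom_def group_hom_axioms_def normal.factorgroup_is_group
      normal.r_coset_hom_Mod normal_def)

lemma coset_eq_iff_mem:
  assumes "group G" "subgroup R G" "x \<in> carrier G"
  shows "R #>\<^bsub>G\<^esub> x = R \<longleftrightarrow> x \<in> R"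
  using assms group.coset_join1 group.coset_join2 by (metis group.rcos_self subgroup.subset)

section \<open>Homomorphisms out of a free group\<close>

text \<open>In contrast to \<open>word_eval\<close>, the letters are not elements of \<open>H\<close>, so one word can be evaluated in
several groups.\<close>

definition word_map :: "('b, 'd) monoid_scheme \<Rightarrow> ('a \<Rightarrow> 'b) \<Rightarrow> ('a \<times> bool) list \<Rightarrow> 'b" where
  "word_map H t w =
     foldr (\<lambda>(x, b) y. (if b then t x else inv\<^bsub>H\<^esub> (t x)) \<otimes>\<^bsub>H\<^esub> y) w \<one>\<^bsub>H\<^esub>"

text \<open>Left multiplication of a reduced word by a letter.\<close>

fun cancel_cons :: "'a \<times> bool \<Rightarrow> ('a \<times> bool) list \<Rightarrow> ('a \<times> bool) list" where
  "cancel_cons l [] = [l]"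
| "cancel_cons l (k # w) = (if fst l = fst k \<and> snd l \<noteq> snd k then w else l # k # w)"

lemma word_map_closed:
  assumes "group H" "t ` S \<subseteq> carrier H" "fst ` set w \<subseteq> S"
  shows "word_map H t w \<in> carrier H"
proof -
  interpret group H by fact
  show ?thesis
    using assms(2,3) by (induction w) (auto simp: word_map_def image_subset_iff)
qed

lemma word_map_append:
  assumes "group H" "t ` S \<subseteq> carrier H" "fst ` set v \<subseteq> S" "fst ` set w \<subseteq> S"
  shows "word_map H t (v @ w) = word_map H t v \<otimes>\<^bsub>H\<^esub> word_map H t w"
proof -
  interpret group H by fact
  note closed = word_map_closed[OF assms(1,2), unfolded word_map_def]
  show ?thesis
    using assms(2-4)
  proof (induction v)
    case Nil
    then show ?case using closed by (simp add: word_map_def)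
  next
    case (Cons a v)
    then show ?case
      using closed[of v] closed[of w]
      by (cases a) (auto simp: word_map_def image_subset_iff m_assoc)
  qed
qed

lemma word_map_cancel_cons:
  assumes "group H" "t ` S \<subseteq> carrier H" "fst l \<in> S" "fst ` set w \<subseteq> S"
  shows "word_map H t (cancel_cons l w) = word_map H t (l # w)"
proof -
  interpret group H by fact
  show ?thesis
  proof (cases w)
    case (Cons k v)
    have "word_map H t v \<in> carrier H" "t (fst k) \<in> carrier H"
      using assms word_map_closed[OF assms(1,2)] Cons by auto
    then show ?thesis
      using Cons by (cases l, cases k) (auto simp: word_map_def m_assoc[symmetric])
  qed simp
qed

lemma cancel_cons_reduced:
  assumes "fst l \<in> S" "w \<in> reduced_words S"
  shows "cancel_cons l w \<in> reduced_words S"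
  using assms by (cases w) (auto simp: reduced_words_def successively_Cons)

definition reduce :: "('a \<times> bool) list \<Rightarrow> ('a \<times> bool) list" where
  "reduce w = foldr cancel_cons w []"

lemma reduce_reduced:
  assumes "fst ` set w \<subseteq> S"
  shows "reduce w \<in> reduced_words S"
  using assms
proof (induction w)
  case Nil
  then show ?case by (simp add: reduce_def reduced_words_def)
next
  case (Cons l w)
  then show ?case using cancel_cons_reduced[of l S "reduce w"] by (simp add: reduce_def)
qed

lemma word_map_reduce:
  assumes "group H" "t ` S \<subseteq> carrier H" "fst ` set w \<subseteq> S"
  shows "word_map H t (reduce w) = word_map H t w"
  using assms(3)
proof (induction w)
  case (Cons l w)
  have "fst ` set (reduce w) \<subseteq> S"
    using reduce_reduced[of w S] Cons.prems by (simp add: reduced_words_def)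
  then show ?case
    using word_map_cancel_cons[OF assms(1,2), of l "reduce w"] Cons
    by (simp add: reduce_def word_map_def)
qed (simp add: reduce_def)

lemma word_eval_eq_word_map: "word_eval F = word_map F (\<lambda>x. x)"
  by (simp add: fun_eq_iff word_eval_def word_map_def)

text \<open>An element of \<open>F\<close> is sent to the value of its unique reduced word. Reduction does not change the
value of a word in any group, so every word for the element gives the same value, and concatenation of
words yields multiplicativity.\<close>

lemma free_group_on_lift:
  fixes F :: "('a, 'c) monoid_scheme" and H :: "('b, 'd) monoid_scheme"
  assumes "free_group_on F S" "group H" "t ` S \<subseteq> carrier H"
  obtains \<psi> where "\<psi> \<in> hom F H"
    and "\<And>w. fst ` set w \<subseteq> S \<Longrightarrow> \<psi> (word_eval F w) = word_map H t w"
proof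
  let ?E = "word_eval F"
  define \<psi> where "\<psi> x = word_map H t (the_inv_into (reduced_words S) ?E x)" for x
  have F: "group F" "(\<lambda>x. x) ` S \<subseteq> carrier F" and bij: "bij_betw ?E (reduced_words S) (carrier F)"
    using assms(1) by (auto simp: free_group_on_def)
  show eval: "\<psi> (?E w) = word_map H t w" if "fst ` set w \<subseteq> S" for w
  proof -
    have "?E (reduce w) = ?E w"
      using word_map_reduce[OF F that] by (simp add: word_eval_eq_word_map)
    then have "the_inv_into (reduced_words S) ?E (?E w) = reduce w"
      using reduce_reduced[OF that] bij by (metis bij_betw_imp_inj_on the_inv_into_f_f)
    then show ?thesis using word_map_reduce[OF assms(2,3) that] by (simp add: \<psi>_def)
  qed
  have word: "\<exists>w. fst ` set w \<subseteq> S \<and> x = ?E w" if "x \<in> carrier F" for x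
  proof -
    have "x \<in> ?E ` reduced_words S" using bij that by (simp add: bij_betw_def)
    then show ?thesis by (auto simp: reduced_words_def)
  qed
  show "\<psi> \<in> hom F H"
  proof (rule homI)
    fix x assume "x \<in> carrier F"
    then show "\<psi> x \<in> carrier H" using word eval word_map_closed[OF assms(2,3)] by metis
  next
    fix x y assume "x \<in> carrier F" "y \<in> carrier F"
    then obtain v w where vw: "fst ` set v \<subseteq> S" "x = ?E v" "fst ` set w \<subseteq> S" "y = ?E w"
      using word by meson
    have "x \<otimes>\<^bsub>F\<^esub> y = ?E (v @ w)"
      using vw word_map_append[OF F, of v w] by (simp add: word_eval_eq_word_map)
    then show "\<psi> (x \<otimes>\<^bsub>F\<^esub> y) = \<psi> x \<otimes>\<^bsub>H\<^esub> \<psi> y"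
      using vw eval[of "v @ w"] word_map_append[OF assms(2,3), of v w] by (simp add: eval image_Un)
  qed
qed

lemma hom_word_map:
  assumes "group_hom H K h" "t ` S \<subseteq> carrier H" "fst ` set w \<subseteq> S"
  shows "h (word_map H t w) = word_map K (h \<circ> t) w"
proof -
  interpret group_hom H K h by fact
  note closed = word_map_closed[OF G.is_group assms(2), unfolded word_map_def]
  show ?thesis
    using assms(2,3)
  proof (induction w)
    case (Cons a w)
    then show ?case
      using closed[of w] by (cases a) (auto simp: word_map_def image_subset_iff)
  qed (simp add: word_map_def)
qed

text \<open>Only the basis has to be lifted; both \<open>p \<circ> \<psi>\<close> and \<open>q\<close> then evaluate words at the same
letters.\<close>

lemma free_group_projective:
  assumes "free_group F" "group_hom F B q" "group_hom E B p" "q ` carrier F \<subseteq> p ` carrier E"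
  obtains \<psi> where "group_hom F E \<psi>" "\<And>x. x \<in> carrier F \<Longrightarrow> p (\<psi> x) = q x"
proof -
  interpret q: group_hom F B q by fact
  interpret p: group_hom E B p by fact
  obtain S where S: "free_group_on F S" using assms(1) by (auto simp: free_group_def)
  then have S_sub: "S \<subseteq> carrier F" and bij: "bij_betw (word_eval F) (reduced_words S) (carrier F)"
    by (auto simp: free_group_on_def)
  have "\<forall>x\<in>S. \<exists>e. e \<in> carrier E \<and> p e = q x"
    using S_sub assms(4) by (metis imageE image_subset_iff subset_iff)
  then obtain t where t: "\<And>x. x \<in> S \<Longrightarrow> t x \<in> carrier E \<and> p (t x) = q x"
    by metis
  then have tS: "t ` S \<subseteq> carrier E" by blast
  obtain \<psi> where \<psi>: "\<psi> \<in> hom F E"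
    and eval: "\<And>w. fst ` set w \<subseteq> S \<Longrightarrow> \<psi> (word_eval F w) = word_map E t w"
    using free_group_on_lift[OF S p.G.is_group tS] by blast
  have "p (\<psi> x) = q x" if "x \<in> carrier F" for x
  proof -
    have "x \<in> word_eval F ` reduced_words S"
      using bij that by (simp add: bij_betw_def)
    then obtain w where w: "fst ` set w \<subseteq> S" "x = word_eval F w"
      by (auto simp: reduced_words_def)
    have "p (\<psi> x) = word_map B (p \<circ> t) w"
      using w eval hom_word_map[OF assms(3) tS] by simp
    also have "\<dots> = word_map B (q \<circ> (\<lambda>x. x)) w"
      using w(1) t by (induction w) (auto simp: word_map_def)
    also have "\<dots> = q x"
      using w hom_word_map[OF assms(2), of "\<lambda>x. x" S w] S_sub by (simp add: word_eval_eq_word_map)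
    finally show ?thesis .
  qed
  moreover have "group_hom F E \<psi>"
    using \<psi> by (simp add: group_hom_def group_hom_axioms_def)
  ultimately show thesis using that by blast
qed

section \<open>Central extensions\<close>

text \<open>If \<open>p\<close> is onto, this says that \<open>E\<close> is a central extension of \<open>B\<close>.\<close>

definition central_hom ::
  "('e, 'd) monoid_scheme \<Rightarrow> ('b, 'g) monoid_scheme \<Rightarrow> ('e \<Rightarrow> 'b) \<Rightarrow> bool" where
  "central_hom E B p \<longleftrightarrow>
     group_hom E B p \<and> (\<forall>z\<in>kernel E B p. \<forall>x\<in>carrier E. z \<otimes>\<^bsub>E\<^esub> x = x \<otimes>\<^bsub>E\<^esub> z)"

text \<open>If \<open>E\<close> is \<open>F/[F,N]\<close> for a presentation \<open>F/N\<close> of \<open>B\<close>, this is the group of Hopf's formula, the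
Schur multiplier of \<open>B\<close>.\<close>

definition multiplier ::
  "('e, 'd) monoid_scheme \<Rightarrow> ('b, 'g) monoid_scheme \<Rightarrow> ('e \<Rightarrow> 'b) \<Rightarrow> 'e set" where
  "multiplier E B p = kernel E B p \<inter> derived E (carrier E)"

text \<open>Since \<open>e a\<close> and \<open>a\<close> have the same image in \<open>B\<close>, they differ by a central element, and central factors
cancel in commutators.\<close>

lemma endomorphism_over_base_fixes_derived:
  assumes "central_hom E B p" "e \<in> hom E E" "\<And>x. x \<in> carrier E \<Longrightarrow> p (e x) = p x"
    and "x \<in> derived E (carrier E)"
  shows "e x = x"
proof -
  interpret group_hom E B p using assms(1) by (simp add: central_hom_def)
  interpret e: group_hom E E e using assms(2) by unfold_locales
  have central: "z \<otimes>\<^bsub>E\<^esub> x = x \<otimes>\<^bsub>E\<^esub> z" if "z \<in> kernel E B p" "x \<in> carrier E" for z x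
    using that assms(1) by (auto simp: central_hom_def)
  have shift: "\<exists>z\<in>kernel E B p. e a = z \<otimes>\<^bsub>E\<^esub> a" if "a \<in> carrier E" for a
    using that assms(3) by (intro bexI[of _ "e a \<otimes>\<^bsub>E\<^esub> inv\<^bsub>E\<^esub> a"]) (auto simp: kernel_def G.m_assoc)
  have comm: "e (a \<otimes>\<^bsub>E\<^esub> b \<otimes>\<^bsub>E\<^esub> inv\<^bsub>E\<^esub> a \<otimes>\<^bsub>E\<^esub> inv\<^bsub>E\<^esub> b) = a \<otimes>\<^bsub>E\<^esub> b \<otimes>\<^bsub>E\<^esub> inv\<^bsub>E\<^esub> a \<otimes>\<^bsub>E\<^esub> inv\<^bsub>E\<^esub> b"
    if ab: "a \<in> carrier E" "b \<in> carrier E" for a b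
  proof -
    obtain y z where y: "y \<in> kernel E B p" "e a = y \<otimes>\<^bsub>E\<^esub> a" and z: "z \<in> kernel E B p" "e b = z \<otimes>\<^bsub>E\<^esub> b"
      using shift ab by meson
    have "y \<in> carrier E" "z \<in> carrier E" using y(1) z(1) by (auto simp: kernel_def)
    then show ?thesis
      unfolding e.hom_commutator[OF ab] y(2) z(2)
      using ab central[OF y(1)] central[OF z(1)] by (intro G.commutator_mult_central)
  qed
  have "x \<in> carrier E \<and> e x = x"
    using assms(4) unfolding derived_def
  proof (induction rule: generate.induct)
    case (incl h)
    then show ?case using comm by auto
  next
    case (inv h)
    then have "h \<in> carrier E \<and> e h = h" using comm by auto
    then show ?case by simp
  qed auto
  then show ?thesis by simp
qed

text \<open>Both composites of \<open>f\<close> and \<open>g\<close> cover the identity of \<open>B\<close> and therefore fix the commutator subgroups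
pointwise.\<close>

lemma multiplier_iso:
  assumes E1: "central_hom E1 B p1" and E2: "central_hom E2 B p2"
    and f: "f \<in> hom E1 E2" "\<And>x. x \<in> carrier E1 \<Longrightarrow> p2 (f x) = p1 x"
    and g: "g \<in> hom E2 E1" "\<And>x. x \<in> carrier E2 \<Longrightarrow> p1 (g x) = p2 x"
  shows "f \<in> iso (E1\<lparr>carrier := multiplier E1 B p1\<rparr>) (E2\<lparr>carrier := multiplier E2 B p2\<rparr>)"
proof -
  interpret p1: group_hom E1 B p1 using E1 by (simp add: central_hom_def)
  interpret p2: group_hom E2 B p2 using E2 by (simp add: central_hom_def)
  interpret f: group_hom E1 E2 f using f(1) by unfold_locales
  interpret g: group_hom E2 E1 g using g(1) by unfold_locales
  have gf: "g (f x) = x" if "x \<in> derived E1 (carrier E1)" for x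
    using endomorphism_over_base_fixes_derived[OF E1, of "g \<circ> f"] that f g
    by (simp add: hom_def Pi_iff)
  have fg: "f (g x) = x" if "x \<in> derived E2 (carrier E2)" for x
    using endomorphism_over_base_fixes_derived[OF E2, of "f \<circ> g"] that f g
    by (simp add: hom_def Pi_iff)
  have fm: "f x \<in> multiplier E2 B p2" if "x \<in> multiplier E1 B p1" for x
    using that f hom_image_derived_le[OF f.group_hom_axioms]
    by (auto simp: multiplier_def kernel_def)
  have gm: "g x \<in> multiplier E1 B p1" if "x \<in> multiplier E2 B p2" for x
    using that g hom_image_derived_le[OF g.group_hom_axioms]
    by (auto simp: multiplier_def kernel_def)
  have "bij_betw f (multiplier E1 B p1) (multiplier E2 B p2)"
    by (rule bij_betw_byWitness[where f' = g]) (use gf fg fm gm in \<open>auto simp: multiplier_def\<close>)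
  moreover have "f \<in> hom (E1\<lparr>carrier := multiplier E1 B p1\<rparr>) (E2\<lparr>carrier := multiplier E2 B p2\<rparr>)"
    using fm by (auto simp: hom_def multiplier_def kernel_def)
  ultimately show ?thesis by (simp add: iso_def)
qed

section \<open>The extension defined by a cocycle\<close>

text \<open>A 2-cocycle of \<open>G\<close> with values in the Abelian group \<open>A\<close> on which \<open>G\<close> acts trivially. It is not
assumed to be normalised, since the universal bar cocycle is not.\<close>

locale central_cocycle = G?: group G + A?: comm_group A
  for G :: "('a, 'b) monoid_scheme" (structure) and A :: "('c, 'd) monoid_scheme" +
  fixes c :: "'a \<Rightarrow> 'a \<Rightarrow> 'c"
  assumes c_closed [simp]: "g \<in> carrier G \<Longrightarrow> h \<in> carrier G \<Longrightarrow> c g h \<in> carrier A"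
    and cocycle: "\<lbrakk>g \<in> carrier G; h \<in> carrier G; k \<in> carrier G\<rbrakk> \<Longrightarrow>
      c g h \<otimes>\<^bsub>A\<^esub> c (g \<otimes>\<^bsub>G\<^esub> h) k = c h k \<otimes>\<^bsub>A\<^esub> c g (h \<otimes>\<^bsub>G\<^esub> k)"
begin

text \<open>Without normalisation the unit element is \<open>(c(1,1)\<^sup>-\<^sup>1, 1)\<close>.\<close>

definition ext :: "('c \<times> 'a) monoid" where
  "ext = \<lparr>carrier = carrier A \<times> carrier G,
          monoid.mult = (\<lambda>(a, g) (b, h). (a \<otimes>\<^bsub>A\<^esub> b \<otimes>\<^bsub>A\<^esub> c g h, g \<otimes>\<^bsub>G\<^esub> h)),
          one = (inv\<^bsub>A\<^esub> c \<one>\<^bsub>G\<^esub> \<one>\<^bsub>G\<^esub>, \<one>\<^bsub>G\<^esub>)\<rparr>"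

lemma ext_carrier [simp]: "carrier ext = carrier A \<times> carrier G"
  by (simp add: ext_def)

lemma ext_mult [simp]: "(a, g) \<otimes>\<^bsub>ext\<^esub> (b, h) = (a \<otimes>\<^bsub>A\<^esub> b \<otimes>\<^bsub>A\<^esub> c g h, g \<otimes>\<^bsub>G\<^esub> h)"
  by (simp add: ext_def)

lemma ext_one [simp]: "\<one>\<^bsub>ext\<^esub> = (inv\<^bsub>A\<^esub> c \<one>\<^bsub>G\<^esub> \<one>\<^bsub>G\<^esub>, \<one>\<^bsub>G\<^esub>)"
  by (simp add: ext_def)

text \<open>An instance of the cocycle identity with two entries equal to \<open>1\<close>; together with its mirror image it
replaces normalisation.\<close>

lemma cocycle_one_left:
  assumes "g \<in> carrier G" shows "c \<one>\<^bsub>G\<^esub> g = c \<one>\<^bsub>G\<^esub> \<one>\<^bsub>G\<^esub>"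
  using cocycle[of "\<one>\<^bsub>G\<^esub>" "\<one>\<^bsub>G\<^esub>" g] assms by simp

lemma cocycle_one_right:
  assumes "g \<in> carrier G" shows "c g \<one>\<^bsub>G\<^esub> = c \<one>\<^bsub>G\<^esub> \<one>\<^bsub>G\<^esub>"
  using cocycle[of g "\<one>\<^bsub>G\<^esub>" "\<one>\<^bsub>G\<^esub>"] assms by simp

lemma ext_group: "group ext"
proof (rule groupI)
  fix x y z assume "x \<in> carrier ext" "y \<in> carrier ext" "z \<in> carrier ext"
  then obtain a g b h e k where [simp]: "x = (a, g)" "y = (b, h)" "z = (e, k)"
    and in_A: "a \<in> carrier A" "b \<in> carrier A" "e \<in> carrier A"
    and in_G: "g \<in> carrier G" "h \<in> carrier G" "k \<in> carrier G"
    by auto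
  have "a \<otimes>\<^bsub>A\<^esub> b \<otimes>\<^bsub>A\<^esub> c g h \<otimes>\<^bsub>A\<^esub> e \<otimes>\<^bsub>A\<^esub> c (g \<otimes>\<^bsub>G\<^esub> h) k
      = a \<otimes>\<^bsub>A\<^esub> b \<otimes>\<^bsub>A\<^esub> e \<otimes>\<^bsub>A\<^esub> (c g h \<otimes>\<^bsub>A\<^esub> c (g \<otimes>\<^bsub>G\<^esub> h) k)"
    using in_A in_G by (simp add: A.m_ac)
  also have "\<dots> = a \<otimes>\<^bsub>A\<^esub> (b \<otimes>\<^bsub>A\<^esub> e \<otimes>\<^bsub>A\<^esub> c h k) \<otimes>\<^bsub>A\<^esub> c g (h \<otimes>\<^bsub>G\<^esub> k)"
    using in_A in_G by (simp add: cocycle A.m_ac)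
  finally show "x \<otimes>\<^bsub>ext\<^esub> y \<otimes>\<^bsub>ext\<^esub> z = x \<otimes>\<^bsub>ext\<^esub> (y \<otimes>\<^bsub>ext\<^esub> z)"
    using in_G by (simp add: G.m_assoc)
next
  fix x assume "x \<in> carrier ext"
  then obtain a g where x: "x = (a, g)" "a \<in> carrier A" "g \<in> carrier G" by auto
  then show "\<one>\<^bsub>ext\<^esub> \<otimes>\<^bsub>ext\<^esub> x = x"
    by (simp add: cocycle_one_left[of g] A.m_ac)
  let ?y = "(inv\<^bsub>A\<^esub> a \<otimes>\<^bsub>A\<^esub> inv\<^bsub>A\<^esub> c (inv\<^bsub>G\<^esub> g) g \<otimes>\<^bsub>A\<^esub> inv\<^bsub>A\<^esub> c \<one>\<^bsub>G\<^esub> \<one>\<^bsub>G\<^esub>, inv\<^bsub>G\<^esub> g)"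
  have "inv\<^bsub>A\<^esub> a \<otimes>\<^bsub>A\<^esub> inv\<^bsub>A\<^esub> c (inv\<^bsub>G\<^esub> g) g \<otimes>\<^bsub>A\<^esub> inv\<^bsub>A\<^esub> c \<one>\<^bsub>G\<^esub> \<one>\<^bsub>G\<^esub> \<otimes>\<^bsub>A\<^esub> a \<otimes>\<^bsub>A\<^esub> c (inv\<^bsub>G\<^esub> g) g
    = (inv\<^bsub>A\<^esub> a \<otimes>\<^bsub>A\<^esub> a) \<otimes>\<^bsub>A\<^esub> (inv\<^bsub>A\<^esub> c (inv\<^bsub>G\<^esub> g) g \<otimes>\<^bsub>A\<^esub> c (inv\<^bsub>G\<^esub> g) g) \<otimes>\<^bsub>A\<^esub> inv\<^bsub>A\<^esub> c \<one>\<^bsub>G\<^esub> \<one>\<^bsub>G\<^esub>"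
    using x by (simp only: A.m_ac A.inv_closed A.m_closed c_closed G.inv_closed G.one_closed)
  then have "?y \<otimes>\<^bsub>ext\<^esub> x = \<one>\<^bsub>ext\<^esub>"
    using x by simp
  moreover have "?y \<in> carrier ext" using x by simp
  ultimately show "\<exists>y\<in>carrier ext. y \<otimes>\<^bsub>ext\<^esub> x = \<one>\<^bsub>ext\<^esub>" by blast
qed auto

text \<open>The factor \<open>c(1,1)\<^sup>-\<^sup>1\<close> sends the unit of \<open>A\<close> to the unit of the extension.\<close>

definition incl :: "'c \<Rightarrow> 'c \<times> 'a" where
  "incl a = (a \<otimes>\<^bsub>A\<^esub> inv\<^bsub>A\<^esub> c \<one>\<^bsub>G\<^esub> \<one>\<^bsub>G\<^esub>, \<one>\<^bsub>G\<^esub>)"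

lemma incl_mult:
  assumes "a \<in> carrier A" "b \<in> carrier A" "g \<in> carrier G"
  shows "incl a \<otimes>\<^bsub>ext\<^esub> (b, g) = (a \<otimes>\<^bsub>A\<^esub> b, g)" "(b, g) \<otimes>\<^bsub>ext\<^esub> incl a = (a \<otimes>\<^bsub>A\<^esub> b, g)"
  using assms by (simp_all add: incl_def cocycle_one_left[of g] cocycle_one_right[of g] A.m_ac)

lemma incl_hom: "group_hom A ext incl"
proof -
  have "incl (a \<otimes>\<^bsub>A\<^esub> b) = incl a \<otimes>\<^bsub>ext\<^esub> incl b" if "a \<in> carrier A" "b \<in> carrier A" for a b
  proof -
    have "incl b = (b \<otimes>\<^bsub>A\<^esub> inv\<^bsub>A\<^esub> c \<one>\<^bsub>G\<^esub> \<one>\<^bsub>G\<^esub>, \<one>\<^bsub>G\<^esub>)" by (simp add: incl_def)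
    then show ?thesis using that incl_mult(1)[of a "b \<otimes>\<^bsub>A\<^esub> inv\<^bsub>A\<^esub> c \<one>\<^bsub>G\<^esub> \<one>\<^bsub>G\<^esub>" "\<one>\<^bsub>G\<^esub>"]
      by (simp add: incl_def A.m_assoc)
  qed
  moreover have "incl a \<in> carrier ext" if "a \<in> carrier A" for a using that by (simp add: incl_def)
  ultimately show ?thesis using ext_group A.is_group
    by (simp add: group_hom_def group_hom_axioms_def hom_def)
qed

lemma incl_inj: "inj_on incl (carrier A)"
  by (auto simp: inj_on_def incl_def)

lemma kernel_snd: "kernel ext G snd = incl ` carrier A"
proof
  show "kernel ext G snd \<subseteq> incl ` carrier A"
  proof
    fix x assume "x \<in> kernel ext G snd"
    then obtain a where a: "a \<in> carrier A" "x = (a, \<one>\<^bsub>G\<^esub>)" by (auto simp: kernel_def)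
    then have "x = incl (a \<otimes>\<^bsub>A\<^esub> c \<one>\<^bsub>G\<^esub> \<one>\<^bsub>G\<^esub>)" by (simp add: incl_def A.m_assoc)
    then show "x \<in> incl ` carrier A" by (rule image_eqI) (use a in simp)
  qed
qed (auto simp: kernel_def incl_def)

lemma central_hom_snd: "central_hom ext G snd"
  unfolding central_hom_def
proof (intro conjI ballI)
  show "group_hom ext G snd"
    using ext_group G.is_group by (auto simp: group_hom_def group_hom_axioms_def hom_def)
next
  fix z x assume "z \<in> kernel ext G snd" "x \<in> carrier ext"
  then show "z \<otimes>\<^bsub>ext\<^esub> x = x \<otimes>\<^bsub>ext\<^esub> z"
    by (auto simp: kernel_snd incl_mult simp del: ext_mult)
qed

end

section \<open>The universal cocycle\<close>

abbreviation bar_chains2 :: "('a, 'b) monoid_scheme \<Rightarrow> ('a \<times> 'a \<Rightarrow>\<^sub>0 int) monoid" where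
  "bar_chains2 G \<equiv> free_Abelian_group (carrier G \<times> carrier G)"

abbreviation bar_bounds2 :: "('a, 'b) monoid_scheme \<Rightarrow> ('a \<times> 'a \<Rightarrow>\<^sub>0 int) set" where
  "bar_bounds2 G \<equiv> bar_d3 G ` carrier (free_Abelian_group (carrier G \<times> carrier G \<times> carrier G))"

abbreviation bar_cycles2 :: "('a, 'b) monoid_scheme \<Rightarrow> ('a \<times> 'a \<Rightarrow>\<^sub>0 int) set" where
  "bar_cycles2 G \<equiv> kernel (bar_chains2 G) (free_Abelian_group (carrier G)) (bar_d2 G)"

lemma frag_extend_hom:
  assumes "\<And>x. x \<in> S \<Longrightarrow> Poly_Mapping.keys (f x) \<subseteq> T"
  shows "group_hom (free_Abelian_group S) (free_Abelian_group T) (frag_extend f)"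
proof -
  have "Poly_Mapping.keys (frag_extend f z) \<subseteq> T" if "Poly_Mapping.keys z \<subseteq> S" for z
    using keys_frag_extend[of f z] that assms by blast
  then show ?thesis
    by (simp add: group_hom_def group_hom_axioms_def hom_def frag_extend_add)
qed

lemma keys_frag_add: "Poly_Mapping.keys a \<subseteq> T \<Longrightarrow> Poly_Mapping.keys b \<subseteq> T \<Longrightarrow> Poly_Mapping.keys (a + b) \<subseteq> T"
  using keys_add[of a b] by blast

lemma keys_frag_diff: "Poly_Mapping.keys a \<subseteq> T \<Longrightarrow> Poly_Mapping.keys b \<subseteq> T \<Longrightarrow> Poly_Mapping.keys (a - b) \<subseteq> T"
  using keys_diff[of a b] by blast

lemma bar_d2_hom:
  assumes "group G"
  shows "group_hom (bar_chains2 G) (free_Abelian_group (carrier G)) (bar_d2 G)"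
proof -
  interpret group G by fact
  show ?thesis unfolding bar_d2_def
  proof (rule frag_extend_hom, goal_cases)
    case (1 x)
    then show ?case by (cases x) (simp add: keys_frag_add keys_frag_diff keys_frag_of)
  qed
qed

lemma bar_d3_hom:
  assumes "group G"
  shows "group_hom (free_Abelian_group (carrier G \<times> carrier G \<times> carrier G)) (bar_chains2 G) (bar_d3 G)"
proof -
  interpret group G by fact
  show ?thesis unfolding bar_d3_def
  proof (rule frag_extend_hom, goal_cases)
    case (1 x)
    then show ?case by (cases x rule: prod_cases3) (simp add: keys_frag_add keys_frag_diff keys_frag_of)
  qed
qed

lemma free_Abelian_hom_eqI:
  assumes "group_hom (free_Abelian_group S) H f" "group_hom (free_Abelian_group S) H g"
    and "\<And>x. x \<in> S \<Longrightarrow> f (frag_of x) = g (frag_of x)" "z \<in> carrier (free_Abelian_group S)"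
  shows "f z = g z"
proof -
  interpret f: group_hom "free_Abelian_group S" H f by fact
  interpret g: group_hom "free_Abelian_group S" H g by fact
  have "Poly_Mapping.keys z \<subseteq> S \<and> f z = g z"
    using assms(4) unfolding carrier_free_Abelian_group_iff
  proof (induction rule: frag_induction)
    case zero
    then show ?case using f.hom_one g.hom_one by simp
  next
    case (one x)
    then show ?case using assms(3) by (simp add: keys_frag_of)
  next
    case (diff a b)
    have diff_eq: "a - b = a \<otimes>\<^bsub>free_Abelian_group S\<^esub> inv\<^bsub>free_Abelian_group S\<^esub> b"
      and mem: "a \<in> carrier (free_Abelian_group S)" "b \<in> carrier (free_Abelian_group S)"
      using diff by simp_all
    have "f (a - b) = g (a - b)"
      unfolding diff_eq using mem diff
      by (simp only: f.hom_mult f.hom_inv g.hom_mult g.hom_inv f.G.inv_closed)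
    then show ?case using diff keys_frag_diff by blast
  qed
  then show ?thesis by simp
qed

lemma bar_d2_d3:
  assumes "group G" "z \<in> carrier (free_Abelian_group (carrier G \<times> carrier G \<times> carrier G))"
  shows "bar_d2 G (bar_d3 G z) = 0"
proof -
  interpret G: group G by fact
  interpret d2: group_hom "bar_chains2 G" "free_Abelian_group (carrier G)" "bar_d2 G"
    by (rule bar_d2_hom) fact
  interpret d3: group_hom "free_Abelian_group (carrier G \<times> carrier G \<times> carrier G)" "bar_chains2 G" "bar_d3 G"
    by (rule bar_d3_hom) fact
  have "(bar_d2 G \<circ> bar_d3 G) z = (\<lambda>_. 0) z"
  proof (rule free_Abelian_hom_eqI[OF _ _ _ assms(2)])
    show "group_hom (free_Abelian_group (carrier G \<times> carrier G \<times> carrier G))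
        (free_Abelian_group (carrier G)) (bar_d2 G \<circ> bar_d3 G)"
      using group_hom_comp d2.group_hom_axioms d3.group_hom_axioms by blast
    show "group_hom (free_Abelian_group (carrier G \<times> carrier G \<times> carrier G))
        (free_Abelian_group (carrier G)) (\<lambda>_. 0)"
      by (simp add: group_hom_def group_hom_axioms_def hom_def)
  qed (auto simp: bar_d3_def bar_d2_def frag_extend_add frag_extend_diff G.m_assoc)
  then show ?thesis by simp
qed

locale bar_universal = group G for G :: "('a, 'b) monoid_scheme" (structure)
begin

text \<open>The coefficient group of the universal cocycle: 2-chains modulo boundaries. Dividing by boundaries is
exactly what turns \<open>(g,h) \<mapsto> [g|h]\<close> into a cocycle.\<close>

definition coeffs :: "('a \<times> 'a \<Rightarrow>\<^sub>0 int) set monoid" where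
  "coeffs = bar_chains2 G Mod bar_bounds2 G"

definition cls :: "('a \<times> 'a \<Rightarrow>\<^sub>0 int) \<Rightarrow> ('a \<times> 'a \<Rightarrow>\<^sub>0 int) set" where
  "cls z = bar_bounds2 G #>\<^bsub>bar_chains2 G\<^esub> z"

lemma bounds_subgroup: "subgroup (bar_bounds2 G) (bar_chains2 G)"
  using group_hom.img_is_subgroup[OF bar_d3_hom[OF is_group]] .

lemma bounds_normal: "bar_bounds2 G \<lhd> bar_chains2 G"
  using bounds_subgroup abelian_free_Abelian_group comm_group.subgroup_imp_normal by blast

lemma coeffs_comm_group: "comm_group coeffs"
  unfolding coeffs_def
  using bounds_subgroup abelian_free_Abelian_group comm_group.abelian_FactGroup by blast

lemma cls_hom: "group_hom (bar_chains2 G) coeffs cls"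
  unfolding coeffs_def cls_def[abs_def] by (rule group_hom_coset[OF bounds_normal])

lemma carrier_coeffs: "carrier coeffs = cls ` carrier (bar_chains2 G)"
  unfolding coeffs_def cls_def[abs_def] by (rule carrier_FactGroup)

lemma cls_one: "z \<in> carrier (bar_chains2 G) \<Longrightarrow> cls z = \<one>\<^bsub>coeffs\<^esub> \<longleftrightarrow> z \<in> bar_bounds2 G"
  unfolding coeffs_def cls_def one_FactGroup
  by (rule coset_eq_iff_mem[OF group_free_Abelian_group bounds_subgroup])

lemma universal_cocycle: "central_cocycle G coeffs (\<lambda>g h. cls (frag_of (g, h)))"
proof -
  interpret coeffs: comm_group coeffs by (rule coeffs_comm_group)
  interpret cls: group_hom "bar_chains2 G" coeffs cls by (rule cls_hom)
  show ?thesis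
  proof
    fix g h assume "g \<in> carrier G" "h \<in> carrier G"
    then show "cls (frag_of (g, h)) \<in> carrier coeffs" by (intro cls.hom_closed) simp
  next
    fix g h k assume in_G: "g \<in> carrier G" "h \<in> carrier G" "k \<in> carrier G"
    let ?l = "frag_of (g, h) + frag_of (g \<otimes> h, k)" and ?r = "frag_of (h, k) + frag_of (g, h \<otimes> k)"
    have "?r - ?l = bar_d3 G (frag_of (g, h, k))" by (simp add: bar_d3_def)
    then have "?r - ?l \<in> bar_bounds2 G" using in_G by (auto intro: image_eqI[of _ _ "frag_of (g, h, k)"])
    moreover have mem: "?l \<in> carrier (bar_chains2 G)" "?r \<in> carrier (bar_chains2 G)"
      "?r - ?l \<in> carrier (bar_chains2 G)"
      using in_G by (simp_all add: keys_frag_add keys_frag_diff keys_frag_of)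
    ultimately have one: "cls (?r - ?l) = \<one>\<^bsub>coeffs\<^esub>" using cls_one by blast
    have "cls ?r = cls ((?r - ?l) \<otimes>\<^bsub>bar_chains2 G\<^esub> ?l)" by simp
    also have "\<dots> = cls ?l" using mem one by (subst cls.hom_mult) (auto simp del: carrier_free_Abelian_group_iff mult_free_Abelian_group)
    finally have eq: "cls ?l = cls ?r" by simp
    have add: "cls (frag_of x + frag_of y) = cls (frag_of x) \<otimes>\<^bsub>coeffs\<^esub> cls (frag_of y)"
      if "x \<in> carrier G \<times> carrier G" "y \<in> carrier G \<times> carrier G" for x y
      using cls.hom_mult[of "frag_of x" "frag_of y"] that by simp
    show "cls (frag_of (g, h)) \<otimes>\<^bsub>coeffs\<^esub> cls (frag_of (g \<otimes> h, k)) =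
          cls (frag_of (h, k)) \<otimes>\<^bsub>coeffs\<^esub> cls (frag_of (g, h \<otimes> k))"
      using eq in_G by (simp add: add)
  qed
qed

sublocale U: central_cocycle G coeffs "\<lambda>g h. cls (frag_of (g, h))"
  by (rule universal_cocycle)

text \<open>The universal property: a set-theoretic section \<open>s\<close> of a central extension defines a cocycle
\<open>k(g,h) = s(g) s(h) s(gh)\<^sup>-\<^sup>1\<close> in the central kernel. The homomorphism \<open>[g|h] \<mapsto> k(g,h)\<close> on 2-chains kills
boundaries by the cocycle identity and induces \<open>\<tau>\<close> on the coefficients; then
\<open>(a,g) \<mapsto> \<tau>(a) s(g)\<close> is the required homomorphism.\<close>

lemma ext_maps_to_central_extension:
  assumes "central_hom E G p" "p ` carrier E = carrier G"
  obtains f where "f \<in> hom U.ext E" "\<And>x. x \<in> carrier U.ext \<Longrightarrow> p (f x) = snd x"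
proof -
  interpret p: group_hom E G p using assms(1) by (simp add: central_hom_def)
  have central: "z \<otimes>\<^bsub>E\<^esub> x = x \<otimes>\<^bsub>E\<^esub> z" if "z \<in> kernel E G p" "x \<in> carrier E" for z x
    using that assms(1) by (auto simp: central_hom_def)
  define K where "K = E\<lparr>carrier := kernel E G p\<rparr>"
  have "group K" unfolding K_def using p.subgroup_kernel p.G.subgroup_imp_group by blast
  then have K: "comm_group K"
    by (rule group.group_comm_groupI) (auto simp: K_def central kernel_def)
  interpret K: comm_group K by (rule K)
  have [simp]: "x \<otimes>\<^bsub>K\<^esub> y = x \<otimes>\<^bsub>E\<^esub> y" "\<one>\<^bsub>K\<^esub> = \<one>\<^bsub>E\<^esub>" for x y by (simp_all add: K_def)
  have K_mem: "x \<in> carrier K \<longleftrightarrow> x \<in> carrier E \<and> p x = \<one>" for x by (simp add: K_def kernel_def)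
  have K_central: "z \<otimes>\<^bsub>E\<^esub> x = x \<otimes>\<^bsub>E\<^esub> z" if "z \<in> carrier K" "x \<in> carrier E" for z x
    using that central by (simp add: K_def)
  have "\<forall>g\<in>carrier G. \<exists>x. x \<in> carrier E \<and> p x = g" using assms(2) by (metis imageE)
  then obtain s where s: "\<And>g. g \<in> carrier G \<Longrightarrow> s g \<in> carrier E \<and> p (s g) = g" by metis
  define k where "k = (\<lambda>(g, h). s g \<otimes>\<^bsub>E\<^esub> s h \<otimes>\<^bsub>E\<^esub> inv\<^bsub>E\<^esub> s (g \<otimes> h))"
  have k_K: "k (g, h) \<in> carrier K" if "g \<in> carrier G" "h \<in> carrier G" for g h
    using that s by (simp add: K_mem k_def)
  then have k_E: "k (g, h) \<in> carrier E" if "g \<in> carrier G" "h \<in> carrier G" for g h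
    using that K_mem by blast
  have k_eq: "k (g, h) \<otimes>\<^bsub>E\<^esub> s (g \<otimes> h) = s g \<otimes>\<^bsub>E\<^esub> s h" if "g \<in> carrier G" "h \<in> carrier G" for g h
    using that s by (simp add: k_def p.G.m_assoc)
  have k_cocycle: "k (g, h) \<otimes>\<^bsub>E\<^esub> k (g \<otimes> h, l) = k (h, l) \<otimes>\<^bsub>E\<^esub> k (g, h \<otimes> l)"
    if in_G: "g \<in> carrier G" "h \<in> carrier G" "l \<in> carrier G" for g h l
  proof -
    have "k (g, h) \<otimes>\<^bsub>E\<^esub> k (g \<otimes> h, l) \<otimes>\<^bsub>E\<^esub> s (g \<otimes> h \<otimes> l) = k (g, h) \<otimes>\<^bsub>E\<^esub> (k (g \<otimes> h, l) \<otimes>\<^bsub>E\<^esub> s (g \<otimes> h \<otimes> l))"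
      using in_G s k_E by (simp add: p.G.m_assoc)
    also have "\<dots> = k (g, h) \<otimes>\<^bsub>E\<^esub> s (g \<otimes> h) \<otimes>\<^bsub>E\<^esub> s l"
      unfolding k_eq[OF m_closed[OF in_G(1,2)] in_G(3)] using in_G s k_E by (simp add: p.G.m_assoc)
    also have "\<dots> = s g \<otimes>\<^bsub>E\<^esub> s h \<otimes>\<^bsub>E\<^esub> s l"
      using in_G by (simp add: k_eq)
    also have "\<dots> = s g \<otimes>\<^bsub>E\<^esub> (s h \<otimes>\<^bsub>E\<^esub> s l)"
      using in_G s by (simp add: p.G.m_assoc)
    also have "\<dots> = s g \<otimes>\<^bsub>E\<^esub> (k (h, l) \<otimes>\<^bsub>E\<^esub> s (h \<otimes> l))"
      using in_G by (simp add: k_eq)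
    also have "\<dots> = k (h, l) \<otimes>\<^bsub>E\<^esub> (s g \<otimes>\<^bsub>E\<^esub> s (h \<otimes> l))"
      using in_G s k_E K_central[OF k_K, of h l "s g"] by (simp flip: p.G.m_assoc)
    also have "\<dots> = k (h, l) \<otimes>\<^bsub>E\<^esub> (k (g, h \<otimes> l) \<otimes>\<^bsub>E\<^esub> s (g \<otimes> (h \<otimes> l)))"
      using in_G by (simp add: k_eq)
    also have "\<dots> = k (h, l) \<otimes>\<^bsub>E\<^esub> k (g, h \<otimes> l) \<otimes>\<^bsub>E\<^esub> s (g \<otimes> h \<otimes> l)"
      using in_G s k_E by (simp add: p.G.m_assoc m_assoc)
    finally show ?thesis using in_G s k_E by simp
  qed
  have "k ` (carrier G \<times> carrier G) \<subseteq> carrier K" using k_K by auto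
  then obtain \<theta> where \<theta>: "\<theta> \<in> hom (bar_chains2 G) K"
      and \<theta>_of: "\<And>x. x \<in> carrier G \<times> carrier G \<Longrightarrow> \<theta> (frag_of x) = k x"
    using K.free_Abelian_group_universal by blast
  interpret \<theta>: group_hom "bar_chains2 G" K \<theta>
    using \<theta> group_homI K.is_group group_free_Abelian_group by blast
  interpret d3: group_hom "free_Abelian_group (carrier G \<times> carrier G \<times> carrier G)" "bar_chains2 G" "bar_d3 G"
    by (rule bar_d3_hom) (rule is_group)
  have \<theta>_add: "\<theta> (a + b) = \<theta> a \<otimes>\<^bsub>E\<^esub> \<theta> b" 
    if "Poly_Mapping.keys a \<subseteq> carrier G \<times> carrier G" "Poly_Mapping.keys b \<subseteq> carrier G \<times> carrier G" for a b
    using \<theta>.hom_mult[of a b] that by simp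
  have "(\<theta> \<circ> bar_d3 G) z = (\<lambda>_. \<one>\<^bsub>K\<^esub>) z"
    if "z \<in> carrier (free_Abelian_group (carrier G \<times> carrier G \<times> carrier G))" for z
  proof (rule free_Abelian_hom_eqI[OF _ _ _ that])
    show "group_hom (free_Abelian_group (carrier G \<times> carrier G \<times> carrier G)) K (\<theta> \<circ> bar_d3 G)"
      using group_hom_comp \<theta>.group_hom_axioms d3.group_hom_axioms by blast
    show "group_hom (free_Abelian_group (carrier G \<times> carrier G \<times> carrier G)) K (\<lambda>_. \<one>\<^bsub>K\<^esub>)"
      by (rule group_hom_trivial[OF group_free_Abelian_group K.is_group])
    fix x assume "x \<in> carrier G \<times> carrier G \<times> carrier G"
    then obtain g h l where x: "x = (g, h, l)" "g \<in> carrier G" "h \<in> carrier G" "l \<in> carrier G" by auto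
    let ?b = "bar_d3 G (frag_of x)"
    have keys: "Poly_Mapping.keys ?b \<subseteq> carrier G \<times> carrier G"
      using d3.hom_closed[of "frag_of x"] x by simp
    \<comment> \<open>The boundary is moved to the side where only sums occur, so that \<open>\<theta>\<close> need not be applied to differences.\<close>
    have "?b + (frag_of (g, h) + frag_of (g \<otimes> h, l)) = frag_of (h, l) + frag_of (g, h \<otimes> l)"
      by (simp add: x bar_d3_def)
    then have "\<theta> (?b + (frag_of (g, h) + frag_of (g \<otimes> h, l))) = \<theta> (frag_of (h, l) + frag_of (g, h \<otimes> l))"
      by simp
    then have "\<theta> ?b \<otimes>\<^bsub>E\<^esub> (k (g, h) \<otimes>\<^bsub>E\<^esub> k (g \<otimes> h, l)) = k (h, l) \<otimes>\<^bsub>E\<^esub> k (g, h \<otimes> l)"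
      using x keys by (simp add: \<theta>_add \<theta>_of keys_frag_add keys_frag_of)
    then have "\<theta> ?b \<otimes>\<^bsub>E\<^esub> (k (h, l) \<otimes>\<^bsub>E\<^esub> k (g, h \<otimes> l)) = k (h, l) \<otimes>\<^bsub>E\<^esub> k (g, h \<otimes> l)"
      using x by (simp add: k_cocycle)
    moreover have "\<theta> ?b \<in> carrier E"
      using \<theta>.hom_closed[of ?b] keys K_mem by simp
    ultimately show "(\<theta> \<circ> bar_d3 G) (frag_of x) = \<one>\<^bsub>K\<^esub>"
      using x k_E by simp
  qed
  then have "bar_bounds2 G \<subseteq> kernel (bar_chains2 G) K \<theta>"
    using d3.hom_closed by (auto simp: kernel_def simp del: carrier_free_Abelian_group_iff)
  then obtain \<tau> where \<tau>: "\<tau> \<in> hom coeffs K" and \<tau>_cls: "\<And>z. z \<in> carrier (bar_chains2 G) \<Longrightarrow> \<tau> (cls z) = \<theta> z"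
    using \<theta>.FactGroup_universal_kernel[OF bounds_normal] unfolding coeffs_def cls_def by metis
  have \<tau>_E: "\<tau> a \<in> carrier K" "\<tau> a \<in> carrier E" "p (\<tau> a) = \<one>" if "a \<in> carrier coeffs" for a
    using \<tau> that K_mem by (auto simp: hom_def)
  have \<tau>_mult: "\<tau> (a \<otimes>\<^bsub>coeffs\<^esub> b) = \<tau> a \<otimes>\<^bsub>E\<^esub> \<tau> b" if "a \<in> carrier coeffs" "b \<in> carrier coeffs" for a b
    using \<tau> that by (auto simp: hom_def)
  define f where "f = (\<lambda>(a, g). \<tau> a \<otimes>\<^bsub>E\<^esub> s g)"
  have "f \<in> hom U.ext E"
  proof (rule homI)
    fix x assume "x \<in> carrier U.ext"
    then show "f x \<in> carrier E" using \<tau>_E s by (auto simp: f_def)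
  next
    fix x y assume "x \<in> carrier U.ext" "y \<in> carrier U.ext"
    then obtain a g b h where [simp]: "x = (a, g)" "y = (b, h)"
      and in_A: "a \<in> carrier coeffs" "b \<in> carrier coeffs" and in_G: "g \<in> carrier G" "h \<in> carrier G"
      by auto
    have "f (x \<otimes>\<^bsub>U.ext\<^esub> y) = \<tau> a \<otimes>\<^bsub>E\<^esub> \<tau> b \<otimes>\<^bsub>E\<^esub> k (g, h) \<otimes>\<^bsub>E\<^esub> s (g \<otimes> h)"
      using in_A in_G by (simp add: f_def \<tau>_mult \<tau>_cls \<theta>_of)
    also have "\<dots> = \<tau> a \<otimes>\<^bsub>E\<^esub> (\<tau> b \<otimes>\<^bsub>E\<^esub> s g) \<otimes>\<^bsub>E\<^esub> s h"
      using in_A in_G \<tau>_E s k_E by (simp add: p.G.m_assoc k_eq)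
    also have "\<dots> = f x \<otimes>\<^bsub>E\<^esub> f y"
      using in_A in_G \<tau>_E s K_central[of "\<tau> b" "s g"] by (simp add: f_def p.G.m_assoc)
    finally show "f (x \<otimes>\<^bsub>U.ext\<^esub> y) = f x \<otimes>\<^bsub>E\<^esub> f y" .
  qed
  moreover have "p (f x) = snd x" if "x \<in> carrier U.ext" for x
    using that \<tau>_E s by (auto simp: f_def)
  ultimately show thesis using that by blast
qed

end

section \<open>The multiplier of the universal extension is the second homology group\<close>

context bar_universal
begin

text \<open>Passing from the quotient of the cycles to a subgroup of the quotient of the chains is an equality of
records, because cosets are formed by the same multiplication.\<close>

lemma H2_eq: "H2 G = coeffs\<lparr>carrier := cls ` bar_cycles2 G\<rparr>"
proof -
  let ?C = "bar_chains2 G"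
  have "carrier (?C\<lparr>carrier := bar_cycles2 G\<rparr> Mod bar_bounds2 G) = cls ` bar_cycles2 G"
    unfolding carrier_FactGroup cls_def[abs_def] by simp
  then show ?thesis
    unfolding H2_def Let_def coeffs_def by (simp add: FactGroup_def fun_eq_iff)
qed

text \<open>The Abelianisation of the universal extension is the group of 1-chains, via
\<open>(a,g) \<mapsto> d\<^sub>2 a + [g]\<close>, and this map restricts to \<open>d\<^sub>2\<close> on the coefficients. Hence an element of the
coefficients is a product of commutators if and only if it is a cycle. For the
converse direction, with \<open>u(g) = (0,g)\<close>, the relation
\<open>[g|h] u(gh) = u(g) u(h)\<close> shows that the image of \<open>z\<close> in the Abelianisation is the image of
\<open>d\<^sub>2 z\<close> under \<open>[g] \<mapsto> u(g)\<close>.\<close>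

lemma incl_cls_in_derived_iff:
  assumes z: "z \<in> carrier (bar_chains2 G)"
  shows "U.incl (cls z) \<in> derived U.ext (carrier U.ext) \<longleftrightarrow> z \<in> bar_cycles2 G"
proof -
  let ?C1 = "free_Abelian_group (carrier G)" and ?D = "derived U.ext (carrier U.ext)"
  interpret d2: group_hom "bar_chains2 G" ?C1 "bar_d2 G" by (rule bar_d2_hom) (rule is_group)
  interpret C1: comm_group ?C1 by (rule abelian_free_Abelian_group)
  interpret cls: group_hom "bar_chains2 G" coeffs cls by (rule cls_hom)
  interpret incl: group_hom coeffs U.ext U.incl by (rule U.incl_hom)
  have pair: "frag_of (g, h) \<in> carrier (bar_chains2 G)" if "g \<in> carrier G" "h \<in> carrier G" for g h
    using that by simp
  note cls_pair = cls.hom_closed[OF pair]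
  show ?thesis
  proof
    assume derived: "U.incl (cls z) \<in> ?D"
    \<comment> \<open>\<open>\<delta>\<close> is the map induced by \<open>d\<^sub>2\<close> and \<open>\<chi>\<close> the map to 1-chains; it kills commutators.\<close>
    have "bar_bounds2 G \<subseteq> kernel (bar_chains2 G) ?C1 (bar_d2 G)"
    proof
      fix b assume b: "b \<in> bar_bounds2 G"
      then have "b \<in> carrier (bar_chains2 G)" using subgroup.mem_carrier[OF bounds_subgroup] by blast
      then show "b \<in> kernel (bar_chains2 G) ?C1 (bar_d2 G)"
        using b bar_d2_d3[OF is_group] by (auto simp: kernel_def simp del: carrier_free_Abelian_group_iff)
    qed
    then obtain \<delta> where \<delta>: "\<delta> \<in> hom coeffs ?C1"
        and \<delta>_cls: "\<And>z. z \<in> carrier (bar_chains2 G) \<Longrightarrow> \<delta> (cls z) = bar_d2 G z"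
      using d2.FactGroup_universal_kernel[OF bounds_normal] unfolding coeffs_def cls_def by metis
    interpret \<delta>: group_hom coeffs ?C1 \<delta>
      using \<delta> group_homI U.A.is_group group_free_Abelian_group by blast
    have \<delta>_mult: "\<delta> (a \<otimes>\<^bsub>coeffs\<^esub> b) = \<delta> a + \<delta> b" if "a \<in> carrier coeffs" "b \<in> carrier coeffs" for a b
      using \<delta>.hom_mult[OF that] by simp
    define \<chi> where "\<chi> = (\<lambda>(a, g). \<delta> a + frag_of g)"
    have "group_hom U.ext ?C1 \<chi>"
    proof -
      have "\<chi> \<in> hom U.ext ?C1"
      proof (rule homI)
        fix x assume "x \<in> carrier U.ext"
        then show "\<chi> x \<in> carrier ?C1"
          using \<delta>.hom_closed by (cases x) (simp add: \<chi>_def keys_frag_add keys_frag_of)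
      next
        fix x y assume "x \<in> carrier U.ext" "y \<in> carrier U.ext"
        then obtain a g b h where "x = (a, g)" "y = (b, h)"
          and in_A: "a \<in> carrier coeffs" "b \<in> carrier coeffs" and in_G: "g \<in> carrier G" "h \<in> carrier G"
          by auto
        then show "\<chi> (x \<otimes>\<^bsub>U.ext\<^esub> y) = \<chi> x \<otimes>\<^bsub>?C1\<^esub> \<chi> y"
          using \<delta>_cls[OF pair[OF in_G]] cls_pair[OF in_G] by (simp add: \<chi>_def \<delta>_mult bar_d2_def)
      qed
      then show ?thesis using U.ext_group group_free_Abelian_group by (simp add: group_hom_def group_hom_axioms_def)
    qed
    then have "\<chi> (U.incl (cls z)) \<in> derived ?C1 (carrier ?C1)"
      using derived by (rule hom_image_derived_le)
    then have "\<chi> (U.incl (cls z)) = 0"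
      using C1.derived_eq_singleton[of "carrier ?C1"] by simp
    moreover have "\<chi> (U.incl (cls z)) = bar_d2 G z"
    proof -
      let ?e = "cls (frag_of (\<one>, \<one>))"
      have e: "?e \<in> carrier coeffs" using cls_pair by simp
      have "\<delta> ?e = frag_of \<one>" using \<delta>_cls[OF pair, of \<one> \<one>] by (simp add: bar_d2_def)
      moreover have "Poly_Mapping.keys (frag_of \<one>) \<subseteq> carrier G" by simp
      ultimately have "\<delta> (inv\<^bsub>coeffs\<^esub> ?e) = - frag_of \<one>" using e \<delta>.hom_inv[OF e] by simp
      then show ?thesis
        using e cls.hom_closed[OF z] \<delta>_cls[OF z] by (simp add: \<chi>_def U.incl_def \<delta>_mult)
    qed
    ultimately show "z \<in> bar_cycles2 G" using z by (simp add: kernel_def)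
  next
    assume cycle: "z \<in> bar_cycles2 G"
    let ?Q = "U.ext Mod ?D"
    have D: "?D \<lhd> U.ext" by (rule incl.H.derived_self_is_normal)
    interpret Q: comm_group ?Q by (rule incl.H.derived_quot_is_comm_group)
    let ?q = "\<lambda>x. ?D #>\<^bsub>U.ext\<^esub> x"
    interpret q: group_hom U.ext ?Q ?q using D by (rule group_hom_coset)
    define u where "u g = (\<one>\<^bsub>coeffs\<^esub>, g)" for g :: 'a
    have u: "u g \<in> carrier U.ext" if "g \<in> carrier G" for g using that by (simp add: u_def)
    obtain j where j: "j \<in> hom ?C1 ?Q" and j_of: "\<And>g. g \<in> carrier G \<Longrightarrow> j (frag_of g) = ?q (u g)"
      using Q.free_Abelian_group_universal[of "\<lambda>g. ?q (u g)" "carrier G"] u q.hom_closed by blast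
    interpret j: group_hom ?C1 ?Q j
      using j group_homI group_free_Abelian_group Q.is_group by blast
    have "(?q \<circ> (U.incl \<circ> cls)) z = (j \<circ> bar_d2 G) z"
    proof (rule free_Abelian_hom_eqI[OF _ _ _ z])
      show "group_hom (bar_chains2 G) ?Q (?q \<circ> (U.incl \<circ> cls))"
        by (rule group_hom_comp[OF group_hom_comp[OF cls_hom incl.group_hom_axioms] q.group_hom_axioms])
      show "group_hom (bar_chains2 G) ?Q (j \<circ> bar_d2 G)"
        by (rule group_hom_comp[OF d2.group_hom_axioms j.group_hom_axioms])
      fix x assume "x \<in> carrier G \<times> carrier G"
      then obtain g h where x: "x = (g, h)" and in_G: "g \<in> carrier G" "h \<in> carrier G" by auto
      have c: "cls (frag_of x) \<in> carrier coeffs" using cls_pair[OF in_G] x by simp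
      have "U.incl (cls (frag_of x)) \<otimes>\<^bsub>U.ext\<^esub> u (g \<otimes> h) = u g \<otimes>\<^bsub>U.ext\<^esub> u h"
        using c in_G unfolding u_def by (subst U.incl_mult) (simp_all add: x)
      then have "?q (U.incl (cls (frag_of x)) \<otimes>\<^bsub>U.ext\<^esub> u (g \<otimes> h)) = ?q (u g \<otimes>\<^bsub>U.ext\<^esub> u h)"
        by (rule arg_cong)
      then have "?q (U.incl (cls (frag_of x))) \<otimes>\<^bsub>?Q\<^esub> ?q (u (g \<otimes> h)) = ?q (u g) \<otimes>\<^bsub>?Q\<^esub> ?q (u h)"
        using q.hom_mult[OF incl.hom_closed[OF c] u[OF m_closed[OF in_G]]]
          q.hom_mult[OF u[OF in_G(1)] u[OF in_G(2)]] by simp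
      moreover have "j (bar_d2 G (frag_of x)) \<otimes>\<^bsub>?Q\<^esub> ?q (u (g \<otimes> h)) = ?q (u g) \<otimes>\<^bsub>?Q\<^esub> ?q (u h)"
      proof -
        have mem: "bar_d2 G (frag_of x) \<in> carrier ?C1" using d2.hom_closed[OF pair[OF in_G]] x by simp
        have "j (bar_d2 G (frag_of x)) \<otimes>\<^bsub>?Q\<^esub> j (frag_of (g \<otimes> h))
            = j (bar_d2 G (frag_of x) + frag_of (g \<otimes> h))"
          using j.hom_mult[OF mem, of "frag_of (g \<otimes> h)"] in_G by simp
        also have "\<dots> = j (frag_of g + frag_of h)" by (simp add: x bar_d2_def add.commute)
        also have "\<dots> = j (frag_of g) \<otimes>\<^bsub>?Q\<^esub> j (frag_of h)"
          using j.hom_mult[of "frag_of g" "frag_of h"] in_G by simp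
        finally show ?thesis using in_G by (simp add: j_of)
      qed
      moreover have "bar_d2 G (frag_of x) \<in> carrier ?C1" using d2.hom_closed[OF pair[OF in_G]] x by simp
      ultimately have "?q (U.incl (cls (frag_of x))) = j (bar_d2 G (frag_of x))"
        using Q.right_cancel q.hom_closed[OF u[OF m_closed[OF in_G]]] q.hom_closed[OF incl.hom_closed[OF c]]
          j.hom_closed by metis
      then show "(?q \<circ> (U.incl \<circ> cls)) (frag_of x) = (j \<circ> bar_d2 G) (frag_of x)" by simp
    qed
    moreover have "bar_d2 G z = \<one>\<^bsub>?C1\<^esub>" using cycle by (simp add: kernel_def)
    ultimately have "?q (U.incl (cls z)) = ?D" using j.hom_one by simp
    then show "U.incl (cls z) \<in> ?D"
      using coset_eq_iff_mem[OF U.ext_group normal_imp_subgroup[OF D]] incl.hom_closed[OF cls.hom_closed[OF z]]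
      by blast
  qed
qed

lemma incl_iso_multiplier: "U.incl \<in> iso (H2 G) (U.ext\<lparr>carrier := multiplier U.ext G snd\<rparr>)"
proof -
  interpret cls: group_hom "bar_chains2 G" coeffs cls by (rule cls_hom)
  interpret incl: group_hom coeffs U.ext U.incl by (rule U.incl_hom)
  have cycles: "bar_cycles2 G \<subseteq> carrier (bar_chains2 G)" by (auto simp: kernel_def)
  have image: "U.incl ` (cls ` bar_cycles2 G) = multiplier U.ext G snd"
    unfolding multiplier_def U.kernel_snd carrier_coeffs
    using incl_cls_in_derived_iff cycles by blast
  have sub: "cls ` bar_cycles2 G \<subseteq> carrier coeffs"
    using cycles unfolding carrier_coeffs by blast
  show ?thesis
    unfolding iso_def bij_betw_def H2_eq
  proof (intro CollectI conjI)
    show "U.incl \<in> hom (coeffs\<lparr>carrier := cls ` bar_cycles2 G\<rparr>) (U.ext\<lparr>carrier := multiplier U.ext G snd\<rparr>)"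
      by (rule homI) (use image sub incl.hom_mult in \<open>auto simp: subset_iff\<close>)
    show "inj_on U.incl (carrier (coeffs\<lparr>carrier := cls ` bar_cycles2 G\<rparr>))"
      using inj_on_subset[OF U.incl_inj sub] by simp
    show "U.incl ` carrier (coeffs\<lparr>carrier := cls ` bar_cycles2 G\<rparr>) = carrier (U.ext\<lparr>carrier := multiplier U.ext G snd\<rparr>)"
      using image by simp
  qed
qed

end

section \<open>Hopf's formula\<close>

locale presentation = group_hom F G \<pi>
  for F :: "('f, 'c) monoid_scheme" and G :: "('a, 'b) monoid_scheme" and \<pi> +
  assumes surj: "\<pi> ` carrier F = carrier G"
begin

abbreviation N :: "'f set" where "N \<equiv> kernel F G \<pi>"
abbreviation FN :: "'f set" where "FN \<equiv> commutator_subgroup F (carrier F) N"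

lemma FN_normal: "FN \<lhd> F" and FN_le_N: "FN \<subseteq> N" and FN_le_derived: "FN \<subseteq> derived F (carrier F)"
  using G.commutator_subgroup_normal[OF normal_kernel] by blast+

definition proj :: "'f set \<Rightarrow> 'a" where
  "proj A = the_elem (\<pi> ` A)"

lemma proj_hom: "group_hom (F Mod FN) G proj"
  and proj_kernel: "kernel (F Mod FN) G proj = (\<lambda>x. FN #>\<^bsub>F\<^esub> x) ` N"
  and proj_surj: "proj ` carrier (F Mod FN) = carrier G"
  using hom_FactGroup_induced[OF group_hom_axioms FN_normal FN_le_N] surj
  unfolding proj_def[abs_def] by simp_all

lemma proj_coset: "x \<in> carrier F \<Longrightarrow> proj (FN #>\<^bsub>F\<^esub> x) = \<pi> x"
  unfolding proj_def using the_elem_image_coset[OF group_hom_axioms normal_imp_subgroup[OF FN_normal] FN_le_N] .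

text \<open>For \<open>m \<in> N\<close> the commutator \<open>[f,m]\<close> lies in \<open>[F,N]\<close>, so \<open>fm\<close> and \<open>mf\<close> have the same coset.\<close>

lemma proj_central: "central_hom (F Mod FN) G proj"
  unfolding central_hom_def
proof (intro conjI ballI)
  show "group_hom (F Mod FN) G proj" by (rule proj_hom)
next
  interpret q: group_hom F "F Mod FN" "\<lambda>x. FN #>\<^bsub>F\<^esub> x" by (rule group_hom_coset[OF FN_normal])
  fix z x assume "z \<in> kernel (F Mod FN) G proj" "x \<in> carrier (F Mod FN)"
  then obtain m f where m: "m \<in> N" "z = FN #>\<^bsub>F\<^esub> m" and f: "f \<in> carrier F" "x = FN #>\<^bsub>F\<^esub> f"
    by (auto simp: proj_kernel carrier_FactGroup)
  have mF: "m \<in> carrier F" using m by (simp add: kernel_def)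
  let ?k = "f \<otimes>\<^bsub>F\<^esub> m \<otimes>\<^bsub>F\<^esub> inv\<^bsub>F\<^esub> f \<otimes>\<^bsub>F\<^esub> inv\<^bsub>F\<^esub> m"
  have "?k \<in> FN" using f m by (intro G.commutator_mem)
  then have one: "FN #>\<^bsub>F\<^esub> ?k = \<one>\<^bsub>F Mod FN\<^esub>"
    using coset_eq_iff_mem[OF G.is_group normal_imp_subgroup[OF FN_normal], of ?k] f mF by simp
  have "f \<otimes>\<^bsub>F\<^esub> m = ?k \<otimes>\<^bsub>F\<^esub> (m \<otimes>\<^bsub>F\<^esub> f)"
    using f mF by (simp add: G.m_assoc G.inv_mult_cancel)
  then have "FN #>\<^bsub>F\<^esub> (f \<otimes>\<^bsub>F\<^esub> m) = (FN #>\<^bsub>F\<^esub> ?k) \<otimes>\<^bsub>F Mod FN\<^esub> (FN #>\<^bsub>F\<^esub> (m \<otimes>\<^bsub>F\<^esub> f))"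
    using f mF q.hom_mult[of ?k "m \<otimes>\<^bsub>F\<^esub> f"] by simp
  also have "\<dots> = FN #>\<^bsub>F\<^esub> (m \<otimes>\<^bsub>F\<^esub> f)"
    unfolding one by (rule q.H.l_one[OF q.hom_closed[OF G.m_closed[OF mF f(1)]]])
  finally show "z \<otimes>\<^bsub>F Mod FN\<^esub> x = x \<otimes>\<^bsub>F Mod FN\<^esub> z"
    unfolding m f using q.hom_mult[OF mF f(1)] q.hom_mult[OF f(1) mF] by simp
qed

text \<open>Membership does not depend on the representative because \<open>[F,N] \<le> [F,F]\<close>.\<close>

lemma coset_in_derived_iff:
  assumes "x \<in> carrier F"
  shows "FN #>\<^bsub>F\<^esub> x \<in> derived (F Mod FN) (carrier (F Mod FN)) \<longleftrightarrow> x \<in> derived F (carrier F)"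
proof -
  interpret q: group_hom F "F Mod FN" "\<lambda>x. FN #>\<^bsub>F\<^esub> x" by (rule group_hom_coset[OF FN_normal])
  have D: "subgroup (derived F (carrier F)) F" by (simp add: G.derived_is_subgroup)
  have eq: "derived (F Mod FN) (carrier (F Mod FN)) = (\<lambda>x. FN #>\<^bsub>F\<^esub> x) ` derived F (carrier F)"
    using q.derived_img[of "carrier F"] by (simp add: carrier_FactGroup)
  show ?thesis
  proof
    assume "FN #>\<^bsub>F\<^esub> x \<in> derived (F Mod FN) (carrier (F Mod FN))"
    then obtain y where y: "y \<in> derived F (carrier F)" "FN #>\<^bsub>F\<^esub> x = FN #>\<^bsub>F\<^esub> y" unfolding eq by blast
    have "x \<in> FN #>\<^bsub>F\<^esub> x" using assms G.rcos_self normal_imp_subgroup[OF FN_normal] by blast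
    then obtain k where "k \<in> FN" "x = k \<otimes>\<^bsub>F\<^esub> y" unfolding y(2) by (auto simp: r_coset_def)
    then show "x \<in> derived F (carrier F)"
      using y(1) FN_le_derived subgroup.m_closed[OF D] by blast
  qed (simp add: eq)
qed

lemma hopf_group_eq: "hopf_group F N = (F Mod FN)\<lparr>carrier := multiplier (F Mod FN) G proj\<rparr>"
proof -
  let ?H = "N \<inter> derived F (carrier F)"
  have "carrier (F\<lparr>carrier := ?H\<rparr> Mod FN) = (\<lambda>x. FN #>\<^bsub>F\<^esub> x) ` ?H"
    unfolding carrier_FactGroup by simp
  also have "\<dots> = multiplier (F Mod FN) G proj"
    unfolding multiplier_def proj_kernel using coset_in_derived_iff by (auto simp: kernel_def)
  finally show ?thesis
    unfolding hopf_group_def by (simp add: FactGroup_def fun_eq_iff)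
qed

text \<open>The universal extension maps to \<open>F/[F,N]\<close> by its universal property. In the other direction, freeness
lifts \<open>\<pi>\<close> to a homomorphism from \<open>F\<close> to the universal extension; it sends \<open>N\<close> into the central kernel,
hence kills \<open>[F,N]\<close>. So the two extensions have isomorphic multipliers.\<close>

theorem hopf_formula:
  assumes "free_group F"
  shows "H2 G \<cong> hopf_group F N"
proof -
  interpret bar_universal G by unfold_locales
  interpret q: group_hom F "F Mod FN" "\<lambda>x. FN #>\<^bsub>F\<^esub> x" by (rule group_hom_coset[OF FN_normal])
  interpret snd: group_hom U.ext G snd using U.central_hom_snd by (simp add: central_hom_def)
  obtain f where f: "f \<in> hom U.ext (F Mod FN)" "\<And>x. x \<in> carrier U.ext \<Longrightarrow> proj (f x) = snd x"
    using ext_maps_to_central_extension[OF proj_central proj_surj] by blast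
  have "\<pi> ` carrier F \<subseteq> snd ` carrier U.ext"
    using surj U.A.one_closed by (force simp: image_iff)
  then obtain \<psi> where \<psi>: "group_hom F U.ext \<psi>" and \<psi>_over: "\<And>x. x \<in> carrier F \<Longrightarrow> snd (\<psi> x) = \<pi> x"
    using free_group_projective[OF assms group_hom_axioms snd.group_hom_axioms] by blast
  interpret \<psi>: group_hom F U.ext \<psi> by (rule \<psi>)
  have "FN \<subseteq> kernel F U.ext \<psi>"
  proof (rule G.commutator_subgroup_le[OF \<psi>.subgroup_kernel])
    fix a m assume a: "a \<in> carrier F" and m: "m \<in> N"
    then have mF: "m \<in> carrier F" by (simp add: kernel_def)
    have "\<psi> m \<in> kernel U.ext G snd" using m \<psi>_over \<psi>.hom_closed[OF mF] by (simp add: kernel_def)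
    then have "\<psi> m \<otimes>\<^bsub>U.ext\<^esub> \<psi> a = \<psi> a \<otimes>\<^bsub>U.ext\<^esub> \<psi> m"
      using U.central_hom_snd \<psi>.hom_closed[OF a] unfolding central_hom_def by blast
    then have "\<psi> (a \<otimes>\<^bsub>F\<^esub> m) = \<psi> (m \<otimes>\<^bsub>F\<^esub> a)"
      using \<psi>.hom_mult a mF by metis
    then have "\<psi> (a \<otimes>\<^bsub>F\<^esub> m \<otimes>\<^bsub>F\<^esub> inv\<^bsub>F\<^esub> (m \<otimes>\<^bsub>F\<^esub> a)) = \<one>\<^bsub>U.ext\<^esub>"
      using \<psi>.hom_mult \<psi>.hom_inv \<psi>.hom_closed a mF by (metis G.inv_closed G.m_closed snd.G.r_inv)
    moreover have "a \<otimes>\<^bsub>F\<^esub> m \<otimes>\<^bsub>F\<^esub> inv\<^bsub>F\<^esub> (m \<otimes>\<^bsub>F\<^esub> a) = a \<otimes>\<^bsub>F\<^esub> m \<otimes>\<^bsub>F\<^esub> inv\<^bsub>F\<^esub> a \<otimes>\<^bsub>F\<^esub> inv\<^bsub>F\<^esub> m"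
      using a mF by (simp add: G.inv_mult_group G.m_assoc)
    ultimately show "a \<otimes>\<^bsub>F\<^esub> m \<otimes>\<^bsub>F\<^esub> inv\<^bsub>F\<^esub> a \<otimes>\<^bsub>F\<^esub> inv\<^bsub>F\<^esub> m \<in> kernel F U.ext \<psi>"
      using a mF by (simp add: kernel_def)
  qed
  then obtain g where g: "g \<in> hom (F Mod FN) U.ext" "\<And>x. x \<in> carrier F \<Longrightarrow> g (FN #>\<^bsub>F\<^esub> x) = \<psi> x"
    using \<psi>.FactGroup_universal_kernel[OF FN_normal] by metis
  have "snd (g A) = proj A" if "A \<in> carrier (F Mod FN)" for A
    using that g(2) \<psi>_over proj_coset by (auto simp: carrier_FactGroup)
  then have "f \<in> iso (U.ext\<lparr>carrier := multiplier U.ext G snd\<rparr>)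
      ((F Mod FN)\<lparr>carrier := multiplier (F Mod FN) G proj\<rparr>)"
    using multiplier_iso[OF U.central_hom_snd proj_central f g(1)] by blast
  then have "U.ext\<lparr>carrier := multiplier U.ext G snd\<rparr> \<cong> hopf_group F N"
    unfolding hopf_group_eq is_iso_def by blast
  moreover have "H2 G \<cong> U.ext\<lparr>carrier := multiplier U.ext G snd\<rparr>"
    using incl_iso_multiplier unfolding is_iso_def by blast
  ultimately show ?thesis by (rule iso_trans[rotated])
qed

end

section \<open>Ordered products\<close>

lemma ordered_prod_0 [simp]: "ordered_prod G 0 f = \<one>\<^bsub>G\<^esub>"
  by (simp add: ordered_prod_def)

lemma ordered_prod_carrier [simp]: "ordered_prod (G\<lparr>carrier := A\<rparr>) n f = ordered_prod G n f"
  by (simp add: ordered_prod_def)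

lemma ordered_prod_cong:
  "(\<And>i. i < n \<Longrightarrow> f i = g i) \<Longrightarrow> ordered_prod G n f = ordered_prod G n g"
  unfolding ordered_prod_def by (rule foldr_cong) auto

context group
begin

lemma foldr_mult_start:
  assumes "\<And>i. i \<in> set l \<Longrightarrow> f i \<in> carrier G" "y \<in> carrier G"
  shows "foldr (\<lambda>i y. f i \<otimes> y) l \<one> \<in> carrier G"
    and "foldr (\<lambda>i y. f i \<otimes> y) l y = foldr (\<lambda>i y. f i \<otimes> y) l \<one> \<otimes> y"
  using assms by (induction l) (auto simp: m_assoc)

lemma ordered_prod_closed:
  "(\<And>i. i < n \<Longrightarrow> f i \<in> carrier G) \<Longrightarrow> ordered_prod G n f \<in> carrier G"
  unfolding ordered_prod_def by (rule foldr_mult_start(1)) auto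

lemma ordered_prod_Suc:
  assumes "\<And>i. i < Suc n \<Longrightarrow> f i \<in> carrier G"
  shows "ordered_prod G (Suc n) f = ordered_prod G n f \<otimes> f n"
  using assms foldr_mult_start(2)[of "[0..<n]" f "f n"] by (simp add: ordered_prod_def)

text \<open>Multiplying the first factor from the left is the only change of an ordered product that is exact in
a non-commutative group.\<close>

lemma ordered_prod_mult_first:
  assumes "\<And>i. i < n \<Longrightarrow> f i \<in> carrier G" "y \<in> carrier G" "0 < n"
  shows "ordered_prod G n (\<lambda>i. if i = 0 then y \<otimes> f 0 else f i) = y \<otimes> ordered_prod G n f"
  using assms(1,3)
proof (induction n)
  case (Suc n)
  then show ?case
    using assms(2) ordered_prod_closed[of n f] by (cases "n = 0") (simp_all add: ordered_prod_Suc m_assoc, simp add: ordered_prod_def)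
qed simp

lemma ordered_prod_one: "ordered_prod G n (\<lambda>_. \<one>) = \<one>"
  by (induction n) (simp_all add: ordered_prod_Suc)

lemma ordered_prod_first:
  assumes "x \<in> carrier G" "0 < n"
  shows "ordered_prod G n (\<lambda>i. if i = 0 then x else \<one>) = x"
  using ordered_prod_mult_first[of n "\<lambda>_. \<one>" x] assms by (simp add: ordered_prod_one cong: if_cong)

lemma ordered_prod_last:
  assumes "x \<in> carrier G" "j < n"
  shows "ordered_prod G n (\<lambda>i. if i = j then x else \<one>) = x"
  using assms(2)
proof (induction n)
  case (Suc n)
  show ?case
  proof (cases "n = j")
    case True
    then have "ordered_prod G n (\<lambda>i. if i = j then x else \<one>) = ordered_prod G n (\<lambda>_. \<one>)"
      by (intro ordered_prod_cong) simp
    then show ?thesis using True assms(1) by (simp add: ordered_prod_Suc ordered_prod_one)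
  next
    case False
    then show ?thesis using Suc assms(1) by (simp add: ordered_prod_Suc)
  qed
qed simp

end

lemma (in group_hom) hom_ordered_prod:
  assumes "\<And>i. i < n \<Longrightarrow> f i \<in> carrier G"
  shows "h (ordered_prod G n f) = ordered_prod H n (\<lambda>i. h (f i))"
  using assms by (induction n) (simp_all add: G.ordered_prod_Suc H.ordered_prod_Suc G.ordered_prod_closed)

lemma (in comm_group) ordered_prod_distrib:
  assumes "\<And>i. i < n \<Longrightarrow> f i \<in> carrier G" "\<And>i. i < n \<Longrightarrow> g i \<in> carrier G"
  shows "ordered_prod G n (\<lambda>i. f i \<otimes> g i) = ordered_prod G n f \<otimes> ordered_prod G n g"
  using assms
proof (induction n)
  case (Suc n)
  then show ?case
    using ordered_prod_closed[of n f] ordered_prod_closed[of n g] by (simp add: ordered_prod_Suc m_ac)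
qed simp

section \<open>The groups \<open>\<K>(F, n)\<close> and \<open>\<K>~(G, n)\<close>\<close>

lemma group_direct_power: "group G \<Longrightarrow> group (direct_power G n)"
  by simp

lemma direct_power_comm_group:
  assumes "comm_group G" shows "comm_group (direct_power G n)"
proof -
  interpret comm_group G by fact
  show ?thesis
    by (rule group.group_comm_groupI) (auto simp: PiE_iff m_comm intro!: restrict_ext)
qed

lemma K_set_eq:
  assumes "group F"
  shows "K_set F n = {f \<in> carrier (direct_power F n). ordered_prod F n f \<in> derived F (carrier F)}"
proof -
  interpret group F by fact
  have "derived F (carrier F) #>\<^bsub>F\<^esub> ordered_prod F n f = derived F (carrier F) \<longleftrightarrow>
      ordered_prod F n f \<in> derived F (carrier F)" if "f \<in> carrier (direct_power F n)" for f
    using that by (intro coset_eq_iff_mem ordered_prod_closed derived_is_subgroup is_group) auto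
  then show ?thesis by (auto simp: K_set_def kernel_def)
qed

text \<open>Modulo commutators the ordered product is a homomorphism, and \<open>\<K>(F,n)\<close> is its kernel.\<close>

lemma K_set_normal:
  assumes "group F"
  shows "K_set F n \<lhd> direct_power F n"
proof -
  interpret group F by fact
  let ?D = "derived F (carrier F)" and ?P = "direct_power F n"
  interpret A: comm_group "F Mod ?D" by (rule derived_quot_is_comm_group)
  interpret q: group_hom F "F Mod ?D" "\<lambda>x. ?D #>\<^bsub>F\<^esub> x"
    by (rule group_hom_coset[OF derived_self_is_normal])
  have "(\<lambda>f. ?D #>\<^bsub>F\<^esub> ordered_prod F n f) \<in> hom ?P (F Mod ?D)"
  proof (rule homI)
    fix f assume "f \<in> carrier ?P"
    then show "?D #>\<^bsub>F\<^esub> ordered_prod F n f \<in> carrier (F Mod ?D)"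
      by (intro q.hom_closed ordered_prod_closed) auto
  next
    fix f g assume f: "f \<in> carrier ?P" and g: "g \<in> carrier ?P"
    have in_F: "f i \<in> carrier F" "g i \<in> carrier F" if "i < n" for i using f g that by auto
    have "?D #>\<^bsub>F\<^esub> ordered_prod F n (f \<otimes>\<^bsub>?P\<^esub> g)
        = ordered_prod (F Mod ?D) n (\<lambda>i. ?D #>\<^bsub>F\<^esub> (f \<otimes>\<^bsub>?P\<^esub> g) i)"
      using in_F by (intro q.hom_ordered_prod) simp
    also have "\<dots> = ordered_prod (F Mod ?D) n (\<lambda>i. (?D #>\<^bsub>F\<^esub> f i) \<otimes>\<^bsub>F Mod ?D\<^esub> (?D #>\<^bsub>F\<^esub> g i))"
      using in_F q.hom_mult by (intro ordered_prod_cong) simp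
    also have "\<dots> = ordered_prod (F Mod ?D) n (\<lambda>i. ?D #>\<^bsub>F\<^esub> f i)
        \<otimes>\<^bsub>F Mod ?D\<^esub> ordered_prod (F Mod ?D) n (\<lambda>i. ?D #>\<^bsub>F\<^esub> g i)"
      using in_F q.hom_closed by (intro A.ordered_prod_distrib) simp_all
    also have "\<dots> = (?D #>\<^bsub>F\<^esub> ordered_prod F n f) \<otimes>\<^bsub>F Mod ?D\<^esub> (?D #>\<^bsub>F\<^esub> ordered_prod F n g)"
      using in_F by (simp only: q.hom_ordered_prod)
    finally show "?D #>\<^bsub>F\<^esub> ordered_prod F n (f \<otimes>\<^bsub>?P\<^esub> g) =
        (?D #>\<^bsub>F\<^esub> ordered_prod F n f) \<otimes>\<^bsub>F Mod ?D\<^esub> (?D #>\<^bsub>F\<^esub> ordered_prod F n g)" .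
  qed
  then have "group_hom ?P (F Mod ?D) (\<lambda>f. ?D #>\<^bsub>F\<^esub> ordered_prod F n f)"
    by (rule group_homI[OF group_direct_power[OF is_group] A.is_group])
  then show ?thesis
    unfolding K_set_def by (rule group_hom.normal_kernel)
qed

context presentation
begin

definition single :: "nat \<Rightarrow> 'f \<Rightarrow> nat \<Rightarrow> 'f" where
  "single n x = (\<lambda>i\<in>{..<n}. if i = 0 then x else \<one>\<^bsub>F\<^esub>)"

text \<open>The two nontrivial entries cancel in the ordered product, so these tuples belong to \<open>\<K>(F,n)\<close>, and to
\<open>\<K>(N,n)\<close> when \<open>x \<in> N\<close>.\<close>

definition opposite_pair :: "nat \<Rightarrow> nat \<Rightarrow> 'f \<Rightarrow> nat \<Rightarrow> 'f" where
  "opposite_pair n j x = (\<lambda>i\<in>{..<n}. if i = 0 then x else if i = j then inv\<^bsub>F\<^esub> x else \<one>\<^bsub>F\<^esub>)"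

lemma single_hom: "group_hom F (direct_power F n) (single n)"
  by (rule group_homI) (auto simp: hom_def single_def intro!: restrict_ext)

lemma ordered_prod_single:
  assumes "x \<in> carrier F" "0 < n" shows "ordered_prod F n (single n x) = x"
proof -
  have "ordered_prod F n (single n x) = ordered_prod F n (\<lambda>i. if i = 0 then x else \<one>\<^bsub>F\<^esub>)"
    by (rule ordered_prod_cong) (simp add: single_def)
  then show ?thesis using G.ordered_prod_first assms by simp
qed

lemma ordered_prod_opposite_pair:
  assumes "x \<in> carrier F" "0 < j" "j < n" shows "ordered_prod F n (opposite_pair n j x) = \<one>\<^bsub>F\<^esub>"
proof -
  let ?f = "\<lambda>i. if i = j then inv\<^bsub>F\<^esub> x else \<one>\<^bsub>F\<^esub>"
  have "ordered_prod F n (opposite_pair n j x)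
      = ordered_prod F n (\<lambda>i. if i = 0 then x \<otimes>\<^bsub>F\<^esub> ?f 0 else ?f i)"
    using assms by (intro ordered_prod_cong) (simp add: opposite_pair_def)
  also have "\<dots> = x \<otimes>\<^bsub>F\<^esub> ordered_prod F n ?f"
    using assms by (intro G.ordered_prod_mult_first) auto
  also have "\<dots> = \<one>\<^bsub>F\<^esub>" using assms G.ordered_prod_last[of "inv\<^bsub>F\<^esub> x" j n] by simp
  finally show ?thesis .
qed

text \<open>The cosets of elements of \<open>N\<close> modulo \<open>[F,N]\<close> lie in a central, hence commutative, subgroup, where the
order of the factors is irrelevant.\<close>

lemma ordered_prod_mod_FN:
  assumes f: "f \<in> {..<n} \<rightarrow>\<^sub>E N" and g: "g \<in> {..<n} \<rightarrow>\<^sub>E N"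
  shows "FN #>\<^bsub>F\<^esub> ordered_prod F n (f \<otimes>\<^bsub>direct_power F n\<^esub> g) =
    (FN #>\<^bsub>F\<^esub> ordered_prod F n f) \<otimes>\<^bsub>F Mod FN\<^esub> (FN #>\<^bsub>F\<^esub> ordered_prod F n g)"
proof -
  let ?P = "direct_power F n" and ?Q = "F Mod FN"
  interpret q: group_hom F ?Q "\<lambda>x. FN #>\<^bsub>F\<^esub> x" by (rule group_hom_coset[OF FN_normal])
  interpret proj: group_hom ?Q G proj by (rule proj_hom)
  define Z where "Z = ?Q\<lparr>carrier := kernel ?Q G proj\<rparr>"
  have Z: "comm_group Z"
  proof (rule group.group_comm_groupI)
    show "group Z" unfolding Z_def using proj.subgroup_kernel q.H.subgroup_imp_group by blast
    fix x y assume "x \<in> carrier Z" "y \<in> carrier Z"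
    then show "x \<otimes>\<^bsub>Z\<^esub> y = y \<otimes>\<^bsub>Z\<^esub> x"
      using proj_central unfolding central_hom_def Z_def by (simp add: kernel_def)
  qed
  have in_N: "f i \<in> N" "g i \<in> N" if "i < n" for i using f g that by auto
  then have in_F: "f i \<in> carrier F" "g i \<in> carrier F" if "i < n" for i using that by (auto simp: kernel_def)
  have in_Z: "FN #>\<^bsub>F\<^esub> x \<in> carrier Z" if "x \<in> N" for x using that by (simp add: Z_def proj_kernel)
  have "FN #>\<^bsub>F\<^esub> ordered_prod F n (f \<otimes>\<^bsub>?P\<^esub> g)
      = ordered_prod ?Q n (\<lambda>i. FN #>\<^bsub>F\<^esub> (f \<otimes>\<^bsub>?P\<^esub> g) i)"
    using in_F by (intro q.hom_ordered_prod) simp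
  also have "\<dots> = ordered_prod Z n (\<lambda>i. (FN #>\<^bsub>F\<^esub> f i) \<otimes>\<^bsub>Z\<^esub> (FN #>\<^bsub>F\<^esub> g i))"
    unfolding Z_def ordered_prod_carrier
    using in_F q.hom_mult by (intro ordered_prod_cong) simp
  also have "\<dots> = ordered_prod Z n (\<lambda>i. FN #>\<^bsub>F\<^esub> f i) \<otimes>\<^bsub>Z\<^esub> ordered_prod Z n (\<lambda>i. FN #>\<^bsub>F\<^esub> g i)"
    using in_N in_Z by (intro comm_group.ordered_prod_distrib[OF Z]) blast+
  also have "\<dots> = (FN #>\<^bsub>F\<^esub> ordered_prod F n f) \<otimes>\<^bsub>?Q\<^esub> (FN #>\<^bsub>F\<^esub> ordered_prod F n g)"
    unfolding Z_def ordered_prod_carrier using in_F by (simp add: q.hom_ordered_prod)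
  finally show ?thesis .
qed

lemma coset_FN_iff: "x \<in> carrier F \<Longrightarrow> FN #>\<^bsub>F\<^esub> x = \<one>\<^bsub>F Mod FN\<^esub> \<longleftrightarrow> x \<in> FN"
  using coset_eq_iff_mem[OF G.is_group normal_imp_subgroup[OF FN_normal]] by simp

text \<open>The explicit form of the normal closure of \<open>\<K>(N,n)\<close> in \<open>F\<^sup>n\<close>.\<close>

definition rel_set :: "nat \<Rightarrow> (nat \<Rightarrow> 'f) set" where
  "rel_set n = {f \<in> {..<n} \<rightarrow>\<^sub>E N. ordered_prod F n f \<in> FN}"

lemma N_tuple_in_power: "f \<in> {..<n} \<rightarrow>\<^sub>E N \<Longrightarrow> f \<in> carrier (direct_power F n)"
  by (auto simp: kernel_def PiE_iff)

lemma N_tuples_normal: "({..<n} \<rightarrow>\<^sub>E N) \<lhd> direct_power F n"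
proof -
  interpret P: group "direct_power F n" by (simp add: group_direct_power)
  have "subgroup ({..<n} \<rightarrow>\<^sub>E N) (direct_power F n)"
    by (simp add: PiE_subgroup_product_group subgroup_kernel)
  then show ?thesis
  proof (rule P.normal_invI)
    fix x f assume "x \<in> carrier (direct_power F n)" "f \<in> {..<n} \<rightarrow>\<^sub>E N"
    then show "x \<otimes>\<^bsub>direct_power F n\<^esub> f \<otimes>\<^bsub>direct_power F n\<^esub> inv\<^bsub>direct_power F n\<^esub> x \<in> {..<n} \<rightarrow>\<^sub>E N"
      by (auto simp: PiE_iff kernel_def)
  qed
qed

text \<open>It is the kernel of the product homomorphism \<open>N\<^sup>n \<rightarrow> N/[F,N]\<close>. Conjugation by \<open>F\<close> acts trivially on
\<open>N/[F,N]\<close>, so this kernel is normal in all of \<open>F\<^sup>n\<close>.\<close>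

lemma rel_set_normal: "rel_set n \<lhd> direct_power F n"
proof -
  let ?P = "direct_power F n" and ?Q = "F Mod FN" and ?M = "{..<n} \<rightarrow>\<^sub>E N"
  interpret P: group ?P by (simp add: group_direct_power)
  interpret q: group_hom F ?Q "\<lambda>x. FN #>\<^bsub>F\<^esub> x" by (rule group_hom_coset[OF FN_normal])
  interpret M: normal ?M ?P by (rule N_tuples_normal)
  let ?\<sigma> = "\<lambda>f. FN #>\<^bsub>F\<^esub> ordered_prod F n f"
  have op_F: "ordered_prod F n f \<in> carrier F" if "f \<in> ?M" for f
    using that by (intro G.ordered_prod_closed) (auto simp: kernel_def)
  have rel: "rel_set n = {f \<in> ?M. ?\<sigma> f = \<one>\<^bsub>?Q\<^esub>}"
    unfolding rel_set_def using op_F coset_FN_iff by blast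
  have "group_hom (?P\<lparr>carrier := ?M\<rparr>) ?Q ?\<sigma>"
  proof (rule group_homI[OF P.subgroup_imp_group[OF M.subgroup_axioms] q.H.is_group])
    show "?\<sigma> \<in> hom (?P\<lparr>carrier := ?M\<rparr>) ?Q"
      by (rule homI) (use op_F ordered_prod_mod_FN in simp_all)
  qed
  then have "subgroup (kernel (?P\<lparr>carrier := ?M\<rparr>) ?Q ?\<sigma>) (?P\<lparr>carrier := ?M\<rparr>)"
    by (rule group_hom.subgroup_kernel)
  then have "subgroup (rel_set n) ?P"
    using P.incl_subgroup[OF M.subgroup_axioms] unfolding rel by (simp add: kernel_def)
  then show ?thesis
  proof (rule P.normal_invI)
    fix x f assume x: "x \<in> carrier ?P" and f: "f \<in> rel_set n"
    let ?y = "x \<otimes>\<^bsub>?P\<^esub> f \<otimes>\<^bsub>?P\<^esub> inv\<^bsub>?P\<^esub> x"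
    have fM: "f \<in> ?M" and yM: "?y \<in> ?M" using f x M.inv_op_closed2 by (auto simp: rel_set_def)
    have "FN #>\<^bsub>F\<^esub> ?y i = FN #>\<^bsub>F\<^esub> f i" if "i < n" for i
    proof -
      have xi: "x i \<in> carrier F" and fi: "f i \<in> N" "f i \<in> carrier F"
        using x fM that by (auto simp: kernel_def)
      have "FN #>\<^bsub>F\<^esub> f i \<in> kernel ?Q G proj" using fi by (simp add: proj_kernel)
      then have "(FN #>\<^bsub>F\<^esub> f i) \<otimes>\<^bsub>?Q\<^esub> (FN #>\<^bsub>F\<^esub> x i) = (FN #>\<^bsub>F\<^esub> x i) \<otimes>\<^bsub>?Q\<^esub> (FN #>\<^bsub>F\<^esub> f i)"
        using proj_central q.hom_closed[OF xi] unfolding central_hom_def by blast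
      then have "FN #>\<^bsub>F\<^esub> (x i \<otimes>\<^bsub>F\<^esub> f i) = FN #>\<^bsub>F\<^esub> (f i \<otimes>\<^bsub>F\<^esub> x i)"
        using xi fi q.hom_mult by simp
      then have "FN #>\<^bsub>F\<^esub> (x i \<otimes>\<^bsub>F\<^esub> f i \<otimes>\<^bsub>F\<^esub> inv\<^bsub>F\<^esub> x i) = FN #>\<^bsub>F\<^esub> (f i \<otimes>\<^bsub>F\<^esub> x i \<otimes>\<^bsub>F\<^esub> inv\<^bsub>F\<^esub> x i)"
        using xi fi q.hom_mult by (metis G.inv_closed G.m_closed)
      then show ?thesis using that x xi fi by (simp add: G.m_assoc)
    qed
    then have "?\<sigma> ?y = ?\<sigma> f"
      using fM yM
      by (subst (1 2) q.hom_ordered_prod) (auto simp: kernel_def PiE_iff intro!: ordered_prod_cong)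
    then show "?y \<in> rel_set n" using f yM unfolding rel by simp
  qed
qed

lemma K_set_N_eq: "K_set (F\<lparr>carrier := N\<rparr>) n = {f \<in> {..<n} \<rightarrow>\<^sub>E N. ordered_prod F n f \<in> derived F N}"
proof -
  have "group (F\<lparr>carrier := N\<rparr>)" using G.subgroup_imp_group[OF subgroup_kernel] .
  moreover have "derived (F\<lparr>carrier := N\<rparr>) N = derived F N"
    using G.derived_consistent[OF order_refl subgroup_kernel] by simp
  ultimately show ?thesis using K_set_eq[of "F\<lparr>carrier := N\<rparr>" n] by simp
qed

text \<open>Let \<open>M\<close> be a normal subgroup containing \<open>\<K>(N,n)\<close>. It contains \<open>(m,m\<^sup>-\<^sup>1,1,\<dots>)\<close> and hence the commutator
of \<open>(a,1,\<dots>,1)\<close> with it, which is \<open>([a,m],1,\<dots>,1)\<close>; so \<open>(c,1,\<dots>,1) \<in> M\<close> for all \<open>c \<in> [F,N]\<close>. A tuple over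
\<open>N\<close> with product \<open>c \<in> [F,N]\<close> is \<open>(c,1,\<dots>,1)\<close> times a tuple with product \<open>1\<close>, and the latter lies in
\<open>\<K>(N,n)\<close>.\<close>

lemma K_rel_eq:
  assumes "2 \<le> n"
  shows "K_rel F N n = rel_set n"
proof
  let ?P = "direct_power F n"
  have "derived F N \<subseteq> FN"
    unfolding derived_eq_commutator_subgroup
    using G.commutator_subgroup_le[OF normal_imp_subgroup[OF FN_normal]] G.commutator_mem
    by (meson normal_imp_subgroup normal_kernel subgroup.mem_carrier)
  then have "K_set (F\<lparr>carrier := N\<rparr>) n \<subseteq> rel_set n"
    unfolding K_set_N_eq rel_set_def by blast
  then show "K_rel F N n \<subseteq> rel_set n"
    unfolding K_rel_def normal_closure_def using rel_set_normal by blast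
  have "rel_set n \<subseteq> M" if M: "M \<lhd> ?P" and KM: "K_set (F\<lparr>carrier := N\<rparr>) n \<subseteq> M" for M
  proof
    interpret M: normal M ?P by (rule M)
    interpret s: group_hom F ?P "single n" by (rule single_hom)
    have one_derived: "\<one>\<^bsub>F\<^esub> \<in> derived F N"
      using G.derived_is_subgroup[of N] subgroup.one_closed by (auto simp: kernel_def)
    have "FN \<subseteq> {x \<in> carrier F. single n x \<in> M}"
    proof (rule G.commutator_subgroup_le)
      show "subgroup {x \<in> carrier F. single n x \<in> M} F"
        by (rule s.subgroup_preimage[OF M.subgroup_axioms])
      fix a m assume a: "a \<in> carrier F" and m: "m \<in> N"
      have mF: "m \<in> carrier F" using m by (simp add: kernel_def)
      let ?p = "opposite_pair n 1 m"
      have "?p \<in> K_set (F\<lparr>carrier := N\<rparr>) n"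
        unfolding K_set_N_eq using ordered_prod_opposite_pair[of m 1 n] assms mF one_derived
          subgroup.m_inv_closed[OF subgroup_kernel m] subgroup.one_closed[OF subgroup_kernel] m
        by (auto simp: opposite_pair_def)
      then have pM: "?p \<in> M" using KM by blast
      have "single n a \<otimes>\<^bsub>?P\<^esub> ?p \<otimes>\<^bsub>?P\<^esub> inv\<^bsub>?P\<^esub> single n a \<otimes>\<^bsub>?P\<^esub> inv\<^bsub>?P\<^esub> ?p \<in> M"
        using M.inv_op_closed2[OF s.hom_closed[OF a] pM] pM by blast
      moreover have "single n a \<otimes>\<^bsub>?P\<^esub> ?p \<otimes>\<^bsub>?P\<^esub> inv\<^bsub>?P\<^esub> single n a \<otimes>\<^bsub>?P\<^esub> inv\<^bsub>?P\<^esub> ?p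
          = single n (a \<otimes>\<^bsub>F\<^esub> m \<otimes>\<^bsub>F\<^esub> inv\<^bsub>F\<^esub> a \<otimes>\<^bsub>F\<^esub> inv\<^bsub>F\<^esub> m)"
        using s.hom_closed[OF a] M.mem_carrier[OF pM] a mF
        by (auto simp: single_def opposite_pair_def fun_eq_iff)
      ultimately show "a \<otimes>\<^bsub>F\<^esub> m \<otimes>\<^bsub>F\<^esub> inv\<^bsub>F\<^esub> a \<otimes>\<^bsub>F\<^esub> inv\<^bsub>F\<^esub> m \<in> {x \<in> carrier F. single n x \<in> M}"
        using a mF by simp
    qed
    then have single_M: "single n c \<in> M" if "c \<in> FN" for c using that by blast
    fix f assume "f \<in> rel_set n"
    then have f: "f \<in> {..<n} \<rightarrow>\<^sub>E N" and c: "ordered_prod F n f \<in> FN" by (auto simp: rel_set_def)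
    let ?c = "ordered_prod F n f"
    have cF: "?c \<in> carrier F" and cN: "?c \<in> N" using c FN_le_N by (auto simp: kernel_def)
    have fF: "f i \<in> carrier F" if "i < n" for i using f that by (auto simp: kernel_def)
    let ?g = "single n (inv\<^bsub>F\<^esub> ?c) \<otimes>\<^bsub>?P\<^esub> f"
    have "ordered_prod F n ?g = ordered_prod F n (\<lambda>i. if i = 0 then inv\<^bsub>F\<^esub> ?c \<otimes>\<^bsub>F\<^esub> f 0 else f i)"
      using fF by (intro ordered_prod_cong) (simp add: single_def)
    also have "\<dots> = inv\<^bsub>F\<^esub> ?c \<otimes>\<^bsub>F\<^esub> ?c"
      using fF cF assms by (intro G.ordered_prod_mult_first) auto
    finally have "ordered_prod F n ?g = \<one>\<^bsub>F\<^esub>" using cF by simp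
    moreover have "?g \<in> {..<n} \<rightarrow>\<^sub>E N"
    proof (rule PiE_I)
      fix i assume "i \<in> {..<n}"
      then show "?g i \<in> N" using f cN by (auto simp: single_def PiE_iff kernel_def)
    qed simp
    ultimately have "?g \<in> K_set (F\<lparr>carrier := N\<rparr>) n"
      unfolding K_set_N_eq using one_derived by (simp only: mem_Collect_eq)
    then have "?g \<in> M" using KM by blast
    then have "single n ?c \<otimes>\<^bsub>?P\<^esub> ?g \<in> M" using single_M[OF c] by (rule subgroup.m_closed[OF M.subgroup_axioms, rotated])
    moreover have "single n ?c \<otimes>\<^bsub>?P\<^esub> ?g = f"
    proof
      fix i
      show "(single n ?c \<otimes>\<^bsub>?P\<^esub> ?g) i = f i"
        using f fF[of i] cF by (cases "i < n") (auto simp: single_def G.inv_mult_cancel PiE_iff extensional_def)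
    qed
    ultimately show "f \<in> M" by simp
  qed
  then show "rel_set n \<subseteq> K_rel F N n"
    unfolding K_rel_def normal_closure_def by blast
qed

end

section \<open>Abelian \<open>G\<close>: the central extension \<open>\<K>~(G, n)\<close> of \<open>G\<^sup>n\<^sup>-\<^sup>1\<close>\<close>

locale abelian_presentation = presentation F G \<pi>
  for F :: "('f, 'c) monoid_scheme" and G :: "('a, 'b) monoid_scheme" and \<pi> +
  fixes n :: nat
  assumes comm: "comm_group G" and n_ge_3: "3 \<le> n"
begin

abbreviation P :: "(nat \<Rightarrow> 'f) monoid" where "P \<equiv> direct_power F n"
abbreviation D :: "'f set" where "D \<equiv> derived F (carrier F)"
abbreviation KF :: "(nat \<Rightarrow> 'f) monoid" where "KF \<equiv> P\<lparr>carrier := K_set F n\<rparr>"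
abbreviation R :: "(nat \<Rightarrow> 'f) set" where "R \<equiv> rel_set n"
abbreviation KT :: "(nat \<Rightarrow> 'f) set monoid" where "KT \<equiv> K_tilde F N n"
abbreviation \<kappa> :: "(nat \<Rightarrow> 'f) \<Rightarrow> (nat \<Rightarrow> 'f) set" where "\<kappa> f \<equiv> R #>\<^bsub>P\<^esub> f"

sublocale P: group P by (simp add: group_direct_power)

lemma D_le_N: "D \<subseteq> N"
proof
  fix x assume x: "x \<in> D"
  then have "\<pi> x \<in> derived G (carrier G)" by (rule hom_image_derived_le[OF group_hom_axioms])
  then have "\<pi> x = \<one>\<^bsub>G\<^esub>" using comm_group.derived_eq_singleton[OF comm] by simp
  then show "x \<in> N" using x G.derived_in_carrier[of "carrier F"] by (auto simp: kernel_def)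
qed

lemma D_subgroup: "subgroup D F" by (simp add: G.derived_is_subgroup)

lemma K_mem: "f \<in> K_set F n \<longleftrightarrow> f \<in> carrier P \<and> ordered_prod F n f \<in> D"
  by (simp add: K_set_eq[OF G.is_group])

lemma K_subgroup: "subgroup (K_set F n) P"
  by (rule normal_imp_subgroup[OF K_set_normal[OF G.is_group]])

lemma KF_group: "group KF"
  by (rule P.subgroup_imp_group[OF K_subgroup])

lemma R_le_K: "R \<subseteq> K_set F n"
  using N_tuple_in_power FN_le_derived by (auto simp: K_mem rel_set_def simp del: carrier_product_group)

lemma R_normal: "R \<lhd> KF"
  by (rule P.normal_restrict_supergroup[OF K_subgroup rel_set_normal R_le_K])

lemma K_tilde_eq: "KT = KF Mod R"
  using K_rel_eq n_ge_3 by (simp add: K_tilde_def)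

lemma \<kappa>_hom: "group_hom KF KT \<kappa>"
  using group_hom_coset[OF R_normal] unfolding K_tilde_eq by simp

lemma carrier_KT: "carrier KT = \<kappa> ` K_set F n"
  unfolding K_tilde_eq carrier_FactGroup by simp

lemma one_KT: "\<one>\<^bsub>KT\<^esub> = R"
  unfolding K_tilde_eq by simp

lemma \<kappa>_eq_one_iff: "f \<in> carrier P \<Longrightarrow> \<kappa> f = \<one>\<^bsub>KT\<^esub> \<longleftrightarrow> f \<in> R"
  unfolding one_KT by (rule coset_eq_iff_mem[OF P.is_group normal_imp_subgroup[OF rel_set_normal]])

lemma single_in_P: "x \<in> carrier F \<Longrightarrow> single n x \<in> carrier P"
  using group_hom.hom_closed[OF single_hom] .

lemma single_in_K:
  assumes "x \<in> D" shows "single n x \<in> K_set F n"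
  unfolding K_mem using assms n_ge_3 ordered_prod_single single_in_P subgroup.mem_carrier[OF D_subgroup]
  by (simp del: carrier_product_group)

text \<open>This gives injectivity of \<open>[F,F]/[F,N] \<rightarrow> \<K>~(G,n)\<close>.\<close>

lemma single_in_R_iff:
  assumes "x \<in> carrier F" shows "single n x \<in> R \<longleftrightarrow> x \<in> FN"
proof -
  have "single n x \<in> {..<n} \<rightarrow>\<^sub>E N" if "x \<in> FN"
    using that FN_le_N subgroup.one_closed[OF subgroup_kernel] by (auto simp: single_def)
  then show ?thesis using assms n_ge_3 by (auto simp: rel_set_def ordered_prod_single)
qed

text \<open>The first map of the exact sequence, before dividing \<open>[F,F]\<close> by \<open>[F,N]\<close>.\<close>

definition \<iota> :: "'f \<Rightarrow> (nat \<Rightarrow> 'f) set" where "\<iota> x = \<kappa> (single n x)"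

lemma \<iota>_hom: "group_hom (F\<lparr>carrier := D\<rparr>) KT \<iota>"
proof -
  interpret \<kappa>: group_hom KF KT \<kappa> by (rule \<kappa>_hom)
  have "single n \<in> hom (F\<lparr>carrier := D\<rparr>) KF"
    using single_in_K group_hom.hom_mult[OF single_hom, of _ _ n] subgroup.mem_carrier[OF D_subgroup]
    by (auto simp: hom_def)
  then have "group_hom (F\<lparr>carrier := D\<rparr>) KF (single n)"
    by (rule group_homI[OF G.subgroup_imp_group[OF D_subgroup] KF_group])
  then show ?thesis
    unfolding \<iota>_def[abs_def] using group_hom_comp[OF _ \<kappa>_hom] by (simp add: comp_def)
qed

lemma \<iota>_kernel: "kernel (F\<lparr>carrier := D\<rparr>) KT \<iota> = FN"
proof -
  have "\<iota> x = \<one>\<^bsub>KT\<^esub> \<longleftrightarrow> x \<in> FN" if "x \<in> D" for x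
  proof -
    have "x \<in> carrier F" using that subgroup.mem_carrier[OF D_subgroup] by blast
    then show ?thesis
      unfolding \<iota>_def using \<kappa>_eq_one_iff[OF single_in_P] single_in_R_iff by simp
  qed
  then show ?thesis using FN_le_derived by (auto simp: kernel_def)
qed

text \<open>The second map of the exact sequence, before dividing \<open>\<K>(F,n)\<close> by the relations. The last coordinate
is omitted because it is determined by the others.\<close>

definition \<rho> :: "(nat \<Rightarrow> 'f) \<Rightarrow> nat \<Rightarrow> 'a" where "\<rho> f = (\<lambda>i\<in>{..<n - 1}. \<pi> (f i))"

lemma \<rho>_hom: "group_hom KF (direct_power G (n - 1)) \<rho>"
proof (rule group_homI[OF KF_group group_direct_power[OF H.is_group]], rule homI)
  fix f g assume f: "f \<in> carrier KF" and g: "g \<in> carrier KF"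
  have in_F: "f i \<in> carrier F" "g i \<in> carrier F" if "i < n" for i
    using f g that by (auto simp: K_mem)
  then show "\<rho> f \<in> carrier (direct_power G (n - 1))" by (auto simp: \<rho>_def)
  show "\<rho> (f \<otimes>\<^bsub>KF\<^esub> g) = \<rho> f \<otimes>\<^bsub>direct_power G (n - 1)\<^esub> \<rho> g"
    using in_F by (auto simp: \<rho>_def intro!: restrict_ext)
qed

lemma \<pi>_ordered_prod:
  assumes "f \<in> K_set F n" shows "ordered_prod G n (\<lambda>i. \<pi> (f i)) = \<one>\<^bsub>G\<^esub>"
proof -
  have "\<pi> (ordered_prod F n f) = ordered_prod G n (\<lambda>i. \<pi> (f i))"
    using assms by (intro hom_ordered_prod) (auto simp: K_mem)
  moreover have "\<pi> (ordered_prod F n f) = \<one>\<^bsub>G\<^esub>"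
    using assms D_le_N by (auto simp: K_mem kernel_def)
  ultimately show ?thesis by simp
qed

text \<open>If the first \<open>n - 1\<close> entries of an element of \<open>\<K>(F,n)\<close> lie in \<open>N\<close>, then so does the last one,
because the images in \<open>G\<close> multiply to \<open>1\<close>.\<close>

lemma \<rho>_kernel: "kernel KF (direct_power G (n - 1)) \<rho> = K_set F n \<inter> ({..<n} \<rightarrow>\<^sub>E N)"
proof
  obtain m where m: "n = Suc m" using n_ge_3 by (cases n) auto
  show "kernel KF (direct_power G (n - 1)) \<rho> \<subseteq> K_set F n \<inter> ({..<n} \<rightarrow>\<^sub>E N)"
  proof
    fix f assume "f \<in> kernel KF (direct_power G (n - 1)) \<rho>"
    then have f: "f \<in> K_set F n" and \<rho>f: "\<rho> f = (\<lambda>i\<in>{..<n - 1}. \<one>\<^bsub>G\<^esub>)" by (auto simp: kernel_def)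
    have fF: "f i \<in> carrier F" if "i < n" for i using f that by (auto simp: K_mem)
    have one: "\<pi> (f i) = \<one>\<^bsub>G\<^esub>" if "i < m" for i
      using fun_cong[OF \<rho>f, of i] that m unfolding \<rho>_def by simp
    have "\<one>\<^bsub>G\<^esub> = ordered_prod G m (\<lambda>i. \<pi> (f i)) \<otimes>\<^bsub>G\<^esub> \<pi> (f m)"
      using \<pi>_ordered_prod[OF f] fF m by (simp add: H.ordered_prod_Suc)
    also have "ordered_prod G m (\<lambda>i. \<pi> (f i)) = ordered_prod G m (\<lambda>_. \<one>\<^bsub>G\<^esub>)"
      using one by (intro ordered_prod_cong)
    finally have "\<pi> (f m) = \<one>\<^bsub>G\<^esub>" using fF m by (simp add: H.ordered_prod_one)
    then have "f i \<in> N" if "i < n" for i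
      using that one fF m by (cases "i = m") (auto simp: kernel_def)
    moreover have "f \<in> carrier P" using f by (simp only: K_mem)
    ultimately have "f \<in> {..<n} \<rightarrow>\<^sub>E N" by (auto simp: PiE_iff)
    then show "f \<in> K_set F n \<inter> ({..<n} \<rightarrow>\<^sub>E N)" using f by blast
  qed
  show "K_set F n \<inter> ({..<n} \<rightarrow>\<^sub>E N) \<subseteq> kernel KF (direct_power G (n - 1)) \<rho>"
  proof
    fix f assume "f \<in> K_set F n \<inter> ({..<n} \<rightarrow>\<^sub>E N)"
    then have f: "f \<in> K_set F n" and fN: "\<And>i. i < n \<Longrightarrow> f i \<in> N" by auto
    have "\<rho> f = (\<lambda>i\<in>{..<n - 1}. \<one>\<^bsub>G\<^esub>)"
      unfolding \<rho>_def by (rule restrict_ext) (use fN in \<open>simp add: kernel_def\<close>)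
    then show "f \<in> kernel KF (direct_power G (n - 1)) \<rho>" using f by (simp add: kernel_def)
  qed
qed

text \<open>Lift the given coordinates arbitrarily and take the inverse of the product of the lifts as the last
entry.\<close>

lemma \<rho>_surj: "\<rho> ` K_set F n = carrier (direct_power G (n - 1))"
proof
  show "\<rho> ` K_set F n \<subseteq> carrier (direct_power G (n - 1))"
    using group_hom.hom_closed[OF \<rho>_hom] by (auto simp del: carrier_product_group)
  obtain m where m: "n = Suc m" using n_ge_3 by (cases n) auto
  show "carrier (direct_power G (n - 1)) \<subseteq> \<rho> ` K_set F n"
  proof
    fix g assume g: "g \<in> carrier (direct_power G (n - 1))"
    have "\<forall>x\<in>carrier G. \<exists>y. y \<in> carrier F \<and> \<pi> y = x" using surj by (metis imageE)
    then obtain s where s: "\<And>x. x \<in> carrier G \<Longrightarrow> s x \<in> carrier F \<and> \<pi> (s x) = x" by metis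
    define c where "c = ordered_prod F m (\<lambda>i. s (g i))"
    define f where "f = (\<lambda>i\<in>{..<n}. if i = m then inv\<^bsub>F\<^esub> c else s (g i))"
    have gG: "g i \<in> carrier G" if "i < m" for i using g that m by auto
    then have cF: "c \<in> carrier F" unfolding c_def using s by (intro G.ordered_prod_closed) blast
    have "f i \<in> carrier F" if "i < n" for i
      using that gG s cF m by (auto simp: f_def)
    then have fP: "f \<in> carrier P" by (auto simp: f_def)
    have "ordered_prod F m f = c"
      unfolding c_def using m by (intro ordered_prod_cong) (simp add: f_def)
    moreover have "ordered_prod F (Suc m) f = ordered_prod F m f \<otimes>\<^bsub>F\<^esub> f m"
      using fP m by (intro G.ordered_prod_Suc) auto
    moreover have "f m = inv\<^bsub>F\<^esub> c" using m by (simp add: f_def)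
    ultimately have "ordered_prod F n f = \<one>\<^bsub>F\<^esub>" using cF m by simp
    then have "f \<in> K_set F n" using fP subgroup.one_closed[OF D_subgroup] by (simp add: K_mem)
    moreover have "\<rho> f = g"
    proof
      fix i show "\<rho> f i = g i"
        using g gG[of i] s m unfolding \<rho>_def f_def
        by (cases "i < m") (auto simp: PiE_iff extensional_def)
    qed
    ultimately show "g \<in> \<rho> ` K_set F n" by (metis imageI)
  qed
qed

lemma R_le_kernel: "R \<subseteq> kernel KF (direct_power G (n - 1)) \<rho>"
  unfolding \<rho>_kernel by (rule Int_greatest[OF R_le_K]) (unfold rel_set_def, blast)

text \<open>The quotient of the two tuples is a tuple over \<open>N\<close> whose product is trivial modulo \<open>[F,N]\<close>.\<close>

lemma \<kappa>_N_tuple: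
  assumes "f \<in> K_set F n" "f \<in> {..<n} \<rightarrow>\<^sub>E N"
  shows "\<kappa> f = \<iota> (ordered_prod F n f)"
proof -
  let ?c = "ordered_prod F n f"
  interpret q: group_hom F "F Mod FN" "\<lambda>x. FN #>\<^bsub>F\<^esub> x" by (rule group_hom_coset[OF FN_normal])
  have c: "?c \<in> D" using assms(1) by (simp add: K_mem)
  then have cF: "?c \<in> carrier F" using subgroup.mem_carrier[OF D_subgroup] by blast
  have icD: "inv\<^bsub>F\<^esub> ?c \<in> D" using c subgroup.m_inv_closed[OF D_subgroup] by blast
  have sN: "single n (inv\<^bsub>F\<^esub> ?c) \<in> {..<n} \<rightarrow>\<^sub>E N"
    using icD D_le_N subgroup.one_closed[OF subgroup_kernel] by (auto simp: single_def)
  let ?g = "f \<otimes>\<^bsub>P\<^esub> single n (inv\<^bsub>F\<^esub> ?c)"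
  have gN: "?g \<in> {..<n} \<rightarrow>\<^sub>E N"
    using subgroup.m_closed[OF normal_imp_subgroup[OF N_tuples_normal] assms(2) sN] .
  have "FN #>\<^bsub>F\<^esub> ordered_prod F n ?g = (FN #>\<^bsub>F\<^esub> ?c) \<otimes>\<^bsub>F Mod FN\<^esub> (FN #>\<^bsub>F\<^esub> (inv\<^bsub>F\<^esub> ?c))"
    using ordered_prod_mod_FN[OF assms(2) sN] cF n_ge_3 by (simp add: ordered_prod_single)
  also have "\<dots> = \<one>\<^bsub>F Mod FN\<^esub>"
    using q.hom_mult[OF cF G.inv_closed[OF cF]] q.hom_one cF by simp
  finally have "ordered_prod F n ?g \<in> FN"
    using coset_FN_iff[of "ordered_prod F n ?g"] G.ordered_prod_closed[of n ?g] gN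
    by (auto simp: kernel_def simp del: mult_product_group)
  then have "?g \<in> R" using gN by (simp add: rel_set_def)
  moreover have fP: "f \<in> carrier P" using assms(1) by (simp only: K_mem)
  moreover have sP: "single n ?c \<in> carrier P" using single_in_P[OF cF] .
  moreover have "single n (inv\<^bsub>F\<^esub> ?c) = inv\<^bsub>P\<^esub> single n ?c"
    using group_hom.hom_inv[OF single_hom cF] .
  ultimately show ?thesis
    unfolding \<iota>_def
    by (metis P.coset_mult_inv1 P.coset_join2 P.m_closed P.inv_closed P.coset_mult_inv2
        normal_imp_subgroup rel_set_normal subgroup.subset)
qed

lemma \<kappa>_kernel_\<rho>: "\<kappa> ` kernel KF (direct_power G (n - 1)) \<rho> = \<iota> ` D"
proof
  show "\<kappa> ` kernel KF (direct_power G (n - 1)) \<rho> \<subseteq> \<iota> ` D"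
  proof
    fix A assume "A \<in> \<kappa> ` kernel KF (direct_power G (n - 1)) \<rho>"
    then obtain f where f: "f \<in> K_set F n" "f \<in> {..<n} \<rightarrow>\<^sub>E N" and A: "A = \<kappa> f"
      unfolding \<rho>_kernel by blast
    have "ordered_prod F n f \<in> D" using f(1) by (simp only: K_mem)
    then show "A \<in> \<iota> ` D" unfolding A \<kappa>_N_tuple[OF f] by (rule imageI)
  qed
  have "single n x \<in> {..<n} \<rightarrow>\<^sub>E N" if "x \<in> D" for x
    using that D_le_N subgroup.one_closed[OF subgroup_kernel] by (auto simp: single_def)
  then show "\<iota> ` D \<subseteq> \<kappa> ` kernel KF (direct_power G (n - 1)) \<rho>"
    unfolding \<rho>_kernel \<iota>_def using single_in_K by blast
qed

text \<open>Since \<open>x \<in> [F,F] \<le> N\<close>, commuting \<open>(x,1,\<dots>,1)\<close> past a tuple \<open>f\<close> costs \<open>([f\<^sub>0,x],1,\<dots>,1)\<close> with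
\<open>[f\<^sub>0,x] \<in> [F,N]\<close>.\<close>

lemma \<iota>_central:
  assumes x: "x \<in> D" and A: "A \<in> carrier KT"
  shows "\<iota> x \<otimes>\<^bsub>KT\<^esub> A = A \<otimes>\<^bsub>KT\<^esub> \<iota> x"
proof -
  interpret \<kappa>: group_hom KF KT \<kappa> by (rule \<kappa>_hom)
  obtain f where f: "f \<in> K_set F n" and A_eq: "A = \<kappa> f" using A by (auto simp: carrier_KT)
  have fP: "f \<in> carrier P" using f by (simp only: K_mem)
  then have fF: "f i \<in> carrier F" if "i < n" for i using that by auto
  have xF: "x \<in> carrier F" using x subgroup.mem_carrier[OF D_subgroup] by blast
  let ?k = "f 0 \<otimes>\<^bsub>F\<^esub> x \<otimes>\<^bsub>F\<^esub> inv\<^bsub>F\<^esub> f 0 \<otimes>\<^bsub>F\<^esub> inv\<^bsub>F\<^esub> x"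
  have f0: "f 0 \<in> carrier F" using fF n_ge_3 by simp
  have k: "?k \<in> FN" using x D_le_N f0 by (intro G.commutator_mem) auto
  then have kD: "?k \<in> D" using FN_le_derived by blast
  have kF: "?k \<in> carrier F" using xF f0 by simp
  have "f \<otimes>\<^bsub>P\<^esub> single n x = single n ?k \<otimes>\<^bsub>P\<^esub> (single n x \<otimes>\<^bsub>P\<^esub> f)"
    using fF f0 xF by (auto simp: single_def fun_eq_iff G.m_assoc G.inv_mult_cancel)
  then have "\<kappa> (f \<otimes>\<^bsub>P\<^esub> single n x) = \<kappa> (single n ?k \<otimes>\<^bsub>P\<^esub> (single n x \<otimes>\<^bsub>P\<^esub> f))"
    by (rule arg_cong)
  moreover have sx: "single n x \<in> K_set F n" and sk: "single n ?k \<in> K_set F n"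
    using single_in_K x kD by blast+
  moreover have "\<kappa> (single n ?k) = \<one>\<^bsub>KT\<^esub>"
    using \<kappa>_eq_one_iff[OF single_in_P[OF kF]] single_in_R_iff[OF kF] k by blast
  ultimately have "\<kappa> f \<otimes>\<^bsub>KT\<^esub> \<kappa> (single n x) = \<kappa> (single n x) \<otimes>\<^bsub>KT\<^esub> \<kappa> f"
    using \<kappa>.hom_mult[of f "single n x"] \<kappa>.hom_mult[of "single n x" f]
      \<kappa>.hom_mult[of "single n ?k" "single n x \<otimes>\<^bsub>P\<^esub> f"] f
      \<kappa>.hom_closed[of "single n x"] \<kappa>.hom_closed[of f] subgroup.m_closed[OF K_subgroup sx f]
    by (simp del: mult_product_group)
  then show ?thesis unfolding \<iota>_def A_eq by simp
qed

text \<open>This is where \<open>n \<ge> 3\<close> is used: the supports of the two tuples of \<open>\<K>(F,n)\<close> meet only in the first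
coordinate.\<close>

lemma single_commutator:
  assumes "a \<in> carrier F" "b \<in> carrier F"
  defines "x \<equiv> opposite_pair n 1 a" and "y \<equiv> opposite_pair n 2 b"
  shows "single n (a \<otimes>\<^bsub>F\<^esub> b \<otimes>\<^bsub>F\<^esub> inv\<^bsub>F\<^esub> a \<otimes>\<^bsub>F\<^esub> inv\<^bsub>F\<^esub> b) = x \<otimes>\<^bsub>P\<^esub> y \<otimes>\<^bsub>P\<^esub> inv\<^bsub>P\<^esub> x \<otimes>\<^bsub>P\<^esub> inv\<^bsub>P\<^esub> y"
    and "x \<in> K_set F n" "y \<in> K_set F n"
proof -
  have in_P: "x \<in> carrier P" "y \<in> carrier P"
    using assms(1,2) by (auto simp: x_def y_def opposite_pair_def)
  then show "x \<in> K_set F n" "y \<in> K_set F n"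
    using ordered_prod_opposite_pair[OF assms(1), of 1 n] ordered_prod_opposite_pair[OF assms(2), of 2 n]
      n_ge_3 subgroup.one_closed[OF D_subgroup]
    by (simp_all add: K_mem x_def y_def del: carrier_product_group)
  show "single n (a \<otimes>\<^bsub>F\<^esub> b \<otimes>\<^bsub>F\<^esub> inv\<^bsub>F\<^esub> a \<otimes>\<^bsub>F\<^esub> inv\<^bsub>F\<^esub> b) = x \<otimes>\<^bsub>P\<^esub> y \<otimes>\<^bsub>P\<^esub> inv\<^bsub>P\<^esub> x \<otimes>\<^bsub>P\<^esub> inv\<^bsub>P\<^esub> y"
    using in_P assms(1,2)
    by (auto simp: fun_eq_iff single_def x_def y_def opposite_pair_def)
qed

lemma kernel_induced: "kernel KT (direct_power G (n - 1)) (\<lambda>A. the_elem (\<rho> ` A)) = \<iota> ` D"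
  and induced_hom: "group_hom KT (direct_power G (n - 1)) (\<lambda>A. the_elem (\<rho> ` A))"
  and induced_surj: "(\<lambda>A. the_elem (\<rho> ` A)) ` carrier KT = carrier (direct_power G (n - 1))"
  using hom_FactGroup_induced[OF \<rho>_hom R_normal R_le_kernel] \<kappa>_kernel_\<rho> \<rho>_surj
  unfolding K_tilde_eq by simp_all

text \<open>One inclusion holds because \<open>G\<^sup>n\<^sup>-\<^sup>1\<close> is Abelian; the other one reduces to the generators \<open>[a,b]\<close> of
\<open>[F,F]\<close>, whose images are commutators of elements of \<open>\<K>(F,n)\<close>.\<close>

lemma derived_KT: "derived KT (carrier KT) = \<iota> ` D"
proof
  interpret \<kappa>: group_hom KF KT \<kappa> by (rule \<kappa>_hom)
  interpret \<iota>: group_hom "F\<lparr>carrier := D\<rparr>" KT \<iota> by (rule \<iota>_hom)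
  interpret A: comm_group "direct_power G (n - 1)" by (rule direct_power_comm_group[OF comm])
  show "derived KT (carrier KT) \<subseteq> \<iota> ` D"
  proof
    fix A assume A: "A \<in> derived KT (carrier KT)"
    then have "the_elem (\<rho> ` A) \<in> derived (direct_power G (n - 1)) (carrier (direct_power G (n - 1)))"
      by (rule hom_image_derived_le[OF induced_hom])
    then have "the_elem (\<rho> ` A) = \<one>\<^bsub>direct_power G (n - 1)\<^esub>"
      using A.derived_eq_singleton[OF order_refl] by blast
    moreover have "A \<in> carrier KT" using A \<kappa>.H.derived_in_carrier[OF order_refl] by blast
    ultimately show "A \<in> \<iota> ` D" unfolding kernel_induced[symmetric] by (simp add: kernel_def)
  qed
  have D_KT: "subgroup (derived KT (carrier KT)) KT" by (simp add: \<kappa>.H.derived_is_subgroup)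
  have "D \<subseteq> {x \<in> D. \<iota> x \<in> derived KT (carrier KT)}"
  proof (subst derived_eq_commutator_subgroup, rule G.commutator_subgroup_le)
    have "subgroup {x \<in> D. \<iota> x \<in> derived KT (carrier KT)} (F\<lparr>carrier := D\<rparr>)"
      using \<iota>.subgroup_preimage[OF D_KT] by simp
    then show "subgroup {x \<in> D. \<iota> x \<in> derived KT (carrier KT)} F"
      using G.incl_subgroup[OF D_subgroup] by blast
    fix a b assume ab: "a \<in> carrier F" "b \<in> carrier F"
    let ?x = "opposite_pair n 1 a" and ?y = "opposite_pair n 2 b"
    let ?k = "a \<otimes>\<^bsub>F\<^esub> b \<otimes>\<^bsub>F\<^esub> inv\<^bsub>F\<^esub> a \<otimes>\<^bsub>F\<^esub> inv\<^bsub>F\<^esub> b"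
    note comm = single_commutator[OF ab]
    have inv_KF: "inv\<^bsub>P\<^esub> z = inv\<^bsub>KF\<^esub> z" if "z \<in> K_set F n" for z
      using P.m_inv_consistent[OF K_subgroup that] by simp
    have mult_KF: "monoid.mult KF = monoid.mult P" by simp
    have xy: "?x \<in> carrier KF" "?y \<in> carrier KF" using comm(2,3) by simp_all
    have "single n ?k = ?x \<otimes>\<^bsub>KF\<^esub> ?y \<otimes>\<^bsub>KF\<^esub> inv\<^bsub>KF\<^esub> ?x \<otimes>\<^bsub>KF\<^esub> inv\<^bsub>KF\<^esub> ?y"
      unfolding comm(1) inv_KF[OF comm(2)] inv_KF[OF comm(3)] mult_KF by (rule refl)
    then have "\<iota> ?k = \<kappa> ?x \<otimes>\<^bsub>KT\<^esub> \<kappa> ?y \<otimes>\<^bsub>KT\<^esub> inv\<^bsub>KT\<^esub> \<kappa> ?x \<otimes>\<^bsub>KT\<^esub> inv\<^bsub>KT\<^esub> \<kappa> ?y"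
      unfolding \<iota>_def by (simp only: \<kappa>.hom_commutator[OF xy])
    moreover have "\<kappa> ?x \<in> carrier KT" "\<kappa> ?y \<in> carrier KT"
      using comm(2,3) by (auto simp: carrier_KT)
    ultimately have "\<iota> ?k \<in> derived KT (carrier KT)"
      using \<kappa>.H.commutator_mem unfolding derived_eq_commutator_subgroup by metis
    moreover have "?k \<in> D"
      using ab G.commutator_mem unfolding derived_eq_commutator_subgroup by blast
    ultimately show "?k \<in> {x \<in> D. \<iota> x \<in> derived KT (carrier KT)}" by blast
  qed
  then show "\<iota> ` D \<subseteq> derived KT (carrier KT)" by blast
qed

lemma hopf_to_K_tilde_hom: "group_hom (hopf_group F N) KT (hopf_to_K_tilde F N n)"
  and hopf_to_K_tilde_inj: "inj_on (hopf_to_K_tilde F N n) (carrier (hopf_group F N))"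
  and hopf_to_K_tilde_image: "hopf_to_K_tilde F N n ` carrier (hopf_group F N) = \<iota> ` D"
proof -
  interpret \<iota>: group_hom "F\<lparr>carrier := D\<rparr>" KT \<iota> by (rule \<iota>_hom)
  have "N \<inter> D = D" using D_le_N by blast
  then have hopf: "hopf_group F N = F\<lparr>carrier := D\<rparr> Mod kernel (F\<lparr>carrier := D\<rparr>) KT \<iota>"
    unfolding hopf_group_def \<iota>_kernel by simp
  have map: "hopf_to_K_tilde F N n = (\<lambda>A. the_elem (\<iota> ` A))"
    using K_rel_eq n_ge_3 by (simp add: hopf_to_K_tilde_def[abs_def] \<iota>_def[abs_def] single_def[abs_def])
  show "inj_on (hopf_to_K_tilde F N n) (carrier (hopf_group F N))"
    unfolding hopf map by (rule \<iota>.FactGroup_inj_on)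
  show "group_hom (hopf_group F N) KT (hopf_to_K_tilde F N n)"
    and "hopf_to_K_tilde F N n ` carrier (hopf_group F N) = \<iota> ` D"
    unfolding hopf map
    using hom_FactGroup_induced[OF \<iota>.group_hom_axioms \<iota>.normal_kernel order_refl] by simp_all
qed

end

section \<open>Frattini subgroups\<close>

lemma frattini_mem: "x \<in> frattini G \<longleftrightarrow> x \<in> carrier G \<and> (\<forall>M. maximal_subgroup M G \<longrightarrow> x \<in> M)"
  by (auto simp: frattini_def)

lemma frattini_subgroup:
  assumes "group G" shows "subgroup (frattini G) G"
proof -
  interpret group G by fact
  have sub: "subgroup M G" if "maximal_subgroup M G" for M
    using that by (simp add: maximal_subgroup_def)
  show ?thesis
  proof (rule subgroupI)
    have "\<one>\<^bsub>G\<^esub> \<in> frattini G" using sub subgroup.one_closed by (auto simp: frattini_mem)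
    then show "frattini G \<noteq> {}" by blast
  qed (use subgroup.m_closed[OF sub] subgroup.m_inv_closed[OF sub] in \<open>auto simp: frattini_mem\<close>)
qed

locale surjective_hom = group_hom +
  assumes surj: "h ` carrier G = carrier H"
begin

lemma mem_of_image_mem:
  assumes "subgroup L G" "kernel G H h \<subseteq> L" "x \<in> carrier G" "h x \<in> h ` L"
  shows "x \<in> L"
proof -
  obtain l where l: "l \<in> L" "h x = h l" using assms(4) by blast
  have lG: "l \<in> carrier G" using l subgroup.mem_carrier[OF assms(1)] by blast
  then have "x \<otimes>\<^bsub>G\<^esub> inv\<^bsub>G\<^esub> l \<in> L" using l assms(2,3) by (auto simp: kernel_def)
  then have "x \<otimes>\<^bsub>G\<^esub> inv\<^bsub>G\<^esub> l \<otimes>\<^bsub>G\<^esub> l \<in> L" using l subgroup.m_closed[OF assms(1)] by blast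
  then show ?thesis using lG assms(3) by (simp add: G.m_assoc)
qed

text \<open>Together with \<open>maximal_subgroup_image\<close> this is the correspondence between the maximal subgroups of
\<open>H\<close> and those of \<open>G\<close> that contain the kernel.\<close>

lemma maximal_subgroup_preimage:
  assumes "maximal_subgroup M H"
  shows "maximal_subgroup {x \<in> carrier G. h x \<in> M} G"
  unfolding maximal_subgroup_def
proof (intro conjI allI impI)
  have M: "subgroup M H" "M \<noteq> carrier H" using assms by (auto simp: maximal_subgroup_def)
  then show "subgroup {x \<in> carrier G. h x \<in> M} G" by (intro subgroup_preimage)
  have "M \<subseteq> carrier H" using M(1) subgroup.subset by blast
  then obtain y where "y \<in> carrier H" "y \<notin> M" using M(2) by blast
  moreover from this obtain x where "x \<in> carrier G" "h x = y" using surj by (metis imageE)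
  ultimately show "{x \<in> carrier G. h x \<in> M} \<noteq> carrier G" by blast
  fix L assume L: "subgroup L G" and sub: "{x \<in> carrier G. h x \<in> M} \<subseteq> L"
  have LG: "L \<subseteq> carrier G" using L subgroup.subset by blast
  have ker: "kernel G H h \<subseteq> L" using sub subgroup.one_closed[OF M(1)] by (auto simp: kernel_def)
  have "M \<subseteq> h ` L"
  proof
    fix y assume y: "y \<in> M"
    then obtain x where "x \<in> carrier G" "y = h x" using surj \<open>M \<subseteq> carrier H\<close> by blast
    then show "y \<in> h ` L" using y sub by blast
  qed
  then consider "h ` L = M" | "h ` L = carrier H"
    using assms subgroup_img_is_subgroup[OF L] by (auto simp: maximal_subgroup_def)
  then show "L = {x \<in> carrier G. h x \<in> M} \<or> L = carrier G"
  proof cases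
    case 1
    then show ?thesis using sub LG by blast
  next
    case 2
    then have "carrier G \<subseteq> L" using mem_of_image_mem[OF L ker] by auto
    then show ?thesis using LG by blast
  qed
qed

lemma maximal_subgroup_image:
  assumes M: "maximal_subgroup M G" and ker: "kernel G H h \<subseteq> M"
  shows "maximal_subgroup (h ` M) H"
  unfolding maximal_subgroup_def
proof (intro conjI allI impI)
  have sub: "subgroup M G" using M by (simp add: maximal_subgroup_def)
  then have MG: "M \<subseteq> carrier G" using subgroup.subset by blast
  show "subgroup (h ` M) H" using sub by (rule subgroup_img_is_subgroup)
  show "h ` M \<noteq> carrier H"
  proof
    assume "h ` M = carrier H"
    then have "carrier G \<subseteq> M" using mem_of_image_mem[OF sub ker] by auto
    then show False using M MG by (auto simp: maximal_subgroup_def)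
  qed
  fix L assume L: "subgroup L H" and img_le: "h ` M \<subseteq> L"
  let ?L = "{x \<in> carrier G. h x \<in> L}"
  have hL: "h ` ?L = L"
  proof
    show "L \<subseteq> h ` ?L"
    proof
      fix y assume "y \<in> L"
      then obtain x where "x \<in> carrier G" "y = h x" using surj subgroup.mem_carrier[OF L] by blast
      then show "y \<in> h ` ?L" using \<open>y \<in> L\<close> by blast
    qed
  qed blast
  have "M \<subseteq> ?L" using img_le MG by blast
  then have "?L = M \<or> ?L = carrier G"
    using M subgroup_preimage[OF L] by (simp add: maximal_subgroup_def)
  then show "L = h ` M \<or> L = carrier H" using hL surj by metis
qed

text \<open>When the kernel lies in the Frattini subgroup, it lies in every maximal subgroup, so the correspondence
reaches all of them.\<close>

lemma frattini_eq_preimage: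
  assumes "kernel G H h \<subseteq> frattini G"
  shows "frattini G = {x \<in> carrier G. h x \<in> frattini H}"
proof (intro equalityI subsetI)
  fix x assume x: "x \<in> frattini G"
  then have "h x \<in> M" if "maximal_subgroup M H" for M
    using maximal_subgroup_preimage[OF that] by (auto simp: frattini_mem)
  then show "x \<in> {x \<in> carrier G. h x \<in> frattini H}" using x by (simp add: frattini_mem)
next
  fix x assume x: "x \<in> {x \<in> carrier G. h x \<in> frattini H}"
  have "x \<in> M" if M: "maximal_subgroup M G" for M
  proof -
    have ker: "kernel G H h \<subseteq> M" using assms M by (auto simp: frattini_mem)
    have "h x \<in> h ` M" using maximal_subgroup_image[OF M ker] x by (simp add: frattini_mem)
    then show ?thesis using mem_of_image_mem ker x M by (simp add: maximal_subgroup_def)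
  qed
  then show "x \<in> frattini G" using x by (simp add: frattini_mem)
qed

end

lemma short_exact_frattini:
  assumes ex: "short_exact A E B f g" and le: "f ` carrier A \<subseteq> frattini E"
  shows "short_exact A (E\<lparr>carrier := frattini E\<rparr>) (B\<lparr>carrier := frattini B\<rparr>) f g"
proof -
  interpret f: group_hom A E f using ex by (simp add: short_exact_def)
  interpret g: surjective_hom E B g
    using ex by (simp add: short_exact_def surjective_hom_def surjective_hom_axioms_def)
  have im: "f ` carrier A = kernel E B g" using ex by (simp add: short_exact_def)
  have pre: "frattini E = {x \<in> carrier E. g x \<in> frattini B}"
    using g.frattini_eq_preimage le im by simp
  have onto: "g ` frattini E = frattini B"
  proof
    show "frattini B \<subseteq> g ` frattini E"
    proof
      fix y assume y: "y \<in> frattini B"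
      then obtain x where "x \<in> carrier E" "y = g x" using g.surj by (auto simp: frattini_mem)
      then show "y \<in> g ` frattini E" using y unfolding pre by blast
    qed
  qed (use pre in blast)
  have groups: "group (E\<lparr>carrier := frattini E\<rparr>)" "group (B\<lparr>carrier := frattini B\<rparr>)"
    using frattini_subgroup f.H.subgroup_imp_group g.H.subgroup_imp_group f.H.is_group g.H.is_group by blast+
  have sub: "x \<in> carrier E" if "x \<in> frattini E" for x using that by (simp add: frattini_mem)
  have hom_f: "group_hom A (E\<lparr>carrier := frattini E\<rparr>) f"
    by (rule group_homI[OF f.G.is_group groups(1)]) (use le in \<open>auto simp: hom_def\<close>)
  have hom_g: "group_hom (E\<lparr>carrier := frattini E\<rparr>) (B\<lparr>carrier := frattini B\<rparr>) g"
    by (rule group_homI[OF groups]) (use onto sub in \<open>auto simp: hom_def\<close>)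
  have ker: "kernel (E\<lparr>carrier := frattini E\<rparr>) (B\<lparr>carrier := frattini B\<rparr>) g = kernel E B g"
    using le unfolding im by (auto simp: kernel_def sub)
  show ?thesis
    unfolding short_exact_def ker using ex hom_f hom_g onto by (simp add: short_exact_def)
qed

text \<open>Suppose a maximal subgroup \<open>M\<close> does not contain \<open>A = [E,E]\<close>. Then \<open>E = AM\<close>, and as \<open>A\<close> is central,
every commutator of \<open>E\<close> is a commutator of \<open>M\<close>, so \<open>A \<le> M\<close> after all.\<close>

lemma (in group) central_derived_le_frattini:
  assumes central: "\<And>a x. a \<in> derived G (carrier G) \<Longrightarrow> x \<in> carrier G \<Longrightarrow> a \<otimes> x = x \<otimes> a"
  shows "derived G (carrier G) \<subseteq> frattini G"
proof -
  let ?A = "derived G (carrier G)"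
  have A: "subgroup ?A G" by (simp add: derived_is_subgroup)
  have "?A \<subseteq> M" if M: "maximal_subgroup M G" for M
  proof (rule ccontr)
    assume not_le: "\<not> ?A \<subseteq> M"
    have sub: "subgroup M G" using M by (simp add: maximal_subgroup_def)
    \<comment> \<open>\<open>L = AM\<close> is a subgroup because \<open>A\<close> is central.\<close>
    define L where "L = {a \<otimes> m | a m. a \<in> ?A \<and> m \<in> M}"
    have AG: "a \<in> carrier G" if "a \<in> ?A" for a using that subgroup.mem_carrier[OF A] by blast
    have MG: "m \<in> carrier G" if "m \<in> M" for m using that subgroup.mem_carrier[OF sub] by blast
    have "subgroup L G"
    proof (rule subgroupI)
      show "L \<subseteq> carrier G" using AG MG by (auto simp: L_def)
      show "L \<noteq> {}" using subgroup.one_closed[OF A] subgroup.one_closed[OF sub] by (auto simp: L_def)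
    next
      fix x assume "x \<in> L"
      then obtain a m where am: "a \<in> ?A" "m \<in> M" "x = a \<otimes> m" by (auto simp: L_def)
      have "inv x = inv a \<otimes> inv m"
        using am AG MG central[OF am(1), of m] by (simp flip: inv_mult_group)
      then show "inv x \<in> L"
        using am subgroup.m_inv_closed[OF A] subgroup.m_inv_closed[OF sub] by (auto simp: L_def)
    next
      fix x y assume "x \<in> L" "y \<in> L"
      then obtain a m b k where am: "a \<in> ?A" "m \<in> M" "x = a \<otimes> m" and bk: "b \<in> ?A" "k \<in> M" "y = b \<otimes> k"
        by (auto simp: L_def)
      have "x \<otimes> y = (a \<otimes> b) \<otimes> (m \<otimes> k)"
        using am bk AG MG central[OF bk(1), of m] by (metis m_assoc m_closed)
      moreover have "a \<otimes> b \<in> ?A" "m \<otimes> k \<in> M"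
        using am bk subgroup.m_closed[OF A] subgroup.m_closed[OF sub] by blast+
      ultimately show "x \<otimes> y \<in> L" unfolding L_def by blast
    qed
    moreover have "M \<subseteq> L"
    proof
      fix m assume "m \<in> M"
      then have "m = \<one> \<otimes> m" using MG by simp
      then show "m \<in> L" using \<open>m \<in> M\<close> subgroup.one_closed[OF A] unfolding L_def by blast
    qed
    moreover have "?A \<subseteq> L"
    proof
      fix a assume "a \<in> ?A"
      then have "a = a \<otimes> \<one>" using AG by simp
      then show "a \<in> L" using \<open>a \<in> ?A\<close> subgroup.one_closed[OF sub] unfolding L_def by blast
    qed
    ultimately have L: "L = carrier G" using M not_le by (auto simp: maximal_subgroup_def)
    have "?A \<subseteq> M"
      unfolding derived_eq_commutator_subgroup
    proof (rule commutator_subgroup_le[OF sub])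
      fix x y assume "x \<in> carrier G" "y \<in> carrier G"
      then have "x \<in> L" "y \<in> L" by (simp_all only: L)
      then obtain a m b k where am: "a \<in> ?A" "m \<in> M" "x = a \<otimes> m" and bk: "b \<in> ?A" "k \<in> M" "y = b \<otimes> k"
        unfolding L_def by blast
      have "x \<otimes> y \<otimes> inv x \<otimes> inv y = m \<otimes> k \<otimes> inv m \<otimes> inv k"
        unfolding am(3) bk(3) using am bk AG MG central by (intro commutator_mult_central) auto
      then show "x \<otimes> y \<otimes> inv x \<otimes> inv y \<in> M"
        using am bk subgroup.m_closed[OF sub] subgroup.m_inv_closed[OF sub] by simp
    qed
    then show False using not_le by blast
  qed
  then show ?thesis using subgroup.subset[OF A] unfolding frattini_def by blast
qed

text \<open>The preimage \<open>S\<close> of a maximal subgroup \<open>M\<close> of the Abelian group \<open>B\<close> is the whole group or maximal: if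
\<open>L\<close> is strictly larger than \<open>S\<close>, then \<open>e(L)M\<close> is strictly larger than \<open>M\<close>, so it is \<open>B\<close>, and dividing an
arbitrary \<open>e(g)\<close> by an element of \<open>e(L)\<close> lands in \<open>M\<close>.\<close>

lemma frattini_hom_into_abelian:
  assumes "group_hom G B e" "comm_group B" and x: "x \<in> frattini G"
  shows "e x \<in> frattini B"
proof -
  interpret group_hom G B e by fact
  interpret B: comm_group B by fact
  have "e x \<in> M" if M: "maximal_subgroup M B" for M
  proof -
    have sub: "subgroup M B" using M by (simp add: maximal_subgroup_def)
    have MB: "m \<in> carrier B" if "m \<in> M" for m using that subgroup.mem_carrier[OF sub] by blast
    let ?S = "{g \<in> carrier G. e g \<in> M}"
    have S: "subgroup ?S G" using sub by (rule subgroup_preimage)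
    show ?thesis
    proof (cases "?S = carrier G")
      case True
      then show ?thesis using x by (auto simp: frattini_mem)
    next
      case False
      have "maximal_subgroup ?S G"
        unfolding maximal_subgroup_def
      proof (intro conjI allI impI)
        fix L assume L: "subgroup L G" and SL: "?S \<subseteq> L"
        have LG: "L \<subseteq> carrier G" using L subgroup.subset by blast
        show "L = ?S \<or> L = carrier G"
        proof (rule disjCI)
          assume "L \<noteq> carrier G"
          then obtain g where g: "g \<in> carrier G" "g \<notin> L" using LG by blast
          let ?Q = "(e ` L) <#>\<^bsub>B\<^esub> M"
          have Q: "subgroup ?Q B" using B.mult_subgroups[OF subgroup_img_is_subgroup[OF L] sub] .
          have eL: "e l \<in> ?Q" if "l \<in> L" for l
          proof -
            have "e l = e l \<otimes>\<^bsub>B\<^esub> \<one>\<^bsub>B\<^esub>" using that LG by auto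
            then show ?thesis using that subgroup.one_closed[OF sub] unfolding set_mult_def by blast
          qed
          have "M \<subseteq> ?Q"
          proof
            fix m assume m: "m \<in> M"
            have "m = e \<one>\<^bsub>G\<^esub> \<otimes>\<^bsub>B\<^esub> m" using MB[OF m] by simp
            then show "m \<in> ?Q" using m subgroup.one_closed[OF L] unfolding set_mult_def by blast
          qed
          then have "?Q = M \<or> ?Q = carrier B" using M Q by (simp add: maximal_subgroup_def)
          moreover have "?Q \<noteq> carrier B"
          proof
            assume "?Q = carrier B"
            then have "e g \<in> ?Q" using g by simp
            then obtain l m where l: "l \<in> L" and m: "m \<in> M" and eq: "e g = e l \<otimes>\<^bsub>B\<^esub> m"
              by (auto simp: set_mult_def)
            have lG: "l \<in> carrier G" using l LG by blast
            have "e (inv\<^bsub>G\<^esub> l \<otimes>\<^bsub>G\<^esub> g) = m" using lG g MB[OF m] by (simp add: eq H.inv_mult_cancel)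
            then have "inv\<^bsub>G\<^esub> l \<otimes>\<^bsub>G\<^esub> g \<in> L" using SL lG g m by auto
            then have "l \<otimes>\<^bsub>G\<^esub> (inv\<^bsub>G\<^esub> l \<otimes>\<^bsub>G\<^esub> g) \<in> L" using l subgroup.m_closed[OF L] by blast
            then show False using g lG by (simp add: G.inv_mult_cancel)
          qed
          ultimately show "L = ?S" using eL SL LG by blast
        qed
      qed (use S False in auto)
      then show ?thesis using x by (auto simp: frattini_mem)
    qed
  qed
  then show ?thesis using x by (simp add: frattini_mem)
qed

text \<open>One inclusion uses the projections, along which maximal subgroups pull back. For the other one, a
tuple over \<open>\<Phi>(G)\<close> is the product of its coordinates, each embedded by a homomorphism
\<open>G \<rightarrow> G\<^sup>m\<close> into an Abelian group.\<close>

lemma frattini_direct_power: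
  assumes "comm_group G"
  shows "frattini (direct_power G m) = ({..<m} \<rightarrow>\<^sub>E frattini G)"
proof (intro equalityI subsetI)
  interpret comm_group G by fact
  let ?P = "direct_power G m"
  interpret P: comm_group ?P by (rule direct_power_comm_group[OF assms])
  {
    fix x assume x: "x \<in> frattini ?P"
    have "x i \<in> frattini G" if i: "i < m" for i
    proof -
      have "x i \<in> M" if M: "maximal_subgroup M G" for M
      proof -
        interpret pr: surjective_hom ?P G "\<lambda>f. f i"
        proof
          show "(\<lambda>f. f i) \<in> hom ?P G" using i by (auto simp: hom_def)
          show "(\<lambda>f. f i) ` carrier ?P = carrier G"
          proof
            show "carrier G \<subseteq> (\<lambda>f. f i) ` carrier ?P"
            proof
              fix g assume "g \<in> carrier G"
              then show "g \<in> (\<lambda>f. f i) ` carrier ?P"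
                using i by (intro image_eqI[of _ _ "\<lambda>j\<in>{..<m}. g"]) auto
            qed
          qed (use i in auto)
        qed
        show ?thesis using pr.maximal_subgroup_preimage[OF M] x by (auto simp: frattini_mem)
      qed
      then show ?thesis using x i by (auto simp: frattini_mem)
    qed
    moreover have "x \<in> carrier ?P" using x by (simp only: frattini_mem)
    ultimately show "x \<in> {..<m} \<rightarrow>\<^sub>E frattini G" by (auto simp: PiE_iff)
  }
  fix x assume x: "x \<in> {..<m} \<rightarrow>\<^sub>E frattini G"
  have \<Phi>: "subgroup (frattini ?P) ?P" by (rule frattini_subgroup[OF P.is_group])
  \<comment> \<open>\<open>y k\<close> keeps the first \<open>k\<close> coordinates of \<open>x\<close>.\<close>
  define y where "y k = (\<lambda>j\<in>{..<m}. if j < k then x j else \<one>\<^bsub>G\<^esub>)" for k :: nat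
  have "y k \<in> frattini ?P" if "k \<le> m" for k
    using that
  proof (induction k)
    case 0
    have "y 0 = \<one>\<^bsub>?P\<^esub>" by (simp add: y_def)
    then show ?case using subgroup.one_closed[OF \<Phi>] by (simp only:)
  next
    case (Suc k)
    define e where "e g = (\<lambda>j\<in>{..<m}. if j = k then g else \<one>\<^bsub>G\<^esub>)" for g
    have "group_hom G ?P e"
      by (rule group_homI[OF is_group P.is_group]) (auto simp: hom_def e_def intro!: restrict_ext)
    moreover have "x k \<in> frattini G" using PiE_mem[OF x, of k] Suc.prems by simp
    ultimately have "e (x k) \<in> frattini ?P" by (rule frattini_hom_into_abelian[OF _ P.comm_group_axioms])
    moreover have "y (Suc k) = y k \<otimes>\<^bsub>?P\<^esub> e (x k)"
    proof
      fix j
      have "x j \<in> carrier G" if "j < m" using PiE_mem[OF x, of j] that by (simp add: frattini_mem)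
      then show "y (Suc k) j = (y k \<otimes>\<^bsub>?P\<^esub> e (x k)) j"
        by (cases "j < m"; cases "j = k") (simp_all add: y_def e_def less_Suc_eq)
    qed
    moreover have "y k \<in> frattini ?P" using Suc by simp
    ultimately show ?case using subgroup.m_closed[OF \<Phi>] by (simp only:)
  qed
  moreover have "y m = x" using x by (auto simp: y_def fun_eq_iff PiE_iff extensional_def)
  ultimately show "x \<in> frattini ?P" by blast
qed

section \<open>Non-cyclic Abelian \<open>p\<close>-groups have nontrivial second homology\<close>

lemma (in group) ex_maximal_subgroup:
  assumes "finite (carrier G)" "subgroup H G" "H \<noteq> carrier G"
  obtains M where "maximal_subgroup M G" "H \<subseteq> M"
proof -
  define S where "S = {M. subgroup M G \<and> M \<noteq> carrier G \<and> H \<subseteq> M}"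
  have "S \<subseteq> Pow (carrier G)" unfolding S_def using subgroup.subset by blast
  then have "finite S" using assms(1) finite_subset finite_Pow_iff by blast
  moreover have "H \<in> S" using assms by (simp add: S_def)
  ultimately obtain M where M: "M \<in> S" and max: "\<forall>L\<in>S. M \<subseteq> L \<longrightarrow> M = L"
    using finite_has_maximal2[of S H] by blast
  have "L = M \<or> L = carrier G" if "subgroup L G" "M \<subseteq> L" for L
  proof (rule disjCI)
    assume "L \<noteq> carrier G"
    then have "L \<in> S" using that M unfolding S_def by blast
    then show "L = M" using max that(2) by blast
  qed
  then have "maximal_subgroup M G" using M by (simp add: maximal_subgroup_def S_def)
  then show thesis by (rule that) (use M in \<open>simp add: S_def\<close>)
qed

text \<open>By maximality, \<open>M\<close> and \<open>z\<close> generate the whole group.\<close>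

lemma (in comm_group) adjoin_to_maximal:
  assumes M: "maximal_subgroup M G" and z: "z \<in> carrier G" "z \<notin> M" and g: "g \<in> carrier G"
  obtains i :: int where "g \<otimes> inv (z [^] i) \<in> M"
proof -
  have sub: "subgroup M G" using M by (simp add: maximal_subgroup_def)
  have MG: "m \<in> carrier G" if "m \<in> M" for m using that subgroup.mem_carrier[OF sub] by blast
  have Z: "subgroup (generate G {z}) G" using z by (intro generate_is_subgroup) simp
  let ?L = "M <#> generate G {z}"
  have L: "subgroup ?L G" by (rule mult_subgroups[OF sub Z])
  have "M \<subseteq> ?L"
  proof
    fix m assume m: "m \<in> M"
    then have "m = m \<otimes> \<one>" using MG by simp
    then show "m \<in> ?L" using m subgroup.one_closed[OF Z] unfolding set_mult_def by blast
  qed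
  moreover have "z \<in> ?L"
  proof -
    have "z = \<one> \<otimes> z" using z by simp
    then show ?thesis using subgroup.one_closed[OF sub] generate.incl[of z "{z}"] unfolding set_mult_def by blast
  qed
  ultimately have "?L = carrier G" using M L z by (auto simp: maximal_subgroup_def)
  then have "g \<in> ?L" using g by simp
  then obtain m i where m: "m \<in> M" and i: "g = m \<otimes> z [^] (i :: int)"
    using generate_pow[OF z(1)] by (auto simp: set_mult_def)
  have "g \<otimes> inv (z [^] i) = m" using i z MG[OF m] by (simp add: m_assoc)
  then show thesis using that m by blast
qed

text \<open>Maximal subgroups of a finite Abelian \<open>p\<close>-group have index \<open>p\<close>. An exponent prime to \<open>p\<close> is invertible modulo
the order of \<open>x\<close>, so it cannot bring \<open>x\<close> into \<open>M\<close>. If \<open>x\<^sup>p\<close> were not in \<open>M\<close>, then \<open>M\<close> and \<open>x\<^sup>p\<close> would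
generate \<open>x\<close>, giving an exponent \<open>1 - pi\<close> that brings \<open>x\<close> into \<open>M\<close>.\<close>

lemma (in comm_group) pow_mem_maximal_iff:
  fixes p k :: nat and i :: int
  assumes p: "Factorial_Ring.prime p" and ord: "order G = p ^ k"
    and M: "maximal_subgroup M G" and x: "x \<in> carrier G" "x \<notin> M"
  shows "x [^] i \<in> M \<longleftrightarrow> int p dvd i"
proof -
  have sub: "subgroup M G" using M by (simp add: maximal_subgroup_def)
  have dvd: "int p dvd j" if j: "x [^] j \<in> M" for j :: int
  proof (rule ccontr)
    assume "\<not> int p dvd j"
    then have "coprime (int p) j" using p by (simp add: prime_imp_coprime)
    then have "coprime (int p ^ k) j" by simp
    then obtain u v where uv: "u * (int p ^ k) + v * j = 1"
      using bezout_int[of "int p ^ k" j] by (auto simp: coprime_iff_gcd_eq_1)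
    have "x [^] (int p ^ k) = \<one>"
      using pow_order_eq_1[OF x(1)] ord by (metis int_pow_int of_nat_power)
    then have "x [^] (u * (int p ^ k)) = \<one>"
      using x by (metis int_pow_one int_pow_pow mult.commute)
    moreover have "x [^] (v * j) \<in> M"
      using subgroup_int_pow_closed[OF sub j, of v] x by (simp add: int_pow_pow mult.commute)
    ultimately have "x [^] (u * (int p ^ k) + v * j) \<in> M"
      using x subgroup.mem_carrier[OF sub] by (simp add: int_pow_mult)
    then show False using uv x by simp
  qed
  have "x [^] int p \<in> M"
  proof (rule ccontr)
    assume notin: "x [^] int p \<notin> M"
    obtain i :: int where "x \<otimes> inv ((x [^] int p) [^] i) \<in> M"
      using adjoin_to_maximal[OF M _ notin x(1)] x by auto
    moreover have "x \<otimes> inv ((x [^] int p) [^] i) = x [^] (1 - int p * i)"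
      using x by (simp add: int_pow_pow int_pow_diff)
    ultimately have "int p dvd 1 - int p * i" using dvd by simp
    then have "int p dvd (1 - int p * i) + int p * i" by (intro dvd_add) auto
    then show False using p by (auto simp: zdvd1_eq dest: prime_gt_1_nat)
  qed
  then have "x [^] i \<in> M" if "int p dvd i"
    using that subgroup_int_pow_closed[OF sub, of "x [^] int p" "i div int p"] x
    by (simp add: int_pow_pow)
  then show ?thesis using dvd by blast
qed

text \<open>The homomorphism \<open>G \<rightarrow> G/M \<cong> \<int>/p\<close> with \<open>x \<mapsto> 1\<close>, given by integer representatives: \<open>\<alpha> g\<close> is an exponent
\<open>i\<close> with \<open>g x\<^sup>-\<^sup>i \<in> M\<close>.\<close>

lemma (in comm_group) ex_character_mod_p:
  fixes p k :: nat
  assumes p: "Factorial_Ring.prime p" and ord: "order G = p ^ k"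
    and M: "maximal_subgroup M G" and x: "x \<in> carrier G" "x \<notin> M"
  obtains \<alpha> :: "'a \<Rightarrow> int"
  where "\<And>g h. g \<in> carrier G \<Longrightarrow> h \<in> carrier G \<Longrightarrow> int p dvd \<alpha> (g \<otimes> h) - (\<alpha> g + \<alpha> h)"
    and "\<And>m. m \<in> M \<Longrightarrow> int p dvd \<alpha> m" and "int p dvd \<alpha> x - 1"
proof -
  have sub: "subgroup M G" using M by (simp add: maximal_subgroup_def)
  have MG: "m \<in> carrier G" if "m \<in> M" for m using that subgroup.mem_carrier[OF sub] by blast
  have "\<forall>g\<in>carrier G. \<exists>i::int. g \<otimes> inv (x [^] i) \<in> M"
    using adjoin_to_maximal[OF M x] by metis
  then obtain \<alpha> :: "'a \<Rightarrow> int" where \<alpha>: "\<And>g. g \<in> carrier G \<Longrightarrow> g \<otimes> inv (x [^] \<alpha> g) \<in> M" by metis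
  have unique: "int p dvd \<alpha> g - i" if g: "g \<in> carrier G" and i: "g \<otimes> inv (x [^] i) \<in> M" for g i
  proof -
    have "inv (g \<otimes> inv (x [^] \<alpha> g)) \<otimes> (g \<otimes> inv (x [^] i)) \<in> M"
      using subgroup.m_closed[OF sub subgroup.m_inv_closed[OF sub \<alpha>[OF g]] i] .
    moreover have "inv (g \<otimes> inv (x [^] \<alpha> g)) \<otimes> (g \<otimes> inv (x [^] i)) = x [^] (\<alpha> g - i)"
      using g x by (simp add: inv_mult_group m_assoc inv_mult_cancel int_pow_diff)
    ultimately show ?thesis using pow_mem_maximal_iff[OF p ord M x] by simp
  qed
  show thesis
  proof
    fix g h assume gh: "g \<in> carrier G" "h \<in> carrier G"
    have "(g \<otimes> inv (x [^] \<alpha> g)) \<otimes> (h \<otimes> inv (x [^] \<alpha> h)) \<in> M"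
      using subgroup.m_closed[OF sub \<alpha>[OF gh(1)] \<alpha>[OF gh(2)]] .
    moreover have "(g \<otimes> inv (x [^] \<alpha> g)) \<otimes> (h \<otimes> inv (x [^] \<alpha> h)) = (g \<otimes> h) \<otimes> inv (x [^] (\<alpha> g + \<alpha> h))"
      using gh x by (simp add: int_pow_mult inv_mult m_ac)
    ultimately show "int p dvd \<alpha> (g \<otimes> h) - (\<alpha> g + \<alpha> h)" using gh by (intro unique) simp_all
  next
    fix m assume "m \<in> M"
    then show "int p dvd \<alpha> m" using unique[of m 0] MG by simp
  next
    show "int p dvd \<alpha> x - 1" using unique[of x 1] x subgroup.one_closed[OF sub] by simp
  qed
qed

text \<open>Choose \<open>x\<close> outside a maximal subgroup \<open>M\<close>. As \<open>G\<close> is not cyclic, \<open>x\<close> lies in some maximal subgroup \<open>L\<close>,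
which then differs from \<open>M\<close>.\<close>

lemma (in comm_group) ex_independent_maximal_subgroups:
  assumes "finite (carrier G)" "\<not> cyclic_group G"
  obtains M L x y where "maximal_subgroup M G" "maximal_subgroup L G"
    "x \<in> carrier G" "x \<notin> M" "y \<in> M" "y \<notin> L"
proof -
  have "{\<one>} \<noteq> carrier G"
    using assms(2) trivial_imp_cyclic_group[of G] by (auto simp: trivial_group)
  then obtain M where M: "maximal_subgroup M G" using ex_maximal_subgroup[OF assms(1) triv_subgroup] by blast
  then have "M \<subseteq> carrier G" "M \<noteq> carrier G" using subgroup.subset by (auto simp: maximal_subgroup_def)
  then obtain x where x: "x \<in> carrier G" "x \<notin> M" by blast
  have "generate G {x} \<noteq> carrier G"
    using assms(2) x generate_pow[OF x(1)] by (auto simp: cyclic_group full_SetCompr_eq)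
  then obtain L where L: "maximal_subgroup L G" "generate G {x} \<subseteq> L"
    using ex_maximal_subgroup[OF assms(1) generate_is_subgroup, of "{x}"] x by blast
  then have xL: "x \<in> L" using generate.incl[of x "{x}"] by blast
  have "\<not> M \<subseteq> L"
  proof
    assume "M \<subseteq> L"
    then have "L = M \<or> L = carrier G" using M L(1) unfolding maximal_subgroup_def by blast
    then show False using L(1) xL x(2) by (auto simp: maximal_subgroup_def)
  qed
  then obtain y where "y \<in> M" "y \<notin> L" by blast
  then show thesis by (rule that[OF M L(1) x])
qed

text \<open>The bilinear map \<open>(g,h) \<mapsto> \<alpha>(g)\<beta>(h)\<close> is a cocycle modulo \<open>p\<close>, so the induced functional on 2-chains
vanishes modulo \<open>p\<close> on boundaries. Its value at the cycle \<open>[x|y] - [y|x]\<close> is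
\<open>\<alpha>(x)\<beta>(y) - \<alpha>(y)\<beta>(x)\<close>, which is \<open>1\<close> modulo \<open>p\<close> since \<open>\<alpha>(x)\<close> and \<open>\<beta>(y)\<close> are \<open>1\<close> and
\<open>\<alpha>(y)\<close> is \<open>0\<close>.\<close>

lemma H2_nontrivial:
  fixes G (structure) and p k :: nat
  assumes p: "Factorial_Ring.prime p" and G: "comm_group G" and fin: "finite (carrier G)"
    and ord: "order G = p ^ k" and nc: "\<not> cyclic_group G"
  shows "carrier (H2 G) \<noteq> {\<one>\<^bsub>H2 G\<^esub>}"
proof -
  interpret comm_group G by fact
  interpret bar_universal G by unfold_locales
  interpret I: comm_group integer_group by (rule abelian_integer_group)
  obtain M L x y where M: "maximal_subgroup M G" and L: "maximal_subgroup L G"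
    and xG: "x \<in> carrier G" and xy: "x \<notin> M" "y \<in> M" "y \<notin> L"
    using ex_independent_maximal_subgroups[OF fin nc] .
  have yG: "y \<in> carrier G"
    using xy(2) subgroup.mem_carrier[of M G] M by (simp add: maximal_subgroup_def)
  obtain \<alpha> :: "'a \<Rightarrow> int"
    where \<alpha>: "\<And>g h. g \<in> carrier G \<Longrightarrow> h \<in> carrier G \<Longrightarrow> int p dvd \<alpha> (g \<otimes> h) - (\<alpha> g + \<alpha> h)"
      and \<alpha>M: "\<And>m. m \<in> M \<Longrightarrow> int p dvd \<alpha> m" and \<alpha>x: "int p dvd \<alpha> x - 1"
    using ex_character_mod_p[OF p ord M xG xy(1)] by blast
  obtain \<beta> :: "'a \<Rightarrow> int"
    where \<beta>: "\<And>g h. g \<in> carrier G \<Longrightarrow> h \<in> carrier G \<Longrightarrow> int p dvd \<beta> (g \<otimes> h) - (\<beta> g + \<beta> h)"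
      and \<beta>y: "int p dvd \<beta> y - 1"
    by (rule ex_character_mod_p[OF p ord L yG xy(3)]) (rule that)
  obtain e where e: "e \<in> hom (bar_chains2 G) integer_group"
      and e_of: "\<And>z. z \<in> carrier G \<times> carrier G \<Longrightarrow> e (frag_of z) = \<alpha> (fst z) * \<beta> (snd z)"
    using I.free_Abelian_group_universal[of "\<lambda>z. \<alpha> (fst z) * \<beta> (snd z)" "carrier G \<times> carrier G"] by auto
  interpret e: group_hom "bar_chains2 G" integer_group e
    using e group_homI group_free_Abelian_group group_integer_group by blast
  interpret d3: group_hom "free_Abelian_group (carrier G \<times> carrier G \<times> carrier G)" "bar_chains2 G" "bar_d3 G"
    by (rule bar_d3_hom) (rule is_group)
  let ?S = "carrier G \<times> carrier G"
  have e_add: "e (a + b) = e a + e b" if "Poly_Mapping.keys a \<subseteq> ?S" "Poly_Mapping.keys b \<subseteq> ?S" for a b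
    using e.hom_mult[of a b] that by simp
  have e_diff: "e (a - b) = e a - e b" if "Poly_Mapping.keys a \<subseteq> ?S" "Poly_Mapping.keys b \<subseteq> ?S" for a b
    using e_add[of "a - b" b] that by (simp add: keys_frag_diff)
  have bounds: "int p dvd e b" if b: "b \<in> bar_bounds2 G" for b
  proof -
    obtain z where z: "Poly_Mapping.keys z \<subseteq> carrier G \<times> ?S" and b_eq: "b = bar_d3 G z" using b by auto
    have "Poly_Mapping.keys z \<subseteq> carrier G \<times> ?S \<and> int p dvd e (bar_d3 G z)"
      using z
    proof (induction rule: frag_induction)
      case zero
      then show ?case using e.hom_one by (simp add: bar_d3_def)
    next
      case (one t)
      then obtain g h l where t: "t = (g, h, l)" and in_G: "g \<in> carrier G" "h \<in> carrier G" "l \<in> carrier G"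
        by auto
      obtain u where "\<alpha> (g \<otimes> h) - (\<alpha> g + \<alpha> h) = int p * u"
        using \<alpha>[OF in_G(1,2)] by (elim dvdE)
      then have u: "\<alpha> (g \<otimes> h) = \<alpha> g + \<alpha> h + int p * u" by simp
      obtain v where "\<beta> (h \<otimes> l) - (\<beta> h + \<beta> l) = int p * v"
        using \<beta>[OF in_G(2,3)] by (elim dvdE)
      then have v: "\<beta> (h \<otimes> l) = \<beta> h + \<beta> l + int p * v" by simp
      have "e (bar_d3 G (frag_of t)) = \<alpha> h * \<beta> l - \<alpha> (g \<otimes> h) * \<beta> l + \<alpha> g * \<beta> (h \<otimes> l) - \<alpha> g * \<beta> h"
        using in_G by (simp add: t bar_d3_def e_add e_diff e_of keys_frag_add keys_frag_diff keys_frag_of)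
      also have "\<dots> = int p * (\<alpha> g * v - u * \<beta> l)"
        unfolding u v by (simp add: algebra_simps)
      finally show ?case using one by (simp add: keys_frag_of)
    next
      case (diff a b)
      have "Poly_Mapping.keys (bar_d3 G a) \<subseteq> ?S" "Poly_Mapping.keys (bar_d3 G b) \<subseteq> ?S"
        using d3.hom_closed[of a] d3.hom_closed[of b] diff by simp_all
      then show ?case
        using diff by (simp add: keys_frag_diff bar_d3_def frag_extend_diff e_diff[unfolded bar_d3_def] dvd_diff)
    qed
    then show ?thesis by (simp add: b_eq)
  qed
  let ?z = "frag_of (x, y) - frag_of (y, x)"
  have z: "?z \<in> carrier (bar_chains2 G)" using xG yG by (simp add: keys_frag_diff keys_frag_of)
  have cycle: "?z \<in> bar_cycles2 G"
    using z xG yG by (simp add: kernel_def bar_d2_def frag_extend_diff m_comm)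
  have "\<not> int p dvd e ?z"
  proof
    assume "int p dvd e ?z"
    then have "int p dvd \<alpha> x * \<beta> y - \<alpha> y * \<beta> x" using xG yG by (simp add: e_diff e_of keys_frag_of)
    moreover have "int p dvd \<alpha> y * \<beta> x" using \<alpha>M[OF xy(2)] by (rule dvd_mult2)
    moreover have "int p dvd (\<alpha> x - 1) * \<beta> y + (\<beta> y - 1)" using \<alpha>x \<beta>y by (intro dvd_add dvd_mult2)
    ultimately have "int p dvd (\<alpha> x * \<beta> y - \<alpha> y * \<beta> x) + \<alpha> y * \<beta> x - ((\<alpha> x - 1) * \<beta> y + (\<beta> y - 1))"
      by (rule dvd_diff[OF dvd_add])
    moreover have "(\<alpha> x * \<beta> y - \<alpha> y * \<beta> x) + \<alpha> y * \<beta> x - ((\<alpha> x - 1) * \<beta> y + (\<beta> y - 1)) = 1"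
      by (simp add: algebra_simps)
    ultimately have "int p dvd 1" by (simp only:)
    then show False using p by (auto simp: zdvd1_eq dest: prime_gt_1_nat)
  qed
  then have "cls ?z \<noteq> \<one>\<^bsub>coeffs\<^esub>" using bounds cls_one[OF z] by blast
  moreover have "cls ?z \<in> carrier (H2 G)" using cycle by (simp add: H2_eq)
  moreover have "\<one>\<^bsub>H2 G\<^esub> = \<one>\<^bsub>coeffs\<^esub>" by (simp add: H2_eq)
  ultimately show ?thesis by auto
qed

section \<open>The commutator subgroup and the Frattini subgroup of \<open>\<K>~(G, n)\<close>\<close>

lemma group_H2: "group G \<Longrightarrow> group (H2 G)"
proof -
  assume "group G"
  then interpret bar_universal G by (simp add: bar_universal_def)
  interpret cls: group_hom "bar_chains2 G" coeffs cls by (rule cls_hom)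
  have "subgroup (cls ` bar_cycles2 G) coeffs"
    by (rule cls.subgroup_img_is_subgroup[OF group_hom.subgroup_kernel[OF bar_d2_hom[OF is_group]]])
  then show "group (H2 G)" unfolding H2_eq by (rule U.A.subgroup_imp_group)
qed

lemma direct_power_frattini:
  assumes "comm_group G"
  shows "(direct_power G m)\<lparr>carrier := frattini (direct_power G m)\<rparr> = direct_power (G\<lparr>carrier := frattini G\<rparr>) m"
  unfolding frattini_direct_power[OF assms] by (simp add: product_group_def)

context abelian_presentation
begin

text \<open>Any isomorphism \<open>h\<close> will do, because only the image and the kernel of the composite matter.\<close>

lemma central_short_exact_hopf:
  assumes h: "h \<in> iso (H2 G) (hopf_group F N)"
  shows "central_short_exact (H2 G) KT (direct_power G (n - 1))
    (hopf_to_K_tilde F N n \<circ> h) (\<lambda>A. the_elem (\<rho> ` A))"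
    and "(hopf_to_K_tilde F N n \<circ> h) ` carrier (H2 G) = \<iota> ` D"
proof -
  interpret j: group_hom "hopf_group F N" KT "hopf_to_K_tilde F N n" by (rule hopf_to_K_tilde_hom)
  have "group_hom (H2 G) (hopf_group F N) h"
    using h by (intro group_homI[OF group_H2[OF H.is_group] j.G.is_group]) (simp add: iso_def)
  then have hom: "group_hom (H2 G) KT (hopf_to_K_tilde F N n \<circ> h)"
    by (rule group_hom_comp[OF _ j.group_hom_axioms])
  have h_image: "h ` carrier (H2 G) = carrier (hopf_group F N)" and h_inj: "inj_on h (carrier (H2 G))"
    using h by (auto simp: iso_def bij_betw_def)
  show image: "(hopf_to_K_tilde F N n \<circ> h) ` carrier (H2 G) = \<iota> ` D"
    unfolding image_comp[symmetric] h_image by (rule hopf_to_K_tilde_image)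
  have inj: "inj_on (hopf_to_K_tilde F N n \<circ> h) (carrier (H2 G))"
    using h_inj hopf_to_K_tilde_inj by (intro comp_inj_on) (simp_all add: h_image)
  show "central_short_exact (H2 G) KT (direct_power G (n - 1))
    (hopf_to_K_tilde F N n \<circ> h) (\<lambda>A. the_elem (\<rho> ` A))"
    unfolding central_short_exact_def short_exact_def
  proof (intro conjI ballI)
    fix a A assume a: "a \<in> carrier (H2 G)" and A: "A \<in> carrier KT"
    have "(hopf_to_K_tilde F N n \<circ> h) a \<in> \<iota> ` D" unfolding image[symmetric] using a by (rule imageI)
    then show "(hopf_to_K_tilde F N n \<circ> h) a \<otimes>\<^bsub>KT\<^esub> A = A \<otimes>\<^bsub>KT\<^esub> (hopf_to_K_tilde F N n \<circ> h) a"
      using \<iota>_central[OF _ A] by auto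
  qed (fact hom induced_hom inj induced_surj image[folded kernel_induced])+
qed

lemma derived_le_frattini: "\<iota> ` D \<subseteq> frattini KT"
proof -
  interpret \<kappa>: group_hom KF KT \<kappa> by (rule \<kappa>_hom)
  show ?thesis
    unfolding derived_KT[symmetric]
    by (rule \<kappa>.H.central_derived_le_frattini) (use \<iota>_central in \<open>auto simp: derived_KT\<close>)
qed

lemma nilpotent_class_2:
  assumes "\<iota> ` D \<noteq> {\<one>\<^bsub>KT\<^esub>}"
  shows "nilpotent_of_class KT 2"
proof -
  interpret \<kappa>: group_hom KF KT \<kappa> by (rule \<kappa>_hom)
  have one: "lower_central KT 1 = \<iota> ` D"
    using derived_KT by (simp add: derived_eq_commutator_subgroup)
  have sub: "\<iota> ` D \<subseteq> carrier KT"
    unfolding derived_KT[symmetric] by (rule \<kappa>.H.derived_in_carrier[OF order_refl])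
  have "commutator_subgroup KT (\<iota> ` D) (carrier KT) \<subseteq> {\<one>\<^bsub>KT\<^esub>}"
  proof (rule \<kappa>.H.commutator_subgroup_le[OF \<kappa>.H.triv_subgroup])
    fix a b assume a: "a \<in> \<iota> ` D" and b: "b \<in> carrier KT"
    then have "a \<otimes>\<^bsub>KT\<^esub> b = b \<otimes>\<^bsub>KT\<^esub> a" using \<iota>_central by auto
    moreover have "a \<in> carrier KT" using a sub by blast
    ultimately show "a \<otimes>\<^bsub>KT\<^esub> b \<otimes>\<^bsub>KT\<^esub> inv\<^bsub>KT\<^esub> a \<otimes>\<^bsub>KT\<^esub> inv\<^bsub>KT\<^esub> b \<in> {\<one>\<^bsub>KT\<^esub>}"
      using b by (simp add: \<kappa>.H.m_assoc)
  qed
  moreover have "\<one>\<^bsub>KT\<^esub> \<in> commutator_subgroup KT (\<iota> ` D) (carrier KT)"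
    unfolding commutator_subgroup_def by (rule generate.one)
  ultimately have two: "lower_central KT 2 = {\<one>\<^bsub>KT\<^esub>}"
    using one by (simp add: numeral_2_eq_2) blast
  have "carrier KT \<noteq> {\<one>\<^bsub>KT\<^esub>}"
  proof
    assume "carrier KT = {\<one>\<^bsub>KT\<^esub>}"
    then have "\<iota> ` D \<subseteq> {\<one>\<^bsub>KT\<^esub>}" using sub by simp
    moreover have "\<one>\<^bsub>KT\<^esub> \<in> \<iota> ` D"
      unfolding derived_KT[symmetric]
      by (rule subgroup.one_closed[OF \<kappa>.H.derived_is_subgroup[OF order_refl]])
    ultimately show False using assms by (metis empty_iff subset_singletonD)
  qed
  then have "lower_central KT k \<noteq> {\<one>\<^bsub>KT\<^esub>}" if "k < 2" for k
    using that one assms by (cases "k = 0") (auto simp: less_2_cases_iff)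
  then show ?thesis
    using two \<kappa>.H.is_group by (simp add: nilpotent_of_class_def)
qed

end

theorem proposition4p6:
  fixes G :: "('a, 'b) monoid_scheme"
    and F :: "('f, 'c) monoid_scheme"
    and N :: "'f set"
    and \<phi> :: "'f set \<Rightarrow> 'a"
    and p n :: nat
  assumes "Factorial_Ring.prime p"
    and "comm_group G" and "finite (carrier G)" and "\<exists>k. order G = p ^ k"
    and "n \<ge> 3"
    and "free_group F" and "N \<lhd> F" and "\<phi> \<in> iso (F Mod N) G"
  shows "(\<not> cyclic_group G \<longrightarrow> nilpotent_of_class (K_tilde F N n) 2) \<and>
         H2 G \<cong> hopf_group F N \<and>
         (\<forall>h \<in> iso (H2 G) (hopf_group F N).
            central_short_exact (H2 G) (K_tilde F N n) (direct_power G (n - 1))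
              (hopf_to_K_tilde F N n \<circ> h) (K_tilde_to_power F N \<phi> n) \<and>
            derived (K_tilde F N n) (carrier (K_tilde F N n)) =
              (hopf_to_K_tilde F N n \<circ> h) ` carrier (H2 G) \<and>
            short_exact (H2 G)
              ((K_tilde F N n)\<lparr>carrier := frattini (K_tilde F N n)\<rparr>)
              (direct_power (G\<lparr>carrier := frattini G\<rparr>) (n - 1))
              (hopf_to_K_tilde F N n \<circ> h) (K_tilde_to_power F N \<phi> n))"
proof -
  interpret comm_G: comm_group G by fact
  interpret N: normal N F by fact
  define \<pi> where "\<pi> x = \<phi> (N #>\<^bsub>F\<^esub> x)" for x
  have \<phi>: "group_hom (F Mod N) G \<phi>"
    using assms(8) by (intro group_homI[OF N.factorgroup_is_group comm_G.is_group]) (simp add: iso_def)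
  have \<phi>_bij: "bij_betw \<phi> (carrier (F Mod N)) (carrier G)" using assms(8) by (simp add: iso_def)
  have \<pi>_hom: "group_hom F G \<pi>"
    using group_hom_comp[OF group_hom_coset[OF assms(7)] \<phi>] by (simp add: \<pi>_def[abs_def] comp_def)
  have \<pi>_surj: "\<pi> ` carrier F = carrier G"
    using \<phi>_bij by (simp add: \<pi>_def[abs_def] bij_betw_def carrier_FactGroup image_image)
  interpret abelian_presentation F G \<pi> n
    using \<pi>_hom \<pi>_surj assms(2,5)
    by (simp add: abelian_presentation_def abelian_presentation_axioms_def presentation_def presentation_axioms_def)
  have kernel: "kernel F G \<pi> = N"
  proof -
    have "\<pi> x = \<one>\<^bsub>G\<^esub> \<longleftrightarrow> x \<in> N" if x: "x \<in> carrier F" for x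
    proof -
      have one: "\<phi> N = \<one>\<^bsub>G\<^esub>" using group_hom.hom_one[OF \<phi>] by simp
      have "N \<in> carrier (F Mod N)" using group.is_monoid[OF N.factorgroup_is_group] monoid.one_closed by force
      moreover have "N #>\<^bsub>F\<^esub> x \<in> carrier (F Mod N)" using x by (simp add: carrier_FactGroup)
      ultimately have "\<pi> x = \<one>\<^bsub>G\<^esub> \<longleftrightarrow> N #>\<^bsub>F\<^esub> x = N"
        unfolding \<pi>_def one[symmetric] using \<phi>_bij by (auto simp: bij_betw_def inj_on_def)
      then show ?thesis using coset_eq_iff_mem[OF group_hom.axioms(1)[OF \<pi>_hom] N.subgroup_axioms x] by simp
    qed
    then show ?thesis using N.subset by (auto simp: kernel_def)
  qed
  have to_power: "K_tilde_to_power F N \<phi> n = (\<lambda>A. the_elem (\<rho> ` A))"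
    by (simp add: K_tilde_to_power_def[abs_def] \<rho>_def[abs_def] \<pi>_def)
  have hopf: "H2 G \<cong> hopf_group F N"
    using hopf_formula[OF assms(6)] unfolding kernel .
  note exact = central_short_exact_hopf[unfolded kernel]
  have main: "central_short_exact (H2 G) (K_tilde F N n) (direct_power G (n - 1))
              (hopf_to_K_tilde F N n \<circ> h) (K_tilde_to_power F N \<phi> n) \<and>
            derived (K_tilde F N n) (carrier (K_tilde F N n)) =
              (hopf_to_K_tilde F N n \<circ> h) ` carrier (H2 G) \<and>
            short_exact (H2 G)
              ((K_tilde F N n)\<lparr>carrier := frattini (K_tilde F N n)\<rparr>)
              (direct_power (G\<lparr>carrier := frattini G\<rparr>) (n - 1))
              (hopf_to_K_tilde F N n \<circ> h) (K_tilde_to_power F N \<phi> n)"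
    if h: "h \<in> iso (H2 G) (hopf_group F N)" for h
  proof (intro conjI)
    show ex: "central_short_exact (H2 G) (K_tilde F N n) (direct_power G (n - 1))
              (hopf_to_K_tilde F N n \<circ> h) (K_tilde_to_power F N \<phi> n)"
      unfolding to_power by (rule exact(1)[OF h])
    show "derived (K_tilde F N n) (carrier (K_tilde F N n)) =
              (hopf_to_K_tilde F N n \<circ> h) ` carrier (H2 G)"
      unfolding exact(2)[OF h] by (rule derived_KT[unfolded kernel])
    show "short_exact (H2 G)
              ((K_tilde F N n)\<lparr>carrier := frattini (K_tilde F N n)\<rparr>)
              (direct_power (G\<lparr>carrier := frattini G\<rparr>) (n - 1))
              (hopf_to_K_tilde F N n \<circ> h) (K_tilde_to_power F N \<phi> n)"
      unfolding direct_power_frattini[OF assms(2), symmetric]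
    proof (rule short_exact_frattini)
      show "short_exact (H2 G) (K_tilde F N n) (direct_power G (n - 1))
              (hopf_to_K_tilde F N n \<circ> h) (K_tilde_to_power F N \<phi> n)"
        using ex by (simp only: central_short_exact_def)
      show "(hopf_to_K_tilde F N n \<circ> h) ` carrier (H2 G) \<subseteq> frattini (K_tilde F N n)"
        unfolding exact(2)[OF h] by (rule derived_le_frattini[unfolded kernel])
    qed
  qed
  have "nilpotent_of_class (K_tilde F N n) 2" if nc: "\<not> cyclic_group G"
  proof -
    obtain k where k: "order G = p ^ k" using assms(4) by blast
    obtain h where h: "h \<in> iso (H2 G) (hopf_group F N)" using hopf unfolding is_iso_def by blast
    let ?f = "hopf_to_K_tilde F N n \<circ> h"
    have hom: "group_hom (H2 G) (K_tilde F N n) ?f" and inj: "inj_on ?f (carrier (H2 G))"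
      using main[OF h] unfolding central_short_exact_def short_exact_def by blast+
    have H2: "group (H2 G)" by (rule group_H2[OF comm_G.is_group])
    obtain a where a: "a \<in> carrier (H2 G)" "a \<noteq> \<one>\<^bsub>H2 G\<^esub>"
      using H2_nontrivial[OF assms(1-3) k nc] group.is_monoid[OF H2] monoid.one_closed by blast
    then have "?f a \<noteq> ?f \<one>\<^bsub>H2 G\<^esub>"
      using inj group.is_monoid[OF H2] monoid.one_closed by (metis inj_onD)
    then have "?f a \<noteq> \<one>\<^bsub>K_tilde F N n\<^esub>" using group_hom.hom_one[OF hom] by simp
    then have "\<iota> ` D \<noteq> {\<one>\<^bsub>K_tilde F N n\<^esub>}"
      unfolding exact(2)[OF h, symmetric] using a(1) by blast
    then show ?thesis by (rule nilpotent_class_2[unfolded kernel])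
  qed
  then show ?thesis using hopf main by blast
qed

end
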